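(* Let $\mathcal{H}$ be a regular unitarily invariant complete Pick space on $\mathbb{B}_d$. A compact set $E\subset\partial\mathbb{B}_d$ is an unboundedness set for $\mathcal{H}$ if and only if $E$ is $\operatorname{Mult}(\mathcal{H})$-totally null.
   Context: $\mathbb{B}_d$ is the open unit ball of $\mathbb{C}^d$. A regular unitarily invariant space is a reproducing kernel Hilbert space $\mathcal{H}$ on $\mathbb{B}_d$ with kernel $K(z,w)=\sum_{n\ge0}a_n\langle z,w\rangle^n$, where $a_0=1$, $a_n>0$ for all $n$, and $\lim_{n\to\infty}a_n/a_{n+1}=1$. It is a complete Pick space if the coefficients $b_n$ defined by $\sum_{n\ge1}b_nt^n=1-\big(\sum_{n\ge0}a_nt^n\big)^{-1}$ satisfy $b_n\ge0$ for all $n\ge1$. $\operatorname{Mult}(\mathcal{H})$ is the multiplier algebra with the multiplier (operator) norm; identified with a WOT-closed subalgebra of $\mathcal{B}(\mathcal{H})$ it is a dual space with a weak-$*$ topology. A complex regular Borel measure $\mu$ on $\partial\mathbb{B}_d$ is $\operatorname{Mult}(\mathcal{H})$-Henkin if $p\mapsto\int p\,d\mu$ on polynomials extends to a weak-$*$ continuous functional on $\operatorname{Mult}(\mathcal{H})$; a Borel set $E\subset\partial\mathbb{B}_d$ is $\operatorname{Mult}(\mathcal{H})$-totally null if $|\mu|(E)=0$ for all $\operatorname{Mult}(\mathcal{H})$-Henkin measures $\mu$. A compact $E\subset\partial\mathbb{B}_d$ is an unboundedness set for $\mathcal{H}$ if there exists $f\in\mathcal{H}$ with $\lim_{r\nearrow1}|f(r\zeta)|=\infty$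 for all $\zeta\in E$. *)

theory Defs
  imports "HOL-Analysis.Analysis" "HOL-Computational_Algebra.Formal_Power_Series"
begin

definition cinner :: "complex^'d \<Rightarrow> complex^'d \<Rightarrow> complex" where
  "cinner z w = (\<Sum>i\<in>UNIV. z $ i * cnj (w $ i))"

definition open_ball :: "(complex^'d) set" where
  "open_ball = {z. norm z < 1}"

definition unit_sphere :: "(complex^'d) set" where
  "unit_sphere = {z. norm z = 1}"

definition UI_kernel :: "(nat \<Rightarrow> real) \<Rightarrow> complex^'d \<Rightarrow> complex^'d \<Rightarrow> complex" where
  "UI_kernel a z w = (\<Sum>n. complex_of_real (a n) * (cinner z w) ^ n)"

definition regular_UI :: "(nat \<Rightarrow> real) \<Rightarrow> bool" where
  "regular_UI a \<longleftrightarrow> a 0 = 1 \<and> (\<forall>n. a n > 0) \<and> (\<lambda>n. a n / a (Suc n)) \<longlonglongrightarrow> 1"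

definition complete_pick :: "(nat \<Rightarrow> real) \<Rightarrow> bool" where
  "complete_pick a \<longleftrightarrow> (\<forall>n\<ge>1. fps_nth (1 - inverse (Abs_fps a)) n \<ge> 0)"

definition pos_kernel :: "'a set \<Rightarrow> ('a \<Rightarrow> 'a \<Rightarrow> complex) \<Rightarrow> bool" where
  "pos_kernel S k \<longleftrightarrow>
     (\<forall>(m::nat) (x::nat \<Rightarrow> 'a) (c::nat \<Rightarrow> complex). (\<forall>i<m. x i \<in> S) \<longrightarrow>
        (let s = (\<Sum>i<m. \<Sum>j<m. cnj (c i) * c j * k (x i) (x j)) in Im s = 0 \<and> Re s \<ge> 0))"

text \<open>The reproducing kernel Hilbert space H(K) on the ball (Aronszajn): f belongs to H with
  norm at most C iff C^2 K(z,w) - f(z) conj(f(w)) is a positive kernel on the ball.\<close>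
definition H_bound :: "(nat \<Rightarrow> real) \<Rightarrow> (complex^'d \<Rightarrow> complex) \<Rightarrow> real \<Rightarrow> bool" where
  "H_bound a f C \<longleftrightarrow> C \<ge> 0 \<and>
     pos_kernel open_ball (\<lambda>z w. complex_of_real (C\<^sup>2) * UI_kernel a z w - f z * cnj (f w))"

definition in_H :: "(nat \<Rightarrow> real) \<Rightarrow> (complex^'d \<Rightarrow> complex) \<Rightarrow> bool" where
  "in_H a f \<longleftrightarrow> (\<exists>C. H_bound a f C)"

definition H_norm :: "(nat \<Rightarrow> real) \<Rightarrow> (complex^'d \<Rightarrow> complex) \<Rightarrow> real" where
  "H_norm a f = Inf {C. H_bound a f C}"

text \<open>Inner product of H (linear in the first argument), by polarization.\<close>
definition H_inner :: "(nat \<Rightarrow> real) \<Rightarrow> (complex^'d \<Rightarrow> complex) \<Rightarrow> (complex^'d \<Rightarrow> complex) \<Rightarrow> complex" where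
  "H_inner a f g = (1/4) * (\<Sum>k<4::nat. \<i> ^ k * complex_of_real ((H_norm a (\<lambda>z. f z + \<i> ^ k * g z))\<^sup>2))"

inductive cpoly :: "(complex^'d \<Rightarrow> complex) \<Rightarrow> bool" where
  cpoly_const: "cpoly (\<lambda>z. c)"
| cpoly_coord: "cpoly (\<lambda>z. z $ i)"
| cpoly_add: "cpoly p \<Longrightarrow> cpoly q \<Longrightarrow> cpoly (\<lambda>z. p z + q z)"
| cpoly_mult: "cpoly p \<Longrightarrow> cpoly q \<Longrightarrow> cpoly (\<lambda>z. p z * q z)"

text \<open>A complex regular Borel measure mu on the sphere is represented as mu = h nu, with nu a
  finite positive Borel measure concentrated on the sphere and h in L^1(nu);
  then |mu|(E) = integral over E of |h| d nu.\<close>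
definition sphere_cmeasure :: "(complex^'d) measure \<Rightarrow> (complex^'d \<Rightarrow> complex) \<Rightarrow> bool" where
  "sphere_cmeasure \<nu> h \<longleftrightarrow> sets \<nu> = sets borel \<and> finite_measure \<nu> \<and>
     emeasure \<nu> (UNIV - unit_sphere) = 0 \<and> integrable \<nu> h"

text \<open>Mult(H)-Henkin: p \<mapsto> integral p d mu extends to a weak-* continuous functional on Mult(H).
  The weak-* continuous functionals on Mult(H) (a weak-* closed subalgebra of B(H)) are exactly
  phi \<mapsto> sum_n <phi f_n, g_n> with sum ||f_n||^2, sum ||g_n||^2 finite.\<close>
definition Henkin :: "(nat \<Rightarrow> real) \<Rightarrow> (complex^'d) measure \<Rightarrow> (complex^'d \<Rightarrow> complex) \<Rightarrow> bool" where
  "Henkin a \<nu> h \<longleftrightarrow> sphere_cmeasure \<nu> h \<and>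
     (\<exists>F G :: nat \<Rightarrow> complex^'d \<Rightarrow> complex.
        (\<forall>n. in_H a (F n) \<and> in_H a (G n)) \<and>
        summable (\<lambda>n. (H_norm a (F n))\<^sup>2) \<and> summable (\<lambda>n. (H_norm a (G n))\<^sup>2) \<and>
        (\<forall>p. cpoly p \<longrightarrow>
           (LINT x|\<nu>. p x * h x) = (\<Sum>n. H_inner a (\<lambda>z. p z * F n z) (G n))))"

definition totally_null :: "(nat \<Rightarrow> real) \<Rightarrow> (complex^'d) set \<Rightarrow> bool" where
  "totally_null a E \<longleftrightarrow> E \<in> sets borel \<and> E \<subseteq> unit_sphere \<and>
     (\<forall>\<nu> h. Henkin a \<nu> h \<longrightarrow> (\<integral>\<^sup>+ x\<in>E. ennreal (cmod (h x)) \<partial>\<nu>) = 0)"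

definition unboundedness_set :: "(nat \<Rightarrow> real) \<Rightarrow> (complex^'d) set \<Rightarrow> bool" where
  "unboundedness_set a E \<longleftrightarrow> compact E \<and> E \<subseteq> unit_sphere \<and>
     (\<exists>f. in_H a f \<and>
        (\<forall>\<zeta>\<in>E. filterlim (\<lambda>r::real. cmod (f (r *\<^sub>R \<zeta>))) at_top (at_left 1)))"

end

theory Submission
  imports Defs "HOL-Probability.Probability"
begin

text \<open>
  Write the kernel as \<open>K = 1 / (1 - b)\<close>. The complete Pick property makes multiplication by \<open>b(\<cdot>,w)\<close>
  contractive, so that multiplication by \<open>K(\<cdot>,w)\<close>, and by every potential
  \<open>f = \<Sum>\<^sub>x c\<^sub>x K(\<cdot>, t x)\<close> with weights \<open>c\<^sub>x \<ge> 0\<close>, \<open>x \<in> E\<close>, \<open>t < 1\<close>, is accretive. Both properties of \<open>E\<close> are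
  equivalent to \<open>E\<close> having capacity zero: the energies \<open>\<Sum> c\<^sub>x c\<^sub>y K(x, t y)\<close> of probability weights
  become arbitrarily large, uniformly in the weights, as \<open>t\<close> tends to 1.

  If the capacity is zero, then potentials of almost minimal energy \<open>e\<close> satisfy \<open>Re f \<ge> e - 1\<close> on \<open>E\<close>,
  \<open>Re f \<ge> 0\<close> on the ball and have norm at most \<open>\<surd>e\<close>. Summing suitable \<open>f / e\<close> gives a function that is unbounded
  at every point of \<open>E\<close>. Moreover the functions \<open>f / (f + \<surd>e)\<close> are contractive multipliers that tend to the
  indicator function of \<open>E\<close> on the closed ball, so a Henkin measure gives measure 0 to \<open>E\<close>; as this also holds for the
  compact subsets of \<open>E\<close>, its total variation vanishes on \<open>E\<close>.

  If the capacity is positive, weights of bounded energy have a weak limit \<open>\<mu>\<close>, a probability measure on \<open>E\<close> with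
  \<open>\<integral> p d\<mu> = \<langle>p, g\<rangle>\<close> for some \<open>g\<close> in the space. Hence \<open>\<mu>\<close> is Henkin and \<open>E\<close> is not totally null. Accretivity gives
  \<open>\<integral> |h|\<^sup>2 / |k + s|\<^sup>2 d\<mu> \<le> \<parallel>h\<parallel>\<^sup>2 / (2 s)\<close> for the dilated potential \<open>k\<close> of \<open>\<mu>\<close> and the dilates of all \<open>h\<close>
  in the space. Applied to \<open>h = k\<close> and to \<open>h = f\<close>, this shows that \<open>|f(r \<zeta>)|\<close> stays bounded, uniformly in \<open>r\<close>, on sets of
  measure at least 1/2.
\<close>

section \<open>Positive kernels\<close>

text \<open>The space is given only by the bounds \<open>H_bound\<close>: its norm is an infimum and
  its inner product a polarization formula. Everything is therefore reduced to finite combinations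
  of kernel functions, for which norms and pairings are finite sums, and reaches other functions by
  density and continuity. The kernel lives on the open ball, while both properties of
  \<open>E\<close> concern the sphere, where elements of the space need not have values and K(x,x)
  may be infinite. Hence the dilations: energies are measured with K(x, t y), t < 1. They increase
  with t, so a bound at one t passes down to all smaller ones; limits in the weights are taken at a
  fixed dilation, and the dilation tends to 1 afterwards. Accretivity is kept in a sharp form, with
  the rank-one kernel K(z,w) cnj(K(v,w)) subtracted. The weaker form without that term yields the
  contractive quotients f / (f + s); the subtracted term is what makes the weighted estimate for
  |h|^2 / |k + s|^2 close.\<close>

definition bform :: "'x set \<Rightarrow> ('x \<Rightarrow> 'x \<Rightarrow> complex) \<Rightarrow> ('x \<Rightarrow> complex) \<Rightarrow> ('x \<Rightarrow> complex) \<Rightarrow> complex" where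
  "bform S k c d = (\<Sum>x\<in>S. \<Sum>y\<in>S. cnj (c x) * d y * k x y)"

text \<open>Finite sets instead of finite sequences: a sum can be enlarged by coefficients that
  vanish off a subset, as in \<open>bform_extend\<close>. Membership in the nonnegative reals
  contains the vanishing of the imaginary part, from which Hermitian symmetry is recovered.\<close>

definition psd :: "'x set \<Rightarrow> ('x \<Rightarrow> 'x \<Rightarrow> complex) \<Rightarrow> bool" where
  "psd A k \<longleftrightarrow> (\<forall>S c. finite S \<longrightarrow> S \<subseteq> A \<longrightarrow> bform S k c c \<in> \<real>\<^sub>\<ge>\<^sub>0)"

lemma psdI: "(\<And>S c. finite S \<Longrightarrow> S \<subseteq> A \<Longrightarrow> bform S k c c \<in> \<real>\<^sub>\<ge>\<^sub>0) \<Longrightarrow> psd A k"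
  by (simp add: psd_def)

lemma psdD: "psd A k \<Longrightarrow> finite S \<Longrightarrow> S \<subseteq> A \<Longrightarrow> bform S k c c \<in> \<real>\<^sub>\<ge>\<^sub>0"
  by (simp add: psd_def)

lemma psd_Re: "psd A k \<Longrightarrow> finite S \<Longrightarrow> S \<subseteq> A \<Longrightarrow> 0 \<le> Re (bform S k c c)"
  and psd_Im: "psd A k \<Longrightarrow> finite S \<Longrightarrow> S \<subseteq> A \<Longrightarrow> Im (bform S k c c) = 0"
  using psdD[of A k S c] by (auto simp: complex_nonneg_Reals_iff)

text \<open>A sequence may repeat points. Adding the coefficients over each fibre of
  \<open>x\<close> turns the double sum over indices into one over the image set; conversely a
  finite set is enumerated.\<close>

lemma pos_kernel_iff_psd: "pos_kernel A k \<longleftrightarrow> psd A k"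
proof
  assume pk: "pos_kernel A k"
  show "psd A k"
  proof (rule psdI)
    fix S c assume S: "finite S" "S \<subseteq> A"
    obtain h where h: "bij_betw h {..<card S} S"
      using ex_bij_betw_nat_finite[OF S(1)] by (auto simp: atLeast0LessThan)
    have eq: "bform S k c c = (\<Sum>i<card S. \<Sum>j<card S. cnj (c (h i)) * c (h j) * k (h i) (h j))"
      unfolding bform_def
      by (subst sum.reindex_bij_betw[OF h, symmetric], intro sum.cong refl,
          subst sum.reindex_bij_betw[OF h, symmetric]) simp
    have "\<forall>i<card S. h i \<in> A" using h S by (auto simp: bij_betw_def)
    then show "bform S k c c \<in> \<real>\<^sub>\<ge>\<^sub>0"
      using pk[unfolded pos_kernel_def, rule_format, of "card S" h "\<lambda>i. c (h i)"]
      by (simp add: eq complex_nonneg_Reals_iff Let_def)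
  qed
next
  assume ps: "psd A k"
  show "pos_kernel A k"
    unfolding pos_kernel_def
  proof (intro allI impI)
    fix m :: nat and x :: "nat \<Rightarrow> 'a" and c :: "nat \<Rightarrow> complex"
    assume xA: "\<forall>i<m. x i \<in> A"
    define S where "S = x ` {..<m}"
    define d where "d y = (\<Sum>i\<in>{i\<in>{..<m}. x i = y}. c i)" for y
    have S: "finite S" "S \<subseteq> A" using xA by (auto simp: S_def)
    have grp: "(\<Sum>i<m. c' i * g (x i)) = (\<Sum>y\<in>S. (\<Sum>i\<in>{i\<in>{..<m}. x i = y}. c' i) * g y)"
      for c' g :: "_ \<Rightarrow> complex"
      unfolding S_def by (subst sum.image_gen[of "{..<m}" _ x]) (auto simp: sum_distrib_right intro!: sum.cong)
    have "(\<Sum>i<m. \<Sum>j<m. cnj (c i) * c j * k (x i) (x j))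
        = (\<Sum>i<m. cnj (c i) * (\<Sum>y\<in>S. d y * k (x i) y))"
      by (rule sum.cong[OF refl], subst grp[of c "k (x _)", folded d_def, symmetric])
         (simp add: sum_distrib_left mult.assoc)
    also have "\<dots> = (\<Sum>z\<in>S. cnj (d z) * (\<Sum>y\<in>S. d y * k z y))"
      by (subst grp[of "\<lambda>i. cnj (c i)" "\<lambda>z. \<Sum>y\<in>S. d y * k z y"]) (simp add: d_def cnj_sum)
    also have "\<dots> = bform S k d d"
      by (simp add: bform_def sum_distrib_left mult.assoc)
    finally show "let s = \<Sum>i<m. \<Sum>j<m. cnj (c i) * c j * k (x i) (x j) in Im s = 0 \<and> 0 \<le> Re s"
      using psdD[OF ps S, of d] by (simp add: complex_nonneg_Reals_iff Let_def)
  qed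
qed

lemma bform_cong: "(\<And>x y. x \<in> S \<Longrightarrow> y \<in> S \<Longrightarrow> k x y = k' x y) \<Longrightarrow> bform S k c d = bform S k' c d"
  by (simp add: bform_def)

lemma psd_cong: "(\<And>x y. x \<in> A \<Longrightarrow> y \<in> A \<Longrightarrow> k x y = k' x y) \<Longrightarrow> psd A k = psd A k'"
  unfolding psd_def by (metis bform_cong subsetD)

lemma bform_add_kernel: "bform S (\<lambda>x y. k x y + l x y) c d = bform S k c d + bform S l c d"
  by (simp add: bform_def algebra_simps sum.distrib)

lemma bform_scale_kernel: "bform S (\<lambda>x y. r * k x y) c d = r * bform S k c d"
  by (simp add: bform_def sum_distrib_left mult_ac)

lemma psd_add: "psd A k \<Longrightarrow> psd A l \<Longrightarrow> psd A (\<lambda>x y. k x y + l x y)"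
  by (auto simp: psd_def bform_add_kernel)

lemma psd_scale: "psd A k \<Longrightarrow> 0 \<le> r \<Longrightarrow> psd A (\<lambda>x y. complex_of_real r * k x y)"
  by (auto simp: psd_def bform_scale_kernel intro!: nonneg_Reals_mult_I)

lemma psd_0: "psd A (\<lambda>x y. 0)"
  by (auto simp: psd_def bform_def)

lemma psd_sum: "(\<And>i. i \<in> I \<Longrightarrow> psd A (k i)) \<Longrightarrow> psd A (\<lambda>x y. \<Sum>i\<in>I. k i x y)"
  by (induction I rule: infinite_finite_induct) (auto intro: psd_0 psd_add)

lemma psd_congruence:
  assumes "psd A k" shows "psd A (\<lambda>x y. f x * k x y * cnj (f y))"
proof (rule psdI)
  fix S c assume "finite S" "S \<subseteq> A"
  have "bform S (\<lambda>x y. f x * k x y * cnj (f y)) c c = bform S k (\<lambda>x. cnj (f x) * c x) (\<lambda>x. cnj (f x) * c x)"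
    by (simp add: bform_def mult_ac)
  then show "bform S (\<lambda>x y. f x * k x y * cnj (f y)) c c \<in> \<real>\<^sub>\<ge>\<^sub>0"
    using psdD[OF assms] \<open>finite S\<close> \<open>S \<subseteq> A\<close> by simp
qed

lemma bform_rank1: "bform S (\<lambda>x y. f x * cnj (g y)) c d = (\<Sum>x\<in>S. cnj (c x) * f x) * cnj (\<Sum>x\<in>S. cnj (d x) * g x)"
  unfolding bform_def cnj_sum sum_product by (intro sum.cong refl) simp

lemma psd_rank1: "psd A (\<lambda>x y. f x * cnj (f y))"
  by (rule psdI) (simp add: bform_rank1 complex_norm_square[symmetric] del: cnj_sum complex_cnj_mult)

lemma psd_lim:
  assumes "\<And>n. psd A (k n)" "\<And>x y. x \<in> A \<Longrightarrow> y \<in> A \<Longrightarrow> (\<lambda>n. k n x y) \<longlonglongrightarrow> l x y"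
  shows "psd A l"
proof (rule psdI)
  fix S c assume S: "finite S" "S \<subseteq> A"
  have "(\<lambda>n. bform S (k n) c c) \<longlonglongrightarrow> bform S l c c"
    unfolding bform_def using S by (intro tendsto_sum tendsto_mult tendsto_const assms(2)) auto
  then show "bform S l c c \<in> \<real>\<^sub>\<ge>\<^sub>0"
    using closed_nonneg_Reals_complex psdD[OF assms(1) S]
    by (meson closed_sequentially)
qed

lemma psd_suminf:
  assumes "\<And>n. psd A (k n)" "\<And>x y. x \<in> A \<Longrightarrow> y \<in> A \<Longrightarrow> summable (\<lambda>n. k n x y)"
  shows "psd A (\<lambda>x y. \<Sum>n. k n x y)"
  by (rule psd_lim[where k="\<lambda>N x y. \<Sum>n<N. k n x y"])
     (auto intro!: psd_sum assms summable_LIMSEQ)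

text \<open>\<open>cinner\<close> is the sum over the coordinates of x_i cnj(y_i), so each summand
  of the product is a congruence of \<open>k\<close>.\<close>

lemma psd_cinner_mult:
  assumes "psd A k" shows "psd A (\<lambda>x y. cinner x y * k x y)"
proof -
  have "psd A (\<lambda>x y. \<Sum>i\<in>UNIV. x $ i * k x y * cnj (y $ i))"
    by (intro psd_sum psd_congruence assms)
  then show ?thesis
    by (simp add: cinner_def sum_distrib_left sum_distrib_right mult_ac)
qed

lemma psd_cinner_power_mult:
  assumes "psd A k" shows "psd A (\<lambda>x y. cinner x y ^ n * k x y)"
proof (induction n)
  case (Suc n)
  show ?case using psd_cinner_mult[OF Suc] by (simp add: mult.assoc)
qed (use assms in simp)

lemma psd_one: "psd A (\<lambda>x y. 1)"
  using psd_rank1[of A "\<lambda>_. 1"] by simp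

lemma bform_hermitian:
  assumes "\<And>x y. x \<in> S \<Longrightarrow> y \<in> S \<Longrightarrow> k y x = cnj (k x y)"
  shows "bform S k d c = cnj (bform S k c d)"
proof -
  have "cnj (bform S k c d) = (\<Sum>x\<in>S. \<Sum>y\<in>S. c x * cnj (d y) * k y x)"
    unfolding bform_def cnj_sum
    by (intro sum.cong refl) (subst assms, simp_all)
  also have "\<dots> = bform S k d c"
    unfolding bform_def by (subst sum.swap) (simp add: mult_ac)
  finally show ?thesis by simp
qed

lemma bform_add_left: "bform S k (\<lambda>x. c x + d x) e = bform S k c e + bform S k d e"
  and bform_add_right: "bform S k e (\<lambda>x. c x + d x) = bform S k e c + bform S k e d"
  and bform_scale_left: "bform S k (\<lambda>x. r * c x) e = cnj r * bform S k c e"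
  and bform_scale_right: "bform S k e (\<lambda>x. r * c x) = r * bform S k e c"
  by (simp_all add: bform_def algebra_simps sum.distrib sum_distrib_left)

lemma bform_extend:
  assumes "finite T" "S \<subseteq> T" "\<And>x. x \<in> T - S \<Longrightarrow> c x = 0" "\<And>x. x \<in> T - S \<Longrightarrow> d x = 0"
  shows "bform T k c d = bform S k c d"
  unfolding bform_def using assms
  by (intro sum.mono_neutral_cong_right sum.neutral) auto

section \<open>Cauchy-Schwarz inequalities for positive kernels\<close>

text \<open>The discriminant inequality for a complex variable, including degenerate leading
  coefficients. Cauchy-Schwarz for kernels and the norm bound for a function plus a kernel
  combination both come from it.\<close>

lemma quadratic_nonneg_imp:
  fixes p q :: real and r :: complex
  assumes "\<And>t. 0 \<le> p + 2 * Re (t * r) + (cmod t)\<^sup>2 * q"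
  shows "(cmod r)\<^sup>2 \<le> p * q"
proof (cases "q = 0")
  case True
  have "r = 0"
  proof (rule ccontr)
    assume "r \<noteq> 0"
    \<comment> \<open>Makes \<open>t * r\<close> equal to -(p + 1), so that the affine expression
      drops to -p - 2, against \<open>0 \<le> p\<close>.\<close>
    define t where "t = - complex_of_real ((p + 1) / (cmod r)\<^sup>2) * cnj r"
    have "t * r = - complex_of_real ((p + 1) / (cmod r)\<^sup>2) * complex_of_real ((cmod r)\<^sup>2)"
      unfolding t_def complex_norm_square by simp
    also have "\<dots> = - complex_of_real (p + 1)"
      using \<open>r \<noteq> 0\<close> by (simp flip: of_real_mult)
    finally have "Re (t * r) = - (p + 1)" by simp
    then show False using assms[of t] assms[of 0] True by simp
  qed
  then show ?thesis using True by simp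
next
  case False
  have q: "q > 0"
  proof (rule ccontr)
    assume "\<not> q > 0"
    then have q: "q < 0" using False by simp
    \<comment> \<open>The solution of p + 2 |r| + s q = q, so that the quadratic is at most s q <
      0.\<close>
    define s where "s = 1 + (p + 2 * cmod r) / (- q)"
    have p: "0 \<le> p" using assms[of 0] by simp
    have s: "s \<ge> 1" using p q by (simp add: s_def field_simps)
    have "0 \<le> p + 2 * Re (of_real s * r) + (cmod (of_real s))\<^sup>2 * q" by (rule assms)
    also have "\<dots> \<le> p * s + 2 * (s * cmod r) + s\<^sup>2 * q"
      using s p complex_Re_le_cmod[of r] by (auto intro!: add_mono mult_left_mono simp: mult_le_cancel_left1)
    also have "\<dots> = s * (p + 2 * cmod r + s * q)" by (simp add: power2_eq_square algebra_simps)
    also have "p + 2 * cmod r + s * q = q" using q by (simp add: s_def field_simps)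
    finally show False using s q by (simp add: zero_le_mult_iff)
  qed
  define t where "t = - cnj r / of_real q"
  have "t * r = - complex_of_real ((cmod r)\<^sup>2) / of_real q"
    unfolding t_def complex_norm_square by simp
  then have "Re (t * r) = - (cmod r)\<^sup>2 / q" by (simp flip: of_real_minus of_real_divide)
  moreover have "(cmod t)\<^sup>2 * q = (cmod r)\<^sup>2 / q"
    using q by (simp add: t_def norm_divide power_divide power2_eq_square)
  ultimately have "0 \<le> p - (cmod r)\<^sup>2 / q" using assms[of t] by simp
  then show ?thesis using q by (simp add: field_simps)
qed

text \<open>With coefficients 1 at \<open>x\<close> and \<open>w\<close> at \<open>y\<close>, the
  off-diagonal part of the form is w k(x,y) + cnj(w) k(y,x). It is real for w = 1 and for w = i,
  which determines both parts of k(y,x).\<close>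

lemma psd_hermitian:
  assumes ps: "psd A k" and xy: "x \<in> A" "y \<in> A"
  shows "k y x = cnj (k x y)"
proof (cases "x = y")
  case True
  have "Im (k x x) = 0" using psd_Im[OF ps, of "{x}" "\<lambda>_. 1"] xy by (simp add: bform_def)
  then show ?thesis using True by (simp add: complex_eq_iff)
next
  case False
  have d: "Im (k z z) = 0" if "z \<in> A" for z
    using psd_Im[OF ps, of "{z}" "\<lambda>_. 1"] that by (simp add: bform_def)
  have "Im (bform {x,y} k (\<lambda>z. if z = x then 1 else w) (\<lambda>z. if z = x then 1 else w)) = 0" for w
    using psd_Im[OF ps] xy by simp
  note this[of 1] this[of \<i>]
  then show ?thesis using False d[OF xy(1)] d[OF xy(2)]
    by (auto simp: bform_def complex_eq_iff)
qed

text \<open>A Schur complement: up to the factor \<open>k w w\<close> it is the kernel of the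
  orthogonal complement of k(.,w). Positivity is the Cauchy-Schwarz inequality between a combination
  of kernel functions and k(.,w).\<close>

lemma psd_kernel_CS:
  assumes ps: "psd A k" and w: "w \<in> A"
  shows "psd A (\<lambda>z v. k w w * k z v - k z w * k w v)"
proof (rule psdI)
  fix S and c :: "'a \<Rightarrow> complex" assume S: "finite S" "S \<subseteq> A"
  define T where "T = insert w S"
  define d where "d x = (if x \<in> S then c x else 0 :: complex)" for x
  define e where "e x = (if x = w then 1 else 0 :: complex)" for x
  have T: "finite T" "T \<subseteq> A" using S w by (auto simp: T_def)
  have kh: "k y x = cnj (k x y)" if "x \<in> A" "y \<in> A" for x y
    by (rule psd_hermitian[OF ps that])
  have ee: "bform T k e e = k w w"
    by (subst bform_extend[of T "{w}"]) (auto simp: T_def S e_def bform_def)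
  have dd: "bform T k d d = bform S k c c"
    by (subst bform_extend[of T S]) (auto simp: T_def S d_def bform_def)
  have de: "bform T k d e = (\<Sum>x\<in>S. cnj (c x) * k x w)"
  proof -
    have "bform T k d e = (\<Sum>x\<in>T. cnj (d x) * k x w)"
      unfolding bform_def
    proof (rule sum.cong[OF refl])
      fix x assume "x \<in> T"
      have "(\<Sum>y\<in>T. cnj (d x) * e y * k x y) = (\<Sum>y\<in>T. if y = w then cnj (d x) * k x y else 0)"
        by (rule sum.cong) (auto simp: e_def)
      then show "(\<Sum>y\<in>T. cnj (d x) * e y * k x y) = cnj (d x) * k x w"
        using T by (simp add: sum.delta T_def)
    qed
    also have "\<dots> = (\<Sum>x\<in>S. cnj (c x) * k x w)"
      unfolding T_def using S by (intro sum.mono_neutral_cong_right) (auto simp: d_def)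
    finally show ?thesis .
  qed
  have ed: "bform T k e d = cnj (bform T k d e)"
    using bform_hermitian[of T k e d] kh T by blast
  define r where "r = bform T k d e"
  have le: "(cmod r)\<^sup>2 \<le> Re (k w w) * Re (bform S k c c)"
  proof -
    have "(cmod r)\<^sup>2 \<le> Re (bform T k d d) * Re (bform T k e e)"
    proof (rule quadratic_nonneg_imp)
      fix t
      have "0 \<le> Re (bform T k (\<lambda>x. d x + t * e x) (\<lambda>x. d x + t * e x))"
        by (rule psd_Re[OF ps T])
      also have "bform T k (\<lambda>x. d x + t * e x) (\<lambda>x. d x + t * e x)
         = bform T k d d + t * r + cnj (t * r) + t * cnj t * bform T k e e"
        by (simp add: bform_add_left bform_add_right bform_scale_left bform_scale_right ed r_def algebra_simps)
      also have "Re \<dots> = Re (bform T k d d) + 2 * Re (t * r) + (cmod t)\<^sup>2 * Re (bform T k e e)"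
        by (simp add: complex_norm_square[symmetric] del: complex_cnj_mult of_real_power)
      finally show "0 \<le> \<dots>" .
    qed
    then show ?thesis by (simp add: ee dd mult.commute)
  qed
  have kww: "k w w = of_real (Re (k w w))"
    using psd_Im[OF ps, of "{w}" "\<lambda>_. 1"] w by (simp add: bform_def complex_eq_iff)
  have cc: "bform S k c c = of_real (Re (bform S k c c))"
    using psd_Im[OF ps S] by (simp add: complex_eq_iff)
  have "bform S (\<lambda>z v. k z w * k w v) c c = r * cnj r"
    unfolding r_def de
    by (subst bform_cong[where k'="\<lambda>z v. k z w * cnj (k v w)"])
       (use S w kh in \<open>auto simp: bform_rank1\<close>)
  then have "bform S (\<lambda>z v. k w w * k z v - k z w * k w v) c c = k w w * bform S k c c - r * cnj r"
    using bform_add_kernel[of S "\<lambda>z v. k w w * k z v" "\<lambda>z v. (-1) * (k z w * k w v)" c c]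
    by (simp add: bform_scale_kernel bform_scale_kernel[of S "-1", simplified])
  also have "\<dots> = of_real (Re (k w w) * Re (bform S k c c) - (cmod r)\<^sup>2)"
    by (subst kww, subst cc) (simp only: of_real_diff of_real_mult complex_norm_square)
  also have "\<dots> \<in> \<real>\<^sub>\<ge>\<^sub>0"
    using le by (subst nonneg_Reals_of_real_iff) simp
  finally show "bform S (\<lambda>z v. k w w * k z v - k z w * k w v) c c \<in> \<real>\<^sub>\<ge>\<^sub>0" .
qed

section \<open>Unitarily invariant complete Pick kernels\<close>

lemma inner_eq_Re_cinner: "inner z w = Re (cinner z w)"
  by (simp add: inner_vec_def cinner_def inner_complex_def)

lemma cinner_commute: "cinner w z = cnj (cinner z w)"
  by (simp add: cinner_def mult.commute)

lemma cinner_self: "cinner z z = of_real ((norm z)\<^sup>2)"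
proof (rule complex_eqI)
  show "Re (cinner z z) = Re (of_real ((norm z)\<^sup>2))"
    by (simp add: inner_eq_Re_cinner[symmetric] power2_norm_eq_inner)
  show "Im (cinner z z) = Im (of_real ((norm z)\<^sup>2))"
    by (simp add: cinner_def)
qed

lemma norm_cinner_le: "cmod (cinner z w) \<le> norm z * norm w"
proof -
  have "cmod (cinner z w) \<le> (\<Sum>i\<in>UNIV. \<bar>norm (z $ i)\<bar> * \<bar>norm (w $ i)\<bar>)"
    unfolding cinner_def by (rule order_trans[OF norm_sum]) (simp add: norm_mult)
  also have "\<dots> \<le> norm z * norm w"
    unfolding norm_vec_def by (rule L2_set_mult_ineq)
  finally show ?thesis .
qed

lemma cinner_scaleR_left: "cinner (r *\<^sub>R z) w = of_real r * cinner z w"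
  and cinner_scaleR_right: "cinner z (r *\<^sub>R w) = of_real r * cinner z w"
  unfolding cinner_def vector_scaleR_component sum_distrib_left
  by (intro sum.cong refl; simp add: scaleR_conv_of_real)+

lemma norm_diff_sq_cinner: "(norm (z - w))\<^sup>2 = (norm z)\<^sup>2 + (norm w)\<^sup>2 - 2 * Re (cinner z w)"
  by (simp add: power2_norm_eq_inner inner_diff inner_eq_Re_cinner[symmetric] inner_commute)

lemma continuous_on_cinner [continuous_intros]:
  "continuous_on S f \<Longrightarrow> continuous_on S g \<Longrightarrow> continuous_on S (\<lambda>x. cinner (f x) (g x))"
  unfolding cinner_def by (intro continuous_intros)

lemma psd_powser_mult:
  assumes "psd A k" "\<And>n. 0 \<le> c n"
    and "\<And>x y. x \<in> A \<Longrightarrow> y \<in> A \<Longrightarrow> summable (\<lambda>n. complex_of_real (c n) * cinner x y ^ n)"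
  shows "psd A (\<lambda>x y. (\<Sum>n. complex_of_real (c n) * cinner x y ^ n) * k x y)"
proof -
  have "psd A (\<lambda>x y. \<Sum>n. complex_of_real (c n) * (cinner x y ^ n * k x y))"
  proof (rule psd_suminf)
    show "psd A (\<lambda>x y. complex_of_real (c n) * (cinner x y ^ n * k x y))" for n
      by (intro psd_scale psd_cinner_power_mult assms(1,2))
    show "summable (\<lambda>n. complex_of_real (c n) * (cinner x y ^ n * k x y))" if "x \<in> A" "y \<in> A" for x y
      using summable_mult2[OF assms(3)[OF that], of "k x y"] by (simp add: mult.assoc)
  qed
  moreover have "(\<Sum>n. complex_of_real (c n) * (cinner x y ^ n * k x y))
      = (\<Sum>n. complex_of_real (c n) * cinner x y ^ n) * k x y" if "x \<in> A" "y \<in> A" for x y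
    using suminf_mult2[OF assms(3)[OF that], of "k x y"] by (simp add: mult.assoc)
  ultimately show ?thesis using psd_cong[of A] by (metis (mono_tags, lifting))
qed

section \<open>The power series of the kernel and of 1 - 1/K\<close>

locale pick_space =
  fixes a :: "nat \<Rightarrow> real"
  assumes reg: "regular_UI a" and cp: "complete_pick a"
begin

definition b :: "nat \<Rightarrow> real" where "b n = fps_nth (1 - inverse (Abs_fps a)) n"

definition A :: "complex \<Rightarrow> complex" where "A t = (\<Sum>n. complex_of_real (a n) * t ^ n)"

definition B :: "complex \<Rightarrow> complex" where "B t = (\<Sum>n. complex_of_real (b n) * t ^ n)"

lemma a0 [simp]: "a 0 = 1" and a_pos: "0 < a n" and a_ratio: "(\<lambda>n. a n / a (Suc n)) \<longlonglongrightarrow> 1"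
  using reg by (auto simp: regular_UI_def)

lemma b0 [simp]: "b 0 = 0"
  by (simp add: b_def)

lemma b_nonneg: "0 \<le> b n"
  using cp by (cases "n = 0") (auto simp: complete_pick_def b_def)

text \<open>The renewal equation, the coefficientwise form of (1 - 1/A) A = A - 1. It gives b_1 =
  a_1 and, all terms being nonnegative, b_n \<le> a_n.\<close>

lemma b_conv: "(\<Sum>i\<le>n. b i * a (n - i)) = a n - (if n = 0 then 1 else 0)"
proof -
  have "(1 - inverse (Abs_fps a)) * Abs_fps a = Abs_fps a - 1"
    using inverse_mult_eq_1[of "Abs_fps a"] by (simp add: algebra_simps)
  then have "fps_nth ((1 - inverse (Abs_fps a)) * Abs_fps a) n = fps_nth (Abs_fps a - 1) n"
    by simp
  then show ?thesis
    by (simp add: fps_mult_nth b_def atLeast0AtMost)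
qed

lemma b1_pos: "0 < b 1"
  using b_conv[of 1] a_pos[of 1] by simp

lemma b_le_a: "b n \<le> a n"
proof (cases "n = 0")
  case False
  have "b n * a (n - n) \<le> (\<Sum>i\<le>n. b i * a (n - i))"
    by (rule member_le_sum) (auto intro!: mult_nonneg_nonneg b_nonneg less_imp_le[OF a_pos])
  then show ?thesis using False b_conv[of n] by simp
qed (simp add: less_imp_le)

lemma a_summable: "cmod t < 1 \<Longrightarrow> summable (\<lambda>n. norm (complex_of_real (a n) * t ^ n))"
proof -
  assume t: "cmod t < 1"
  have "conv_radius (\<lambda>n. complex_of_real (a n)) = 1"
    by (rule conv_radius_ratio_limit[where c = 1])
       (use a_pos a_ratio in \<open>auto simp: less_imp_neq[symmetric] one_ereal_def abs_of_pos\<close>)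
  then show ?thesis
    using t by (intro abs_summable_in_conv_radius) (simp add: one_ereal_def)
qed

lemma a_summable_real: "0 \<le> x \<Longrightarrow> x < 1 \<Longrightarrow> summable (\<lambda>n. a n * x ^ n)"
  using a_summable[of "of_real x"] a_pos
  by (simp add: norm_mult norm_power abs_of_pos)

lemma b_summable_open: "cmod t < 1 \<Longrightarrow> summable (\<lambda>n. norm (complex_of_real (b n) * t ^ n))"
  by (rule summable_comparison_test'[OF a_summable[of t], of 0])
     (use b_le_a b_nonneg a_pos in \<open>auto simp: norm_mult norm_power abs_of_pos intro!: mult_right_mono\<close>)

lemma A_B: assumes t: "cmod t < 1" shows "A t * (1 - B t) = 1"
proof -
  have sA: "summable (\<lambda>n. complex_of_real (a n) * t ^ n)"
    using a_summable[OF t] by (rule summable_norm_cancel)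
  have "B t * A t = (\<Sum>k. \<Sum>i\<le>k. (of_real (b i) * t ^ i) * (of_real (a (k - i)) * t ^ (k - i)))"
    unfolding A_def B_def by (rule Cauchy_product[OF b_summable_open[OF t] a_summable[OF t]])
  also have "\<dots> = (\<Sum>k. of_real (a k) * t ^ k - (if k = 0 then 1 else 0))"
  proof (rule arg_cong[where f=suminf], rule ext)
    fix k
    have "(\<Sum>i\<le>k. (of_real (b i) * t ^ i) * (of_real (a (k - i)) * t ^ (k - i)))
        = of_real (\<Sum>i\<le>k. b i * a (k - i)) * t ^ k"
      unfolding of_real_sum sum_distrib_right
      by (intro sum.cong refl) (simp add: power_add[symmetric] mult_ac)
    also have "\<dots> = of_real (a k) * t ^ k - (if k = 0 then 1 else 0)"
      by (simp add: b_conv algebra_simps)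
    finally show "(\<Sum>i\<le>k. (of_real (b i) * t ^ i) * (of_real (a (k - i)) * t ^ (k - i)))
      = of_real (a k) * t ^ k - (if k = 0 then 1 else 0)" .
  qed
  also have "\<dots> = A t - 1"
    unfolding A_def
  proof (rule sums_unique[symmetric], rule sums_diff)
    show "(\<lambda>k. of_real (a k) * t ^ k) sums (\<Sum>n. of_real (a n) * t ^ n)"
      by (rule summable_sums[OF sA])
    show "(\<lambda>k. if k = 0 then 1 else 0) sums (1::complex)"
      using sums_single[of 0 "\<lambda>_. 1::complex"] by simp
  qed
  finally show ?thesis by (simp add: algebra_simps)
qed

lemma Re_suminf': "summable f \<Longrightarrow> Re (suminf f) = (\<Sum>n. Re (f n))"
  by (metis sums_Re sums_iff)

text \<open>For 0 < x < 1 the identity A(x) (1 - B(x)) = 1 with A(x) > 0 forces B(x) < 1, and the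
  finite sums pass to x = 1. Hence B converges absolutely on the closed disc.\<close>

lemma b_partial: "(\<Sum>n<N. b n) \<le> 1"
proof -
  have le: "(\<Sum>n<N. b n * x ^ n) \<le> 1" if x: "0 < x" "x < 1" for x :: real
  proof -
    have cx: "cmod (of_real x) < 1" using x by simp
    have s: "summable (\<lambda>n. b n * x ^ n)"
      using b_summable_open[OF cx] b_nonneg x by (simp add: norm_mult norm_power)
    have B: "B (of_real x) = of_real (\<Sum>n. b n * x ^ n)"
      unfolding B_def by (subst suminf_of_real[OF s]) simp
    have A: "A (of_real x) = of_real (\<Sum>n. a n * x ^ n)"
      unfolding A_def by (subst suminf_of_real[OF a_summable_real]) (use x in auto)
    have Apos: "0 < (\<Sum>n. a n * x ^ n)"
    proof (rule suminf_pos)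
      show "summable (\<lambda>n. a n * x ^ n)" using x by (intro a_summable_real) auto
      show "0 < a n * x ^ n" for n using x by (intro mult_pos_pos a_pos zero_less_power) auto
    qed
    have "(\<Sum>n. a n * x ^ n) * (1 - (\<Sum>n. b n * x ^ n)) = 1"
    proof -
      have "complex_of_real ((\<Sum>n. a n * x ^ n) * (1 - (\<Sum>n. b n * x ^ n))) = of_real 1"
        using A_B[OF cx] by (simp only: A B of_real_mult of_real_diff of_real_1)
      then show ?thesis by (simp only: of_real_eq_iff)
    qed
    then have "0 < 1 - (\<Sum>n. b n * x ^ n)"
      using Apos zero_less_mult_pos[of "\<Sum>n. a n * x ^ n" "1 - (\<Sum>n. b n * x ^ n)"] by linarith
    moreover have "(\<Sum>n<N. b n * x ^ n) \<le> (\<Sum>n. b n * x ^ n)"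
      using s b_nonneg x by (intro sum_le_suminf) auto
    ultimately show ?thesis by simp
  qed
  have "((\<lambda>x::real. \<Sum>n<N. b n * x ^ n) \<longlongrightarrow> (\<Sum>n<N. b n * 1 ^ n)) (at_left 1)"
    by (intro tendsto_sum tendsto_mult tendsto_const tendsto_power tendsto_ident_at)
  moreover have "eventually (\<lambda>x::real. (\<Sum>n<N. b n * x ^ n) \<le> 1) (at_left 1)"
    using eventually_at_left_real[OF zero_less_one] by eventually_elim (auto intro: le)
  ultimately show ?thesis
    using tendsto_upperbound[of "\<lambda>x::real. \<Sum>n<N. b n * x ^ n" _ "at_left 1" 1] by simp
qed

lemma b_summable: "summable b"
  by (rule summableI_nonneg_bounded[OF b_nonneg b_partial])

lemma suminf_b_le: "suminf b \<le> 1"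
  by (rule suminf_le_const[OF b_summable b_partial])

lemma b_summable_closed: "cmod t \<le> 1 \<Longrightarrow> summable (\<lambda>n. norm (complex_of_real (b n) * t ^ n))"
  by (rule summable_comparison_test'[OF b_summable, of 0])
     (use b_nonneg in \<open>auto simp: norm_mult norm_power power_le_one intro!: mult_left_le\<close>)

text \<open>As the coefficients sum to at most 1, the right-hand side dominates the sum of b_n (1 -
  Re t^n), whose terms are nonnegative. The term n = 1 alone gives a lower bound that degenerates
  only at t = 1.\<close>

lemma one_minus_Re_B: assumes t: "cmod t \<le> 1" shows "b 1 * (1 - Re t) \<le> 1 - Re (B t)"
proof -
  have s: "summable (\<lambda>n. complex_of_real (b n) * t ^ n)"
    using b_summable_closed[OF t] by (rule summable_norm_cancel)
  have s': "summable (\<lambda>n. b n * Re (t ^ n))"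
    using summable_Re[OF s] by simp
  have "b 1 * (1 - Re t) \<le> (\<Sum>n. b n * (1 - Re (t ^ n)))"
  proof -
    have nn: "0 \<le> b n * (1 - Re (t ^ n))" for n
      using b_nonneg[of n] complex_Re_le_cmod[of "t ^ n"] t power_le_one[of "cmod t" n]
      by (intro mult_nonneg_nonneg) (auto simp: norm_power)
    have "(\<Sum>n\<in>{1}. b n * (1 - Re (t ^ n))) \<le> (\<Sum>n. b n * (1 - Re (t ^ n)))"
      using b_summable s' nn by (intro sum_le_suminf) (auto simp: right_diff_distrib intro: summable_diff)
    then show ?thesis by simp
  qed
  also have "\<dots> = suminf b - Re (B t)"
    using b_summable s' Re_suminf'[OF s] by (simp add: right_diff_distrib suminf_diff B_def)
  also have "\<dots> \<le> 1 - Re (B t)" using suminf_b_le by simp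
  finally show ?thesis .
qed

lemma B_real: assumes "0 \<le> x" "x \<le> 1"
  shows "B (of_real x) = of_real (\<Sum>n. b n * x ^ n)" "0 \<le> (\<Sum>n. b n * x ^ n)" "(\<Sum>n. b n * x ^ n) \<le> 1"
proof -
  have s: "summable (\<lambda>n. b n * x ^ n)"
    using b_summable_closed[of "of_real x"] b_nonneg assms by (simp add: norm_mult norm_power)
  show "B (of_real x) = of_real (\<Sum>n. b n * x ^ n)"
    unfolding B_def by (subst suminf_of_real[OF s]) simp
  show "0 \<le> (\<Sum>n. b n * x ^ n)"
    using s b_nonneg assms by (intro suminf_nonneg) auto
  have "(\<Sum>n. b n * x ^ n) \<le> suminf b"
    using s b_summable b_nonneg assms by (intro suminf_le) (auto intro!: mult_left_le power_le_one)
  then show "(\<Sum>n. b n * x ^ n) \<le> 1" using suminf_b_le by simp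
qed

lemma A_eq: assumes "cmod t < 1" shows "A t = 1 / (1 - B t)" "1 - B t \<noteq> 0"
proof -
  show nz: "1 - B t \<noteq> 0" using A_B[OF assms] by auto
  show "A t = 1 / (1 - B t)" using A_B[OF assms] nz by (simp add: eq_divide_eq)
qed

lemma Re_one_minus_B_pos: "cmod t < 1 \<Longrightarrow> 0 < 1 - Re (B t)"
  using one_minus_Re_B[of t] b1_pos complex_Re_le_cmod[of t]
  by (smt (verit) mult_pos_pos)

lemma Re_A_nonneg: assumes "cmod t < 1" shows "0 \<le> Re (A t)"
  using Re_one_minus_B_pos[OF assms] A_eq[OF assms] by (simp add: Re_divide)

text \<open>The bound depends on 1 - Re t and not on |t|, so K(z, t x) stays bounded as t tends to 1
  while z keeps away from x.\<close>

lemma norm_A_le: assumes t: "cmod t < 1" and d: "0 < d" "d \<le> 1 - Re t"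
  shows "cmod (A t) \<le> 1 / (b 1 * d)"
proof -
  have "b 1 * d \<le> 1 - Re (B t)"
    using one_minus_Re_B[of t] t d b1_pos by (smt (verit) mult_left_mono)
  also have "\<dots> \<le> cmod (1 - B t)" using complex_Re_le_cmod[of "1 - B t"] by simp
  finally have "b 1 * d \<le> cmod (1 - B t)" .
  then have "1 / cmod (1 - B t) \<le> 1 / (b 1 * d)"
    using d b1_pos by (intro frac_le) auto
  then show ?thesis by (simp only: A_eq(1)[OF t] norm_divide norm_one)
qed

lemma isCont_A: "cmod t < 1 \<Longrightarrow> isCont A t"
  unfolding A_def
proof -
  assume t: "cmod t < 1"
  obtain r where r: "cmod t < r" "r < 1" using dense[OF t] by auto
  then have "0 \<le> r" using norm_ge_zero[of t] by linarith
  have "summable (\<lambda>n. complex_of_real (a n) * of_real r ^ n)"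
    using a_summable[of "of_real r"] r \<open>0 \<le> r\<close> by (intro summable_norm_cancel[of "\<lambda>n. complex_of_real (a n) * of_real r ^ n"]) simp
  then show "isCont (\<lambda>t. \<Sum>n. complex_of_real (a n) * t ^ n) t"
    by (rule isCont_powser) (use r \<open>0 \<le> r\<close> in simp)
qed

lemma continuous_on_A [continuous_intros]:
  assumes "continuous_on S f" "\<And>x. x \<in> S \<Longrightarrow> cmod (f x) < 1"
  shows "continuous_on S (\<lambda>x. A (f x))"
proof -
  have "continuous_on {t. cmod t < 1} A"
    by (intro continuous_at_imp_continuous_on) (auto intro: isCont_A)
  then show ?thesis
    by (rule continuous_on_compose2[OF _ assms(1)]) (use assms in auto)
qed

abbreviation K :: "complex^'d \<Rightarrow> complex^'d \<Rightarrow> complex" where "K \<equiv> UI_kernel a"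

lemma K_eq: "K z w = A (cinner z w)"
  by (simp add: UI_kernel_def A_def)

lemma norm_cinner_less: "norm z \<le> 1 \<Longrightarrow> norm w < 1 \<Longrightarrow> cmod (cinner z w) < 1"
  "norm z < 1 \<Longrightarrow> norm w \<le> 1 \<Longrightarrow> cmod (cinner z w) < 1"
  using norm_cinner_le[of z w] mult_left_le_one_le[of "norm w" "norm z"] mult_left_le_one_le[of "norm z" "norm w"]
  by (auto simp: mult.commute)

lemma cnj_A: assumes "cmod t < 1" shows "cnj (A t) = A (cnj t)"
  using bounded_linear.suminf[OF bounded_linear_cnj summable_norm_cancel[OF a_summable[OF assms]]]
  by (simp add: A_def)

lemma K_commute: "norm z \<le> 1 \<Longrightarrow> norm w < 1 \<Longrightarrow> K w z = cnj (K z w)"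
  by (simp add: K_eq cnj_A norm_cinner_less cinner_commute[of w z])

lemma psd_K_mult: "psd open_ball k \<Longrightarrow> psd open_ball (\<lambda>z w. K z w * k z w)"
  unfolding K_eq A_def
  by (rule psd_powser_mult)
     (auto intro!: less_imp_le[OF a_pos] summable_norm_cancel[OF a_summable] norm_cinner_less simp: open_ball_def)

lemma psd_K: "psd open_ball K"
  using psd_K_mult[OF psd_one] by simp

definition beta :: "complex^'d \<Rightarrow> complex^'d \<Rightarrow> complex" where "beta z w = B (cinner z w)"

lemma psd_beta_mult: "psd open_ball k \<Longrightarrow> psd open_ball (\<lambda>z w. beta z w * k z w)"
  unfolding beta_def B_def
  by (rule psd_powser_mult)
     (auto intro!: b_nonneg summable_norm_cancel[OF b_summable_open] norm_cinner_less simp: open_ball_def)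

lemma psd_beta: "psd open_ball beta"
  using psd_beta_mult[OF psd_one] by simp

lemma K_beta: "norm z \<le> 1 \<Longrightarrow> norm w < 1 \<Longrightarrow> K z w * (1 - beta z w) = 1"
  by (simp add: K_eq beta_def A_B norm_cinner_less)

lemma Re_K_nonneg: "norm z \<le> 1 \<Longrightarrow> norm w < 1 \<Longrightarrow> 0 \<le> Re (K z w)"
  by (simp add: K_eq Re_A_nonneg norm_cinner_less)

text \<open>Multiplication by \<open>K(\<cdot>,w) = 1 / (1 - beta(\<cdot>,w))\<close> is accretive because
  multiplication by \<open>beta(\<cdot>,w)\<close> is a contraction; this is where the complete Pick property enters.\<close>
lemma psd_accretive:
  fixes w :: "complex^'d"
  assumes w: "w \<in> open_ball"
  shows "psd open_ball (\<lambda>z v. (K z w + cnj (K v w) - 1) * K z v - K z w * cnj (K v w))"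
proof -
  have nw: "norm w < 1" using w by (simp add: open_ball_def)
  have c: "psd open_ball (\<lambda>z v. beta w w * beta z v - beta z w * beta w v)"
    by (rule psd_kernel_CS[OF psd_beta w])
  define x where "x = (norm w)\<^sup>2"
  have x: "0 \<le> x" "x \<le> 1" using nw by (auto simp: x_def power_le_one)
  define q where "q = (\<Sum>n. b n * x ^ n)"
  have q: "beta w w = of_real q" "0 \<le> 1 - q"
    using B_real[OF x] by (simp_all add: beta_def cinner_self x_def q_def)
  \<comment> \<open>The two summands add up to (beta(z,v) - beta(z,w) beta(w,v)) K(z,v); the second
    accounts for beta(w,w) < 1. After the congruence with K(.,w), the relation beta K = K - 1
    produces the subtracted product K(z,w) cnj(K(v,w)).\<close>
  have "psd open_ball (\<lambda>z v. K z v * (beta w w * beta z v - beta z w * beta w v)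
          + of_real (1 - q) * (beta z v * K z v))"
    by (intro psd_add psd_scale psd_K_mult psd_beta_mult psd_K c q)
  then have "psd open_ball (\<lambda>z v. K z w * (K z v * (beta w w * beta z v - beta z w * beta w v)
          + of_real (1 - q) * (beta z v * K z v)) * cnj (K v w))"
    by (rule psd_congruence)
  also have "?this \<longleftrightarrow> ?thesis"
  proof (rule psd_cong)
    fix z v :: "complex^'d" assume "z \<in> open_ball" "v \<in> open_ball"
    then have n: "norm z < 1" "norm v < 1" by (auto simp: open_ball_def)
    have 1: "K z w * (1 - beta z w) = 1" "K z v * (1 - beta z v) = 1"
      using n nw by (simp_all add: K_beta less_imp_le)
    have "cnj (K v w) = K w v" using n nw by (intro K_commute[symmetric]) auto
    moreover have "K w v * (1 - beta w v) = 1" using n nw by (simp add: K_beta less_imp_le)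
    ultimately have 2: "cnj (K v w) * (1 - beta w v) = 1" by simp
    have h: "k1 * (k2 * (Q * bb - b1 * b2) + (1 - Q) * (bb * k2)) * k3 = (k1 + k3 - 1) * k2 - k1 * k3"
      if "k1 * (1 - b1) = 1" "k2 * (1 - bb) = 1" "k3 * (1 - b2) = 1" for k1 k2 k3 Q bb b1 b2 :: complex
      using that by algebra
    show "K z w * (K z v * (beta w w * beta z v - beta z w * beta w v)
          + of_real (1 - q) * (beta z v * K z v)) * cnj (K v w)
        = (K z w + cnj (K v w) - 1) * K z v - K z w * cnj (K v w)"
      using h[OF 1(1) 1(2) 2, of "of_real q"] by (simp add: q)
  qed
  finally show ?thesis .
qed

end

section \<open>The Hilbert space\<close>

text \<open>For \<open>f\<close> in the space this is, by the reproducing property, the inner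
  product of \<open>f\<close> with the kernel combination with coefficients
  \<open>c\<close>.\<close>

definition pairing :: "'x set \<Rightarrow> ('x \<Rightarrow> complex) \<Rightarrow> ('x \<Rightarrow> complex) \<Rightarrow> complex" where
  "pairing S c f = (\<Sum>x\<in>S. cnj (c x) * f x)"

lemma pairing_add_left: "pairing S (\<lambda>x. c x + d x) f = pairing S c f + pairing S d f"
  and pairing_scale_left: "pairing S (\<lambda>x. r * c x) f = cnj r * pairing S c f"
  and pairing_add: "pairing S c (\<lambda>x. f x + g x) = pairing S c f + pairing S c g"
  and pairing_scale: "pairing S c (\<lambda>x. r * f x) = r * pairing S c f"
  and pairing_mult: "pairing S c (\<lambda>x. g x * f x) = pairing S (\<lambda>x. cnj (g x) * c x) f"
  by (simp_all add: pairing_def algebra_simps sum.distrib sum_distrib_left sum_subtractf)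

lemma pairing_extend:
  assumes "finite T" "S \<subseteq> T"
  shows "pairing T (\<lambda>x. if x \<in> S then c x else 0) f = pairing S c f"
  unfolding pairing_def using assms by (intro sum.mono_neutral_cong_right) auto

context pick_space begin

text \<open>The squared norm of \<open>kernel_comb S c\<close>.\<close>

definition En :: "(complex^'d) set \<Rightarrow> (complex^'d \<Rightarrow> complex) \<Rightarrow> real" where
  "En S c = Re (bform S K c c)"

definition kernel_comb :: "(complex^'d) set \<Rightarrow> (complex^'d \<Rightarrow> complex) \<Rightarrow> complex^'d \<Rightarrow> complex" where
  "kernel_comb S c z = (\<Sum>y\<in>S. c y * K z y)"

lemma En_nonneg: "finite S \<Longrightarrow> S \<subseteq> open_ball \<Longrightarrow> 0 \<le> En S c"
  unfolding En_def by (rule psd_Re[OF psd_K])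

lemma bform_K_self: "finite S \<Longrightarrow> S \<subseteq> open_ball \<Longrightarrow> bform S K c c = of_real (En S c)"
  using psd_Im[OF psd_K, of S c] by (simp add: En_def complex_eq_iff)

lemma bform_K_swap: assumes "S \<subseteq> open_ball" shows "bform S K d c = cnj (bform S K c d)"
  by (rule bform_hermitian, rule psd_hermitian[OF psd_K]) (use assms in auto)

lemma En_add:
  assumes "S \<subseteq> open_ball"
  shows "En S (\<lambda>x. c x + d x) = En S c + 2 * Re (bform S K c d) + En S d"
  by (simp add: En_def bform_add_left bform_add_right bform_K_swap[OF assms, of d c])

lemma En_scale: "En S (\<lambda>x. r * c x) = (cmod r)\<^sup>2 * En S c"
proof -
  have "bform S K (\<lambda>x. r * c x) (\<lambda>x. r * c x) = of_real ((cmod r)\<^sup>2) * bform S K c c"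
    unfolding bform_scale_left bform_scale_right complex_norm_square by simp
  then show ?thesis by (simp add: En_def del: of_real_power)
qed

lemma En_extend:
  assumes "finite T" "S \<subseteq> T"
  shows "En T (\<lambda>x. if x \<in> S then c x else 0) = En S c"
proof -
  have "bform T K (\<lambda>x. if x \<in> S then c x else 0) (\<lambda>x. if x \<in> S then c x else 0)
      = bform S K (\<lambda>x. if x \<in> S then c x else 0) (\<lambda>x. if x \<in> S then c x else 0)"
    by (rule bform_extend) (use assms in auto)
  also have "\<dots> = bform S K c c" by (simp add: bform_def)
  finally show ?thesis by (simp add: En_def)
qed

lemma pairing_kernel_comb: "pairing S d (kernel_comb S c) = bform S K d c"
  by (simp add: pairing_def kernel_comb_def bform_def sum_distrib_left mult_ac)

lemma kernel_comb_extend: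
  assumes "finite T" "S \<subseteq> T"
  shows "kernel_comb T (\<lambda>x. if x \<in> S then c x else 0) = kernel_comb S c"
  unfolding kernel_comb_def using assms by (intro ext sum.mono_neutral_cong_right) auto

lemma kernel_comb_scale: "kernel_comb S (\<lambda>x. r * c x) z = r * kernel_comb S c z"
  by (simp add: kernel_comb_def sum_distrib_left mult_ac)

text \<open>Tested on coefficients \<open>c\<close>, the Aronszajn condition reads |<f,v>|^2 \<le>
  C^2 |v|^2 for the kernel combination v. So \<open>C\<close> bounds the functional that
  \<open>f\<close> induces on the span of the kernel functions.\<close>

lemma H_bound_iff:
  "H_bound a f C \<longleftrightarrow> 0 \<le> C \<and>
     (\<forall>S c. finite S \<longrightarrow> S \<subseteq> open_ball \<longrightarrow> cmod (pairing S c f) \<le> C * sqrt (En S c))"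
proof -
  have "bform S (\<lambda>z w. complex_of_real (C\<^sup>2) * K z w - f z * cnj (f w)) c c \<in> \<real>\<^sub>\<ge>\<^sub>0
      \<longleftrightarrow> cmod (pairing S c f) \<le> C * sqrt (En S c)"
    if "finite S" "S \<subseteq> open_ball" "0 \<le> C" for S c
  proof -
    have "bform S (\<lambda>z w. complex_of_real (C\<^sup>2) * K z w - f z * cnj (f w)) c c
        = bform S (\<lambda>z w. complex_of_real (C\<^sup>2) * K z w) c c - bform S (\<lambda>z w. f z * cnj (f w)) c c"
      unfolding bform_def by (simp add: right_diff_distrib sum_subtractf)
    also have "\<dots> = of_real (C\<^sup>2 * En S c - (cmod (pairing S c f))\<^sup>2)"
      unfolding bform_scale_kernel bform_rank1 pairing_def[symmetric] bform_K_self[OF that(1,2)]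
      by (simp only: of_real_diff of_real_mult complex_norm_square)
    finally have "bform S (\<lambda>z w. complex_of_real (C\<^sup>2) * K z w - f z * cnj (f w)) c c \<in> \<real>\<^sub>\<ge>\<^sub>0
        \<longleftrightarrow> (cmod (pairing S c f))\<^sup>2 \<le> C\<^sup>2 * En S c"
      by (simp only: nonneg_Reals_of_real_iff) simp
    also have "\<dots> \<longleftrightarrow> (cmod (pairing S c f))\<^sup>2 \<le> (C * sqrt (En S c))\<^sup>2"
      using En_nonneg[OF that(1,2), of c] by (simp add: power_mult_distrib)
    also have "\<dots> \<longleftrightarrow> cmod (pairing S c f) \<le> C * sqrt (En S c)"
      using that(3) En_nonneg[OF that(1,2), of c] by (intro power_mono_iff) auto
    finally show ?thesis .
  qed
  then show ?thesis
    unfolding H_bound_def pos_kernel_iff_psd psd_def by blast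
qed

lemma H_boundD:
  "H_bound a f C \<Longrightarrow> finite S \<Longrightarrow> S \<subseteq> open_ball \<Longrightarrow> cmod (pairing S c f) \<le> C * sqrt (En S c)"
  "H_bound a f C \<Longrightarrow> 0 \<le> C"
  by (auto simp: H_bound_iff)

lemma H_boundI:
  "0 \<le> C \<Longrightarrow> (\<And>S c. finite S \<Longrightarrow> S \<subseteq> open_ball \<Longrightarrow> cmod (pairing S c f) \<le> C * sqrt (En S c)) \<Longrightarrow> H_bound a f C"
  by (auto simp: H_bound_iff)

lemma H_bound_mono: "H_bound a f C \<Longrightarrow> C \<le> D \<Longrightarrow> H_bound a f D"
  unfolding H_bound_iff by (meson En_nonneg mult_right_mono order_trans real_sqrt_ge_zero)

lemma H_bound_zero: "H_bound a (\<lambda>z. 0) 0"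
  by (simp add: H_bound_iff pairing_def)

lemma H_bound_add:
  assumes "H_bound a f C" "H_bound a g D" shows "H_bound a (\<lambda>z. f z + g z) (C + D)"
proof (rule H_boundI)
  fix S c assume S: "finite (S :: (complex^'a) set)" "S \<subseteq> open_ball"
  have "cmod (pairing S c (\<lambda>z. f z + g z)) \<le> cmod (pairing S c f) + cmod (pairing S c g)"
    by (simp add: pairing_add norm_triangle_ineq)
  also have "\<dots> \<le> (C + D) * sqrt (En S c)"
    using H_boundD(1)[OF assms(1) S, of c] H_boundD(1)[OF assms(2) S, of c] by (simp add: algebra_simps)
  finally show "cmod (pairing S c (\<lambda>z. f z + g z)) \<le> (C + D) * sqrt (En S c)" .
qed (use assms[THEN H_boundD(2)] in auto)

lemma H_bound_scale:
  assumes "H_bound a f C" shows "H_bound a (\<lambda>z. r * f z) (cmod r * C)"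
  using assms by (auto simp: H_bound_iff pairing_scale norm_mult mult.assoc mult_left_mono)

lemma H_bound_sum:
  "(\<And>i. i \<in> I \<Longrightarrow> H_bound a (f i) (C i)) \<Longrightarrow> H_bound a (\<lambda>z. \<Sum>i\<in>I. f i z) (\<Sum>i\<in>I. C i)"
  by (induction I rule: infinite_finite_induct) (auto intro: H_bound_zero H_bound_add)

lemma H_bound_lim:
  assumes "\<And>n. H_bound a (f n) C" "\<And>z. z \<in> open_ball \<Longrightarrow> (\<lambda>n. f n z) \<longlonglongrightarrow> g z"
  shows "H_bound a g C"
proof (rule H_boundI)
  fix S c assume S: "finite (S :: (complex^'a) set)" "S \<subseteq> open_ball"
  have "(\<lambda>n. cmod (pairing S c (f n))) \<longlonglongrightarrow> cmod (pairing S c g)"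
    unfolding pairing_def using S by (intro tendsto_intros assms(2)) auto
  then show "cmod (pairing S c g) \<le> C * sqrt (En S c)"
    by (rule LIMSEQ_le_const2) (use H_boundD(1)[OF assms(1) S] in auto)
qed (rule H_boundD(2)[OF assms(1)])

lemma H_bound_quadratic_nonneg:
  assumes "H_bound a f C" "finite S" "S \<subseteq> open_ball"
  shows "0 \<le> C\<^sup>2 + 2 * Re (pairing S c f) + En S c"
proof -
  have "- Re (pairing S c f) \<le> C * sqrt (En S c)"
    using H_boundD(1)[OF assms, of c] abs_Re_le_cmod[of "pairing S c f"] by linarith
  moreover have "0 \<le> (C - sqrt (En S c))\<^sup>2" by simp
  moreover have "(C - sqrt (En S c))\<^sup>2 = C\<^sup>2 - 2 * (C * sqrt (En S c)) + En S c"
    using En_nonneg[OF assms(2,3), of c] by (simp add: power2_diff algebra_simps)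
  ultimately show ?thesis by linarith
qed

text \<open>The radicand is the expansion of |f + v|^2 with \<open>C\<close> in place of |f|.
  Pairing f + v with a further combination d, the inequality required is the discriminant of
  \<open>H_bound_quadratic_nonneg\<close> along the line c + cnj(t) d.\<close>

lemma H_bound_add_kernel_comb:
  fixes S :: "(complex^'d) set"
  assumes f: "H_bound a f C" and S: "finite S" "S \<subseteq> open_ball"
  shows "H_bound a (\<lambda>z. f z + kernel_comb S c z) (sqrt (C\<^sup>2 + 2 * Re (pairing S c f) + En S c))"
proof (rule H_boundI)
  define Q where "Q = C\<^sup>2 + 2 * Re (pairing S c f) + En S c"
  have Q: "0 \<le> Q" unfolding Q_def by (rule H_bound_quadratic_nonneg[OF f S])
  show "0 \<le> sqrt Q" using Q by simp
  fix T :: "(complex^'d) set" and d :: "complex^'d \<Rightarrow> complex" assume T: "finite T" "T \<subseteq> open_ball"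
  define U where "U = S \<union> T"
  have U: "finite U" "U \<subseteq> open_ball" "S \<subseteq> U" "T \<subseteq> U" using S T by (auto simp: U_def)
  define c' where "c' = (\<lambda>x. if x \<in> S then c x else 0 :: complex)"
  define d' where "d' = (\<lambda>x. if x \<in> T then d x else 0 :: complex)"
  have c': "pairing U c' f = pairing S c f" "En U c' = En S c" "kernel_comb U c' = kernel_comb S c"
    unfolding c'_def using U by (simp_all add: pairing_extend En_extend kernel_comb_extend)
  have d': "pairing U d' g = pairing T d g" "En U d' = En T d" for g
    unfolding d'_def using U by (simp_all add: pairing_extend En_extend)
  define r where "r = pairing U d' (\<lambda>z. f z + kernel_comb S c z)"
  have r: "r = pairing U d' f + bform U K d' c'"
    by (simp add: r_def pairing_add pairing_kernel_comb c'(3)[symmetric])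
  have "(cmod r)\<^sup>2 \<le> Q * En U d'"
  proof (rule quadratic_nonneg_imp)
    fix t
    define e where "e x = c' x + cnj t * d' x" for x
    have "0 \<le> C\<^sup>2 + 2 * Re (pairing U e f) + En U e"
      by (rule H_bound_quadratic_nonneg[OF f U(1,2)])
    also have "pairing U e f = pairing U c' f + t * pairing U d' f"
      unfolding e_def by (simp add: pairing_add_left pairing_scale_left)
    also have "En U e = En U c' + 2 * Re (bform U K c' (\<lambda>x. cnj t * d' x)) + (cmod t)\<^sup>2 * En U d'"
      unfolding e_def by (simp add: En_add[OF U(2)] En_scale)
    also have "bform U K c' (\<lambda>x. cnj t * d' x) = cnj (t * bform U K d' c')"
      by (simp add: bform_scale_right bform_K_swap[OF U(2), of d' c'])
    finally show "0 \<le> Q + 2 * Re (t * r) + (cmod t)\<^sup>2 * En U d'"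
      by (simp add: Q_def c' r algebra_simps)
  qed
  then have "cmod r \<le> sqrt (Q * En U d')"
    by (rule real_le_rsqrt)
  then show "cmod (pairing T d (\<lambda>z. f z + kernel_comb S c z)) \<le> sqrt Q * sqrt (En T d)"
    by (simp add: r_def d' real_sqrt_mult)
qed

lemma H_bound_kernel_comb: "finite S \<Longrightarrow> S \<subseteq> open_ball \<Longrightarrow> H_bound a (kernel_comb S c) (sqrt (En S c))"
  using H_bound_add_kernel_comb[OF H_bound_zero, of S c] by (simp add: pairing_def)

lemma H_norm_le: "H_bound a f C \<Longrightarrow> H_norm a f \<le> C"
  unfolding H_norm_def by (rule cInf_lower) (auto intro!: bdd_belowI[of _ 0] H_boundD(2))

text \<open>The infimum is attained because each inequality that defines a bound is closed in the
  constant; where \<open>En S c\<close> vanishes, any bound already forces the pairing to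
  vanish.\<close>

lemma H_bound_H_norm: assumes "in_H a f" shows "H_bound a f (H_norm a f)"
proof -
  have ne: "{C. H_bound a f C} \<noteq> {}" using assms by (auto simp: in_H_def)
  show ?thesis
  proof (rule H_boundI)
    show "0 \<le> H_norm a f" unfolding H_norm_def by (rule cInf_greatest[OF ne]) (auto dest: H_boundD(2))
    fix S c assume S: "finite (S :: (complex^'a) set)" "S \<subseteq> open_ball"
    show "cmod (pairing S c f) \<le> H_norm a f * sqrt (En S c)"
    proof (cases "En S c = 0")
      case True
      then show ?thesis using ne H_boundD(1)[of f _ S c] S by auto
    next
      case False
      then have p: "0 < sqrt (En S c)" using En_nonneg[OF S, of c] by simp
      have "cmod (pairing S c f) / sqrt (En S c) \<le> H_norm a f"
        unfolding H_norm_def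
        by (rule cInf_greatest[OF ne]) (use p H_boundD(1)[of f _ S c] S in \<open>auto simp: divide_le_eq\<close>)
      then show ?thesis using p by (simp add: divide_le_eq)
    qed
  qed
qed

lemma H_norm_nonneg: "in_H a f \<Longrightarrow> 0 \<le> H_norm a f"
  using H_bound_H_norm H_boundD(2) by blast

lemma in_H_zero: "in_H a (\<lambda>z. 0)"
  and in_H_add: "in_H a f \<Longrightarrow> in_H a g \<Longrightarrow> in_H a (\<lambda>z. f z + g z)"
  and in_H_scale: "in_H a f \<Longrightarrow> in_H a (\<lambda>z. r * f z)"
  and in_H_kernel_comb: "finite S \<Longrightarrow> S \<subseteq> open_ball \<Longrightarrow> in_H a (kernel_comb S c)"
  unfolding in_H_def using H_bound_zero H_bound_add H_bound_scale H_bound_kernel_comb by blast+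

lemma in_H_diff: "in_H a f \<Longrightarrow> in_H a g \<Longrightarrow> in_H a (\<lambda>z. f z - g z)"
  using in_H_add[of f "\<lambda>z. (-1) * g z"] in_H_scale[of g "-1"] by simp

lemma H_norm_zero: "H_norm a (\<lambda>z. 0) = 0"
  using H_norm_le[OF H_bound_zero] H_norm_nonneg[OF in_H_zero] by (rule antisym)

lemma H_norm_add: "in_H a f \<Longrightarrow> in_H a g \<Longrightarrow> H_norm a (\<lambda>z. f z + g z) \<le> H_norm a f + H_norm a g"
  by (intro H_norm_le H_bound_add H_bound_H_norm)

lemma H_norm_scale_le: "in_H a f \<Longrightarrow> H_norm a (\<lambda>z. r * f z) \<le> cmod r * H_norm a f"
  by (intro H_norm_le H_bound_scale H_bound_H_norm)

lemma H_norm_scale: assumes "in_H a f" shows "H_norm a (\<lambda>z. r * f z) = cmod r * H_norm a f"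
proof (cases "r = 0")
  case True then show ?thesis by (simp add: H_norm_zero)
next
  case False
  have "H_norm a f \<le> cmod (1 / r) * H_norm a (\<lambda>z. r * f z)"
    using H_norm_scale_le[OF in_H_scale[OF assms, of r], of "1 / r"] False by simp
  then have "cmod r * H_norm a f \<le> H_norm a (\<lambda>z. r * f z)"
    using False by (simp add: norm_divide field_simps)
  with H_norm_scale_le[OF assms, of r] show ?thesis by simp
qed

lemma H_norm_triangle_diff:
  assumes "in_H a f" "in_H a g"
  shows "\<bar>H_norm a f - H_norm a g\<bar> \<le> H_norm a (\<lambda>z. f z - g z)"
proof -
  have "H_norm a f \<le> H_norm a (\<lambda>z. f z - g z) + H_norm a g"
    using H_norm_add[OF in_H_diff[OF assms] assms(2)] by simp
  moreover have "H_norm a g \<le> H_norm a (\<lambda>z. (-1) * (f z - g z)) + H_norm a f"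
    using H_norm_add[OF in_H_scale[OF in_H_diff[OF assms], of "-1"] assms(1)] by simp
  ultimately show ?thesis
    using H_norm_scale[OF in_H_diff[OF assms], of "-1"] by simp
qed

text \<open>One inequality is \<open>H_bound_add_kernel_comb\<close>; the other is the same one
  applied to f + v and -v. The exact value makes the polarized inner product computable against
  kernel combinations.\<close>

lemma H_norm_add_kernel_comb:
  assumes f: "in_H a f" and S: "finite S" "S \<subseteq> open_ball"
  shows "(H_norm a (\<lambda>z. f z + kernel_comb S c z))\<^sup>2 = (H_norm a f)\<^sup>2 + 2 * Re (pairing S c f) + En S c"
proof -
  have le: "(H_norm a (\<lambda>z. g z + kernel_comb S d z))\<^sup>2 \<le> (H_norm a g)\<^sup>2 + 2 * Re (pairing S d g) + En S d"
    if g: "in_H a g" for g d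
  proof -
    have "H_norm a (\<lambda>z. g z + kernel_comb S d z) \<le> sqrt ((H_norm a g)\<^sup>2 + 2 * Re (pairing S d g) + En S d)"
      by (rule H_norm_le[OF H_bound_add_kernel_comb[OF H_bound_H_norm[OF g] S]])
    then have "(H_norm a (\<lambda>z. g z + kernel_comb S d z))\<^sup>2 \<le> (sqrt ((H_norm a g)\<^sup>2 + 2 * Re (pairing S d g) + En S d))\<^sup>2"
      by (intro power_mono H_norm_nonneg in_H_add g in_H_kernel_comb S)
    also have "\<dots> = (H_norm a g)\<^sup>2 + 2 * Re (pairing S d g) + En S d"
      by (rule real_sqrt_pow2[OF H_bound_quadratic_nonneg[OF H_bound_H_norm[OF g] S]])
    finally show ?thesis .
  qed
  have "(H_norm a f)\<^sup>2 \<le> (H_norm a (\<lambda>z. f z + kernel_comb S c z))\<^sup>2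
        + 2 * Re (pairing S (\<lambda>x. (-1) * c x) (\<lambda>z. f z + kernel_comb S c z)) + En S (\<lambda>x. (-1) * c x)"
    using le[OF in_H_add[OF f in_H_kernel_comb[OF S]], of c "\<lambda>x. (-1) * c x"] by (simp only: kernel_comb_scale) simp
  also have "\<dots> = (H_norm a (\<lambda>z. f z + kernel_comb S c z))\<^sup>2 - 2 * Re (pairing S c f) - En S c"
    unfolding pairing_scale_left En_scale pairing_add pairing_kernel_comb bform_K_self[OF S] by simp
  finally show ?thesis using le[OF f, of c] by simp
qed

section \<open>The inner product obtained by polarization\<close>

lemma sum_i_powers: "(\<Sum>k<4::nat. \<i> ^ k * of_real (2 * Re (cnj (\<i> ^ k) * z))) = 4 * z"
  "(\<Sum>k<4::nat. \<i> ^ k * of_real (2 * Re (\<i> ^ k * z))) = 4 * cnj z"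
  "(\<Sum>k<4::nat. \<i> ^ k * of_real r) = 0"
  by (simp_all add: numeral_eq_Suc complex_eq_iff)

lemma H_inner_kernel_comb_right:
  assumes f: "in_H a f" and S: "finite S" "S \<subseteq> open_ball"
  shows "H_inner a f (kernel_comb S c) = pairing S c f"
proof -
  have "(H_norm a (\<lambda>z. f z + \<i> ^ k * kernel_comb S c z))\<^sup>2
      = ((H_norm a f)\<^sup>2 + En S c) + 2 * Re (cnj (\<i> ^ k) * pairing S c f)" for k
    using H_norm_add_kernel_comb[OF f S, of "\<lambda>x. \<i> ^ k * c x"]
    by (simp add: kernel_comb_scale pairing_scale_left En_scale norm_power)
  then have "H_inner a f (kernel_comb S c) = (1/4) * ((\<Sum>k<4::nat. \<i> ^ k * of_real ((H_norm a f)\<^sup>2 + En S c))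
      + (\<Sum>k<4::nat. \<i> ^ k * of_real (2 * Re (cnj (\<i> ^ k) * pairing S c f))))"
    unfolding H_inner_def by (simp only: of_real_add distrib_left sum.distrib)
  then show ?thesis by (simp only: sum_i_powers) simp
qed

lemma H_inner_kernel_comb_left:
  assumes g: "in_H a g" and S: "finite S" "S \<subseteq> open_ball"
  shows "H_inner a (kernel_comb S c) g = cnj (pairing S c g)"
proof -
  have "(H_norm a (\<lambda>z. kernel_comb S c z + \<i> ^ k * g z))\<^sup>2
      = ((H_norm a g)\<^sup>2 + En S c) + 2 * Re (\<i> ^ k * pairing S c g)" for k
    using H_norm_add_kernel_comb[OF in_H_scale[OF g, of "\<i> ^ k"] S, of c]
    by (simp add: H_norm_scale[OF g] pairing_scale norm_power add.commute)
  then have "H_inner a (kernel_comb S c) g = (1/4) * ((\<Sum>k<4::nat. \<i> ^ k * of_real ((H_norm a g)\<^sup>2 + En S c))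
      + (\<Sum>k<4::nat. \<i> ^ k * of_real (2 * Re (\<i> ^ k * pairing S c g))))"
    unfolding H_inner_def by (simp only: of_real_add distrib_left sum.distrib)
  then show ?thesis by (simp only: sum_i_powers) simp
qed

text \<open>If N is the norm of \<open>f\<close>, then N - d is not a bound, so some kernel
  combination v almost attains |<f,v>| = N |v|. Removing from \<open>f\<close> its component along v
  leaves a squared norm of at most N^2 - (N - d)^2.\<close>

lemma kernel_comb_dense:
  assumes f: "in_H a f" and e: "0 < e"
  obtains S c where "finite S" "S \<subseteq> open_ball" "H_norm a (\<lambda>z. f z - kernel_comb S c z) \<le> e"
proof (cases "H_norm a f = 0")
  case True
  then show ?thesis using e by (intro that[of "{}" undefined]) (auto simp: kernel_comb_def)
next
  case False
  define N where "N = H_norm a f"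
  have N: "0 < N" using False H_norm_nonneg[OF f] by (simp add: N_def)
  \<comment> \<open>Makes 2 N d \<le> e^2, which bounds the remainder; the minimum with N keeps N -
    d nonnegative.\<close>
  define d where "d = min N (e\<^sup>2 / (2 * N))"
  have d: "0 < d" "d \<le> N" "2 * N * d \<le> e\<^sup>2"
    using N e by (auto simp: d_def min_def field_simps)
  have "\<not> H_bound a f (N - d)" using H_norm_le[of f "N - d"] d N_def by auto
  then obtain S c where S: "finite S" "S \<subseteq> open_ball" and gt: "(N - d) * sqrt (En S c) < cmod (pairing S c f)"
    using d unfolding H_bound_iff by (auto simp: not_le)
  define m where "m = cmod (pairing S c f)"
  have "En S c \<noteq> 0" using gt H_boundD(1)[OF H_bound_H_norm[OF f] S, of c] by auto
  then have E: "0 < En S c" using En_nonneg[OF S, of c] by simp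
  \<comment> \<open>Minus the coefficient of the projection of \<open>f\<close> onto the line
    spanned by \<open>kernel_comb S c\<close>.\<close>
  define l where "l = - pairing S c f / of_real (En S c)"
  have cl: "(cmod l)\<^sup>2 * En S c = m\<^sup>2 / En S c"
    using E by (simp add: l_def m_def norm_divide power_divide power2_eq_square)
  have "cnj l * pairing S c f = - of_real (m\<^sup>2) / of_real (En S c)"
    unfolding l_def m_def complex_norm_square by simp
  then have rl: "Re (cnj l * pairing S c f) = - m\<^sup>2 / En S c"
    by (simp del: of_real_power flip: of_real_minus of_real_divide)
  have "(H_norm a (\<lambda>z. f z + kernel_comb S (\<lambda>x. l * c x) z))\<^sup>2 = N\<^sup>2 - m\<^sup>2 / En S c"
    unfolding H_norm_add_kernel_comb[OF f S] pairing_scale_left En_scale rl cl N_def by simp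
  also have "\<dots> \<le> N\<^sup>2 - (N - d)\<^sup>2"
  proof -
    have "((N - d) * sqrt (En S c))\<^sup>2 \<le> m\<^sup>2"
      using gt d E by (intro power_mono) (auto simp: m_def)
    then have "(N - d)\<^sup>2 * En S c \<le> m\<^sup>2" using E by (simp only: power_mult_distrib real_sqrt_pow2)
    then show ?thesis using E by (simp add: pos_le_divide_eq)
  qed
  also have "\<dots> = 2 * N * d - d\<^sup>2" by (simp add: power2_eq_square algebra_simps)
  also have "\<dots> \<le> e\<^sup>2" using d(3) zero_le_power2[of d] by linarith
  finally have "H_norm a (\<lambda>z. f z + kernel_comb S (\<lambda>x. l * c x) z) \<le> e"
    using e by (meson less_imp_le power2_le_imp_le)
  then have "H_norm a (\<lambda>z. f z - kernel_comb S (\<lambda>x. - l * c x) z) \<le> e"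
    by (simp only: kernel_comb_scale) simp
  then show ?thesis using that[OF S] by blast
qed

text \<open>Each of the four squared norms in the polarization formula changes by a difference of
  norms times a sum of norms, which yields joint continuity directly from the definition.\<close>

lemma H_inner_diff_le:
  assumes H: "in_H a f" "in_H a g" "in_H a f'" "in_H a g'"
  shows "cmod (H_inner a f g - H_inner a f' g')
    \<le> (H_norm a (\<lambda>z. f z - f' z) + H_norm a (\<lambda>z. g z - g' z))
      * (H_norm a f + H_norm a g + H_norm a f' + H_norm a g')"
proof -
  define D where "D = H_norm a (\<lambda>z. f z - f' z) + H_norm a (\<lambda>z. g z - g' z)"
  define M where "M = H_norm a f + H_norm a g + H_norm a f' + H_norm a g'"
  define n where "n k = H_norm a (\<lambda>z. f z + \<i> ^ k * g z)" for k :: nat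
  define n' where "n' k = H_norm a (\<lambda>z. f' z + \<i> ^ k * g' z)" for k :: nat
  have u: "cmod (\<i> ^ k) = 1" for k :: nat by (simp add: norm_power)
  have nn: "0 \<le> n k" "0 \<le> n' k" for k
    unfolding n_def n'_def by (intro H_norm_nonneg in_H_add in_H_scale H)+
  have t: "\<bar>(n k)\<^sup>2 - (n' k)\<^sup>2\<bar> \<le> D * M" for k
  proof -
    have "\<bar>n k - n' k\<bar> \<le> H_norm a (\<lambda>z. (f z + \<i> ^ k * g z) - (f' z + \<i> ^ k * g' z))"
      unfolding n_def n'_def by (intro H_norm_triangle_diff in_H_add in_H_scale H)
    also have "(\<lambda>z. (f z + \<i> ^ k * g z) - (f' z + \<i> ^ k * g' z)) = (\<lambda>z. (f z - f' z) + \<i> ^ k * (g z - g' z))"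
      by (simp add: algebra_simps)
    also have "H_norm a \<dots> \<le> D"
      unfolding D_def
      using H_norm_add[OF in_H_diff[OF H(1,3)] in_H_scale[OF in_H_diff[OF H(2,4)], of "\<i> ^ k"]]
        H_norm_scale[OF in_H_diff[OF H(2,4)], of "\<i> ^ k"] u by simp
    finally have 1: "\<bar>n k - n' k\<bar> \<le> D" .
    have "n k \<le> H_norm a f + H_norm a g"
      unfolding n_def using H_norm_add[OF H(1) in_H_scale[OF H(2), of "\<i> ^ k"]]
        H_norm_scale[OF H(2), of "\<i> ^ k"] u by simp
    moreover have "n' k \<le> H_norm a f' + H_norm a g'"
      unfolding n'_def using H_norm_add[OF H(3) in_H_scale[OF H(4), of "\<i> ^ k"]]
        H_norm_scale[OF H(4), of "\<i> ^ k"] u by simp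
    ultimately have 2: "n k + n' k \<le> M" by (simp add: M_def)
    have "\<bar>(n k)\<^sup>2 - (n' k)\<^sup>2\<bar> = \<bar>n k - n' k\<bar> * (n k + n' k)"
      using nn[of k] by (simp add: power2_eq_square square_diff_square_factored abs_mult mult.commute)
    also have "\<dots> \<le> D * M" using 1 2 nn[of k] by (intro mult_mono) auto
    finally show ?thesis .
  qed
  have "H_inner a f g - H_inner a f' g' = (1/4) * (\<Sum>k<4::nat. \<i> ^ k * of_real ((n k)\<^sup>2 - (n' k)\<^sup>2))"
    unfolding H_inner_def n_def n'_def by (simp add: right_diff_distrib sum_subtractf)
  also have "cmod \<dots> \<le> (1/4) * (\<Sum>k<4::nat. cmod (\<i> ^ k * of_real ((n k)\<^sup>2 - (n' k)\<^sup>2)))"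
    unfolding norm_mult[of "1/4"] by (intro mult_mono norm_sum) auto
  also have "\<dots> \<le> (1/4) * (\<Sum>k<4::nat. D * M)"
    using t by (intro mult_left_mono sum_mono) (auto simp: norm_mult u simp del: of_real_diff)
  also have "\<dots> = D * M" by simp
  finally show ?thesis by (simp add: D_def M_def)
qed

lemma H_inner_zero: "H_inner a (\<lambda>z. 0) (\<lambda>z. 0) = 0"
  by (simp add: H_inner_def H_norm_zero)

text \<open>Squares rather than a product on the right, so that square-summable families give an
  absolutely summable series.\<close>

lemma H_inner_le:
  assumes "in_H a f" "in_H a g"
  shows "cmod (H_inner a f g) \<le> 2 * (H_norm a f)\<^sup>2 + 2 * (H_norm a g)\<^sup>2"
proof -
  have "cmod (H_inner a f g) \<le> (H_norm a f + H_norm a g)\<^sup>2"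
    using H_inner_diff_le[OF assms in_H_zero in_H_zero] by (simp add: H_inner_zero H_norm_zero power2_eq_square)
  also have "\<dots> \<le> 2 * (H_norm a f)\<^sup>2 + 2 * (H_norm a g)\<^sup>2"
    using sum_squares_bound[of "H_norm a f" "H_norm a g"] by (simp add: power2_sum)
  finally show ?thesis .
qed

end

section \<open>Multipliers\<close>

lemma cpoly_sum: "(\<And>i. i \<in> I \<Longrightarrow> cpoly (p i)) \<Longrightarrow> cpoly (\<lambda>z. \<Sum>i\<in>I. p i z)"
  by (induction I rule: infinite_finite_induct) (auto intro: cpoly.intros)

lemma cpoly_power: "cpoly p \<Longrightarrow> cpoly (\<lambda>z. p z ^ n)"
  by (induction n) (auto intro: cpoly.intros)

lemma cpoly_cinner: "cpoly (\<lambda>z. cinner z w)"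
  unfolding cinner_def by (intro cpoly_sum cpoly.intros)

lemma continuous_on_cpoly: "cpoly p \<Longrightarrow> continuous_on S p"
  by (induction rule: cpoly.induct) (auto intro!: continuous_intros)

context pick_space begin

lemma sqrt_En_triangle:
  assumes S: "finite S" "S \<subseteq> open_ball"
  shows "sqrt (En S (\<lambda>x. c x + d x)) \<le> sqrt (En S c) + sqrt (En S d)"
proof (rule real_le_lsqrt)
  have "Re (bform S K c d) \<le> sqrt (En S d) * sqrt (En S c)"
    using H_boundD(1)[OF H_bound_kernel_comb[OF S, of d] S, of c] complex_Re_le_cmod[of "bform S K c d"]
    by (simp add: pairing_kernel_comb mult.commute)
  then show "En S (\<lambda>x. c x + d x) \<le> (sqrt (En S c) + sqrt (En S d))\<^sup>2"
    using En_nonneg[OF S] by (simp add: En_add[OF S(2)] power2_sum mult.commute)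
qed (use En_nonneg[OF S] in auto)

text \<open>\<open>mult_bound \<phi> C\<close>: \<open>\<phi>\<close> is bounded by \<open>C\<close> on the closed ball and multiplication by \<open>\<phi>\<close> has norm at most
  \<open>C\<close> on the space, the latter expressed by the adjoint acting on kernel functions.\<close>
definition mult_bound :: "(complex^'d \<Rightarrow> complex) \<Rightarrow> real \<Rightarrow> bool" where
  "mult_bound \<phi> C \<longleftrightarrow> 0 \<le> C \<and> (\<forall>z. norm z \<le> 1 \<longrightarrow> cmod (\<phi> z) \<le> C) \<and>
    (\<forall>S c. finite S \<longrightarrow> S \<subseteq> open_ball \<longrightarrow> sqrt (En S (\<lambda>x. cnj (\<phi> x) * c x)) \<le> C * sqrt (En S c))"

lemma mult_boundI:
  assumes "0 \<le> C" "\<And>z. norm z \<le> 1 \<Longrightarrow> cmod (\<phi> z) \<le> C"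
    "\<And>S c. finite S \<Longrightarrow> S \<subseteq> open_ball \<Longrightarrow> sqrt (En S (\<lambda>x. cnj (\<phi> x) * c x)) \<le> C * sqrt (En S c)"
  shows "mult_bound \<phi> C"
  using assms by (simp add: mult_bound_def)

lemma mult_boundD: assumes "mult_bound \<phi> C"
  shows "0 \<le> C" "norm z \<le> 1 \<Longrightarrow> cmod (\<phi> z) \<le> C"
    "finite S \<Longrightarrow> S \<subseteq> open_ball \<Longrightarrow> sqrt (En S (\<lambda>x. cnj (\<phi> x) * c x)) \<le> C * sqrt (En S c)"
  using assms by (auto simp: mult_bound_def)

text \<open>The kernel condition is the positivity of C^2 minus the multiplication operator times
  its adjoint, tested on kernel functions; the adjoint sends K(.,x) to cnj(\<phi>(x))
  K(.,x).\<close>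

lemma mult_boundI_psd:
  assumes C: "0 \<le> C" and sup: "\<And>z. norm z \<le> 1 \<Longrightarrow> cmod (\<phi> z) \<le> C"
    and psd: "psd open_ball (\<lambda>z v. (of_real (C\<^sup>2) - \<phi> z * cnj (\<phi> v)) * K z v)"
  shows "mult_bound \<phi> C"
proof (rule mult_boundI[OF C sup])
  fix S c assume S: "finite (S :: (complex^'a) set)" "S \<subseteq> open_ball"
  have "bform S (\<lambda>z v. (of_real (C\<^sup>2) - \<phi> z * cnj (\<phi> v)) * K z v) c c
      = of_real (C\<^sup>2) * bform S K c c - bform S K (\<lambda>x. cnj (\<phi> x) * c x) (\<lambda>x. cnj (\<phi> x) * c x)"
    by (simp add: bform_def left_diff_distrib right_diff_distrib sum_subtractf sum_distrib_left mult_ac)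
  then have "En S (\<lambda>x. cnj (\<phi> x) * c x) \<le> C\<^sup>2 * En S c"
    using psd_Re[OF psd S, of c] by (simp add: En_def del: of_real_power)
  then have "sqrt (En S (\<lambda>x. cnj (\<phi> x) * c x)) \<le> sqrt (C\<^sup>2 * En S c)" by simp
  then show "sqrt (En S (\<lambda>x. cnj (\<phi> x) * c x)) \<le> C * sqrt (En S c)"
    using C by (simp add: real_sqrt_mult)
qed

lemma mult_bound_mono: "mult_bound \<phi> C \<Longrightarrow> C \<le> D \<Longrightarrow> mult_bound \<phi> D"
proof (rule mult_boundI)
  fix S c assume m: "mult_bound \<phi> C" "C \<le> D" and S: "finite (S :: (complex^'a) set)" "S \<subseteq> open_ball"
  show "sqrt (En S (\<lambda>x. cnj (\<phi> x) * c x)) \<le> D * sqrt (En S c)"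
    by (rule order_trans[OF mult_boundD(3)[OF m(1) S]]) (use m(2) En_nonneg[OF S] in \<open>auto intro: mult_right_mono\<close>)
qed (use mult_boundD in \<open>force+\<close>)

lemma mult_bound_add:
  assumes "mult_bound \<phi> C" "mult_bound \<psi> D" shows "mult_bound (\<lambda>z. \<phi> z + \<psi> z) (C + D)"
proof (rule mult_boundI)
  show "0 \<le> C + D" using mult_boundD(1)[OF assms(1)] mult_boundD(1)[OF assms(2)] by simp
  show "cmod (\<phi> z + \<psi> z) \<le> C + D" if "norm z \<le> 1" for z
    using mult_boundD(2)[OF assms(1) that] mult_boundD(2)[OF assms(2) that] norm_triangle_ineq[of "\<phi> z" "\<psi> z"] by linarith
  fix S c assume S: "finite (S :: (complex^'a) set)" "S \<subseteq> open_ball"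
  have "sqrt (En S (\<lambda>x. cnj (\<phi> x + \<psi> x) * c x))
      \<le> sqrt (En S (\<lambda>x. cnj (\<phi> x) * c x)) + sqrt (En S (\<lambda>x. cnj (\<psi> x) * c x))"
    using sqrt_En_triangle[OF S] by (simp add: distrib_right)
  also have "\<dots> \<le> (C + D) * sqrt (En S c)"
    using mult_boundD(3)[OF assms(1) S, of c] mult_boundD(3)[OF assms(2) S, of c] by (simp add: distrib_right)
  finally show "sqrt (En S (\<lambda>x. cnj (\<phi> x + \<psi> x) * c x)) \<le> (C + D) * sqrt (En S c)" .
qed

lemma mult_bound_mult:
  assumes "mult_bound \<phi> C" "mult_bound \<psi> D" shows "mult_bound (\<lambda>z. \<phi> z * \<psi> z) (C * D)"
proof (rule mult_boundI)
  show "0 \<le> C * D" using mult_boundD(1)[OF assms(1)] mult_boundD(1)[OF assms(2)] by simp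
  show "cmod (\<phi> z * \<psi> z) \<le> C * D" if "norm z \<le> 1" for z
    using mult_boundD(2)[OF assms(1) that] mult_boundD(2)[OF assms(2) that] mult_boundD(1)[OF assms(1)]
    by (auto simp: norm_mult intro!: mult_mono)
  fix S c assume S: "finite (S :: (complex^'a) set)" "S \<subseteq> open_ball"
  have "sqrt (En S (\<lambda>x. cnj (\<phi> x * \<psi> x) * c x)) \<le> C * sqrt (En S (\<lambda>x. cnj (\<psi> x) * c x))"
    using mult_boundD(3)[OF assms(1) S, of "\<lambda>x. cnj (\<psi> x) * c x"] by (simp add: mult.assoc)
  also have "\<dots> \<le> C * (D * sqrt (En S c))"
    by (intro mult_left_mono mult_boundD(3)[OF assms(2) S] mult_boundD(1)[OF assms(1)])
  finally show "sqrt (En S (\<lambda>x. cnj (\<phi> x * \<psi> x) * c x)) \<le> C * D * sqrt (En S c)" by (simp add: mult.assoc)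
qed

lemma mult_bound_const: "mult_bound (\<lambda>z. r) (cmod r)"
  by (rule mult_boundI) (auto simp: En_scale real_sqrt_mult)

lemma mult_bound_scale: "mult_bound \<phi> C \<Longrightarrow> mult_bound (\<lambda>z. r * \<phi> z) (cmod r * C)"
  by (rule mult_bound_mult[OF mult_bound_const])

lemma mult_bound_diff:
  assumes "mult_bound \<phi> C" "mult_bound \<psi> D" shows "mult_bound (\<lambda>z. \<phi> z - \<psi> z) (C + D)"
  using mult_bound_add[OF assms(1) mult_bound_scale[OF assms(2), of "-1"]] by simp

lemma mult_bound_sum: "(\<And>i. i \<in> I \<Longrightarrow> mult_bound (\<phi> i) (C i)) \<Longrightarrow> mult_bound (\<lambda>z. \<Sum>i\<in>I. \<phi> i z) (\<Sum>i\<in>I. C i)"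
  using mult_bound_const[of 0] by (induction I rule: infinite_finite_induct) (auto intro: mult_bound_add)

lemma mult_bound_power: "mult_bound \<phi> C \<Longrightarrow> mult_bound (\<lambda>z. \<phi> z ^ n) (C ^ n)"
  using mult_bound_const[of 1] by (induction n) (auto intro: mult_bound_mult)

lemma mult_bound_lim:
  assumes "\<And>n. mult_bound (\<phi> n) C" "\<And>z. norm z \<le> 1 \<Longrightarrow> (\<lambda>n. \<phi> n z) \<longlonglongrightarrow> \<psi> z"
  shows "mult_bound \<psi> C"
proof (rule mult_boundI)
  show "0 \<le> C" by (rule mult_boundD(1)[OF assms(1)])
  show "cmod (\<psi> z) \<le> C" if "norm z \<le> 1" for z
    by (rule LIMSEQ_le_const2[OF tendsto_norm[OF assms(2)[OF that]]]) (use mult_boundD(2)[OF assms(1) that] in auto)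
  fix S c assume S: "finite (S :: (complex^'a) set)" "S \<subseteq> open_ball"
  have "(\<lambda>n. sqrt (En S (\<lambda>x. cnj (\<phi> n x) * c x))) \<longlonglongrightarrow> sqrt (En S (\<lambda>x. cnj (\<psi> x) * c x))"
    unfolding En_def bform_def
    using S by (intro tendsto_intros assms(2)) (auto simp: open_ball_def)
  then show "sqrt (En S (\<lambda>x. cnj (\<psi> x) * c x)) \<le> C * sqrt (En S c)"
    by (rule LIMSEQ_le_const2) (use mult_boundD(3)[OF assms(1) S] in auto)
qed

lemma mult_bound_suminf:
  assumes m: "\<And>n. mult_bound (\<phi> n) (C n)" and C: "summable C"
  shows "mult_bound (\<lambda>z. \<Sum>n. \<phi> n z) (suminf C)"
proof (rule mult_bound_lim)
  have C0: "0 \<le> C n" for n by (rule mult_boundD(1)[OF m])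
  show "mult_bound (\<lambda>z. \<Sum>n<N. \<phi> n z) (suminf C)" for N
    by (rule mult_bound_mono[OF mult_bound_sum[OF m] sum_le_suminf[OF C]]) (use C0 in auto)
  show "(\<lambda>N. \<Sum>n<N. \<phi> n z) \<longlonglongrightarrow> (\<Sum>n. \<phi> n z)" if "norm z \<le> 1" for z
    by (rule summable_LIMSEQ[OF summable_comparison_test'[OF C]]) (use mult_boundD(2)[OF m that] in auto)
qed

lemma mult_bound_suminf_tail:
  assumes m: "\<And>n. mult_bound (\<phi> n) (C n)" and C: "summable C"
  shows "mult_bound (\<lambda>z. (\<Sum>n. \<phi> n z) - (\<Sum>n<N. \<phi> n z)) (\<Sum>n. C (n + N))"
proof (rule mult_bound_lim[where \<phi> = "\<lambda>M z. \<Sum>n<M. \<phi> (n + N) z"])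
  have C0: "0 \<le> C n" for n by (rule mult_boundD(1)[OF m])
  show "mult_bound (\<lambda>z. \<Sum>n<M. \<phi> (n + N) z) (\<Sum>n. C (n + N))" for M
    by (rule mult_bound_mono[OF mult_bound_sum[OF m] sum_le_suminf[OF summable_ignore_initial_segment[OF C]]]) (use C0 in auto)
  show "(\<lambda>M. \<Sum>n<M. \<phi> (n + N) z) \<longlonglongrightarrow> (\<Sum>n. \<phi> n z) - (\<Sum>n<N. \<phi> n z)" if "norm z \<le> 1" for z
  proof -
    have s: "summable (\<lambda>n. \<phi> n z)"
      by (rule summable_comparison_test'[OF C]) (use mult_boundD(2)[OF m that] in auto)
    show ?thesis
      using summable_LIMSEQ[OF summable_ignore_initial_segment[OF s, of N]]
      by (simp add: suminf_minus_initial_segment[OF s])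
  qed
qed

text \<open>Duality: pairing \<phi> f with \<open>c\<close> is pairing \<open>f\<close> with the
  adjoint image of \<open>c\<close>.\<close>

lemma mult_bound_H_bound:
  assumes "mult_bound \<phi> C" "H_bound a f D" shows "H_bound a (\<lambda>z. \<phi> z * f z) (C * D)"
proof (rule H_boundI)
  show "0 \<le> C * D" using mult_boundD(1)[OF assms(1)] H_boundD(2)[OF assms(2)] by simp
  fix S c assume S: "finite (S :: (complex^'a) set)" "S \<subseteq> open_ball"
  have "cmod (pairing S c (\<lambda>z. \<phi> z * f z)) \<le> D * sqrt (En S (\<lambda>x. cnj (\<phi> x) * c x))"
    unfolding pairing_mult by (rule H_boundD(1)[OF assms(2) S])
  also have "\<dots> \<le> D * (C * sqrt (En S c))"
    by (intro mult_left_mono mult_boundD(3)[OF assms(1) S] H_boundD(2)[OF assms(2)])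
  finally show "cmod (pairing S c (\<lambda>z. \<phi> z * f z)) \<le> C * D * sqrt (En S c)" by (simp add: mult_ac)
qed

lemma mult_bound_in_H: "mult_bound \<phi> C \<Longrightarrow> in_H a f \<Longrightarrow> in_H a (\<lambda>z. \<phi> z * f z)"
  and mult_bound_H_norm: "mult_bound \<phi> C \<Longrightarrow> in_H a f \<Longrightarrow> H_norm a (\<lambda>z. \<phi> z * f z) \<le> C * H_norm a f"
  using mult_bound_H_bound H_bound_H_norm H_norm_le in_H_def by blast+

lemma in_H_one: "in_H a (\<lambda>z :: complex^'d. 1)"
proof -
  have "kernel_comb {0} (\<lambda>_. 1) = (\<lambda>z :: complex^'d. 1)"
    using powser_zero[of "\<lambda>n. complex_of_real (a n)"]
    by (auto simp: kernel_comb_def K_eq A_def cinner_def)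
  moreover have "in_H a (kernel_comb {0 :: complex^'d} (\<lambda>_. 1))"
    by (rule in_H_kernel_comb) (auto simp: open_ball_def)
  ultimately show ?thesis by simp
qed

section \<open>Growth of the coefficients and polynomial multipliers\<close>

text \<open>Only the limit of the ratios a_m / a_(m+1) is known: all but the first N are below
  \<open>r\<close>, and those are bounded by L, which costs the constant L^N.\<close>

lemma a_growth:
  assumes r: "1 < r"
  obtains M where "1 \<le> M" "\<And>m n. a m \<le> M * r ^ n * a (m + n)"
proof -
  obtain N where N: "\<And>m. m \<ge> N \<Longrightarrow> a m / a (Suc m) < r"
    using order_tendstoD(2)[OF a_ratio r] by (auto simp: eventually_sequentially)
  obtain L' where L': "\<And>m. norm (a m / a (Suc m)) \<le> L'"
    by (rule BseqE[OF convergent_imp_Bseq[OF convergentI[OF a_ratio]]]) blast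
  define L where "L = max r L'"
  have L: "a m \<le> L * a (Suc m)" "1 \<le> L" for m
  proof -
    have "a m / a (Suc m) \<le> L" using L'[of m] a_pos by (simp add: L_def le_max_iff_disj abs_of_pos)
    then show "a m \<le> L * a (Suc m)" using a_pos[of "Suc m"] by (simp add: pos_divide_le_eq)
    show "1 \<le> L" using r by (simp add: L_def)
  qed
  \<comment> \<open>The exponent N - m counts the indices still below N and has dropped to 0 once m
    reaches N.\<close>
  have *: "a m \<le> L ^ (N - m) * r ^ n * a (m + n)" for m n
  proof (induction n arbitrary: m)
    case 0
    show ?case using one_le_power[OF L(2), of "N - m"] a_pos[of m] by simp
  next
    case (Suc n)
    show ?case
    proof (cases "m < N")
      case True
      have "a m \<le> L * a (Suc m)" by (rule L)
      also have "\<dots> \<le> L * (L ^ (N - Suc m) * r ^ n * a (Suc m + n))"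
        using L(2) by (intro mult_left_mono Suc.IH) auto
      also have "\<dots> = L ^ (N - m) * r ^ n * a (m + Suc n)"
        using True by (simp add: Suc_diff_Suc[symmetric] mult_ac)
      also have "\<dots> \<le> L ^ (N - m) * r ^ Suc n * a (m + Suc n)"
        using r L(2) a_pos[of "m + Suc n"] by (intro mult_right_mono mult_left_mono) auto
      finally show ?thesis .
    next
      case False
      have "a m \<le> r * a (Suc m)"
        using N[of m] False a_pos[of "Suc m"] by (simp add: pos_divide_less_eq less_imp_le)
      also have "\<dots> \<le> r * (L ^ (N - Suc m) * r ^ n * a (Suc m + n))"
        using r by (intro mult_left_mono Suc.IH) auto
      also have "\<dots> = L ^ (N - m) * r ^ Suc n * a (m + Suc n)" using False by simp
      finally show ?thesis .
    qed
  qed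
  show ?thesis
  proof (rule that[of "L ^ N"])
    show "1 \<le> L ^ N" by (rule one_le_power[OF L(2)])
    fix m n
    have "L ^ (N - m) * r ^ n * a (m + n) \<le> L ^ N * r ^ n * a (m + n)"
      using L(2) r a_pos[of "m + n"] by (intro mult_right_mono power_increasing) auto
    then show "a m \<le> L ^ N * r ^ n * a (m + n)" using *[of m n] by simp
  qed
qed

text \<open>The series of (M - t^n) A(t) has the coefficients M a_m - a_(m-n), with no second term
  for m < n; they are nonnegative by the hypothesis. For n = 1 it says that the row of coordinate
  multiplications has norm at most sqrt M.\<close>

lemma psd_shift:
  assumes M: "\<And>m. a m \<le> M * a (m + n)"
  shows "psd open_ball (\<lambda>z v. (of_real M - cinner z v ^ n) * K z v)"
proof -
  define c where "c m = M * a m - (if m < n then 0 else a (m - n))" for m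
  have "0 < M * a n" using M[of 0] by simp
  then have M0: "0 \<le> M" using a_pos[of n] by (simp add: zero_less_mult_iff)
  have c: "0 \<le> c m" for m
    using M[of "m - n"] M0 a_pos[of m] by (auto simp: c_def less_imp_le)
  have eq: "(\<lambda>m. complex_of_real (c m) * t ^ m) sums ((of_real M - t ^ n) * A t)" if t: "cmod t < 1" for t
  proof -
    have s: "(\<lambda>m. complex_of_real (a m) * t ^ m) sums A t"
      unfolding A_def by (rule summable_sums[OF summable_norm_cancel[OF a_summable[OF t]]])
    have "(\<lambda>m. if m < n then 0 else complex_of_real (a (m - n)) * t ^ m) sums (t ^ n * A t)"
    proof -
      have "(\<lambda>m. complex_of_real (a (m + n - n)) * t ^ (m + n)) sums (t ^ n * A t)"
        using sums_mult[OF s, of "t ^ n"] by (simp add: power_add mult_ac)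
      then show ?thesis
        by (subst sums_zero_iff_shift[of n, symmetric]) auto
    qed
    from sums_diff[OF sums_mult[OF s, of "of_real M"] this]
    have "(\<lambda>m. complex_of_real M * (complex_of_real (a m) * t ^ m)
        - (if m < n then 0 else complex_of_real (a (m - n)) * t ^ m)) sums ((of_real M - t ^ n) * A t)"
      by (simp add: left_diff_distrib)
    moreover have "(\<lambda>m. complex_of_real M * (complex_of_real (a m) * t ^ m)
        - (if m < n then 0 else complex_of_real (a (m - n)) * t ^ m)) = (\<lambda>m. complex_of_real (c m) * t ^ m)"
      by (auto simp: c_def algebra_simps)
    ultimately show ?thesis by simp
  qed
  have "psd open_ball (\<lambda>z v. (\<Sum>m. complex_of_real (c m) * cinner z v ^ m) * 1)"
    by (rule psd_powser_mult[OF psd_one c])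
       (auto intro!: sums_summable[OF eq] norm_cinner_less simp: open_ball_def)
  moreover have "(\<Sum>m. complex_of_real (c m) * cinner z v ^ m) * 1 = (of_real M - cinner z v ^ n) * K z v"
    if "z \<in> open_ball" "v \<in> open_ball" for z v :: "complex^'b"
    using sums_unique[OF eq[of "cinner z v"]] that by (simp add: K_eq open_ball_def norm_cinner_less)
  ultimately show ?thesis using psd_cong[of open_ball] by (metis (mono_tags, lifting))
qed

text \<open>As kernels, <z,w>^n <w,v>^n \<le> |w|^(2n) <z,v>^n by Cauchy-Schwarz, and <z,v>^n K
  \<le> M K by \<open>psd_shift\<close>. The factor |w|^n will beat the growth of the constants M in
  n.\<close>

lemma mult_bound_cinner_power:
  fixes w :: "complex^'d"
  assumes w: "norm w < 1" and M: "1 \<le> M" "\<And>m. a m \<le> M * a (m + n)"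
  shows "mult_bound (\<lambda>z. cinner z w ^ n) (M * norm w ^ n)"
proof (rule mult_boundI_psd)
  define q where "q = (norm w ^ n)\<^sup>2"
  have wb: "w \<in> open_ball" using w by (simp add: open_ball_def)
  have p: "psd open_ball (\<lambda>z v :: complex^'d. cinner z v ^ n)"
    using psd_cinner_power_mult[OF psd_one] by simp
  have q: "cinner w w ^ n = of_real q"
    by (simp add: cinner_self q_def power_mult[symmetric] mult.commute)
  have M2: "M \<le> M\<^sup>2" using M(1) by (simp add: power2_eq_square)
  \<comment> \<open>The first two summands bound the squared norm by M |w|^(2n); the third pads M to
    M^2, so that no root appears in the bound.\<close>
  have "psd open_ball (\<lambda>z v :: complex^'d. K z v * (cinner w w ^ n * cinner z v ^ n - cinner z w ^ n * cinner w v ^ n)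
      + (of_real q * ((of_real M - cinner z v ^ n) * K z v) + of_real (q * (M\<^sup>2 - M)) * K z v))"
    using M2 by (intro psd_add psd_scale psd_K_mult psd_kernel_CS[OF p wb] psd_shift M psd_K)
       (auto simp: q_def)
  also have "(\<lambda>z v :: complex^'d. K z v * (cinner w w ^ n * cinner z v ^ n - cinner z w ^ n * cinner w v ^ n)
      + (of_real q * ((of_real M - cinner z v ^ n) * K z v) + of_real (q * (M\<^sup>2 - M)) * K z v))
     = (\<lambda>z v. (of_real ((M * norm w ^ n)\<^sup>2) - cinner z w ^ n * cnj (cinner v w ^ n)) * K z v)"
    by (intro ext) (simp add: q cinner_commute[of w, symmetric] q_def algebra_simps power_mult_distrib)
  finally show "psd open_ball (\<lambda>z v. (of_real ((M * norm w ^ n)\<^sup>2) - cinner z w ^ n * cnj (cinner v w ^ n)) * K z v)" .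
  show "0 \<le> M * norm w ^ n" using M by simp
  show "cmod (cinner z w ^ n) \<le> M * norm w ^ n" if "norm z \<le> 1" for z
  proof -
    have "cmod (cinner z w) \<le> norm w"
      using norm_cinner_le[of z w] mult_right_mono[OF that norm_ge_zero[of w]] by simp
    then have "cmod (cinner z w ^ n) \<le> norm w ^ n" by (simp add: norm_power power_mono)
    also have "\<dots> \<le> M * norm w ^ n" using M(1) by (simp add: mult_le_cancel_right1)
    finally show ?thesis .
  qed
qed

section \<open>Limits of polynomials in multiplier norm\<close>

text \<open>As \<open>mult_bound\<close> also controls values on the closed ball, these limits are
  uniform up to the sphere. A Henkin identity known for polynomials can therefore be carried over to
  them on both of its sides.\<close>

definition lim_poly :: "(complex^'d \<Rightarrow> complex) \<Rightarrow> bool" where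
  "lim_poly \<phi> \<longleftrightarrow> (\<exists>C. mult_bound \<phi> C) \<and> (\<forall>e>0. \<exists>p. cpoly p \<and> mult_bound (\<lambda>z. \<phi> z - p z) e)"

lemma mult_bound_cpoly: "cpoly p \<Longrightarrow> \<exists>C. mult_bound p C"
proof (induction rule: cpoly.induct)
  case (cpoly_const c) then show ?case using mult_bound_const by blast
next
  case (cpoly_coord i)
  obtain M where M: "1 \<le> M" "\<And>m n. a m \<le> M * 2 ^ n * a (m + n)"
    using a_growth[of 2] by auto
  \<comment> \<open>Half a unit vector, since \<open>mult_bound_cinner_power\<close> asks for a
    point of the open ball; the factor 2 below compensates.\<close>
  have "(norm (axis i (1/2) :: complex^'a))\<^sup>2 = Re (cinner (axis i (1/2) :: complex^'a) (axis i (1/2)))"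
    by (simp add: cinner_self)
  also have "\<dots> = 1 / 4"
    by (simp add: cinner_def axis_def if_distrib sum.delta cong: if_cong)
  also have "\<dots> < 1\<^sup>2" by simp
  finally have lt: "norm (axis i (1/2) :: complex^'a) < 1" by (rule power2_less_imp_less) simp
  have "mult_bound (\<lambda>z :: complex^'a. cinner z (axis i (1/2)) ^ 1) (M * 2 ^ 1 * norm (axis i (1/2) :: complex^'a) ^ 1)"
  proof (rule mult_bound_cinner_power[OF lt])
    show "1 \<le> M * 2 ^ 1" using M(1) by simp
  qed (rule M(2))
  from mult_bound_scale[OF this, of 2] have "\<exists>C. mult_bound (\<lambda>z :: complex^'a. 2 * cinner z (axis i (1/2)) ^ 1) C" by blast
  moreover have "(\<lambda>z :: complex^'a. 2 * cinner z (axis i (1/2)) ^ 1) = (\<lambda>z. z $ i)"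
    by (auto simp: cinner_def axis_def if_distrib sum.delta cong: if_cong)
  ultimately show ?case by simp
next
  case (cpoly_add p q) then show ?case using mult_bound_add by blast
next
  case (cpoly_mult p q) then show ?case using mult_bound_mult by blast
qed

lemma lim_poly_cpoly: "cpoly p \<Longrightarrow> lim_poly p"
proof -
  assume p: "cpoly p"
  have "mult_bound (\<lambda>z. p z - p z) e" if "0 < e" for e
    using mult_bound_mono[OF mult_bound_const[of 0], of e] that by simp
  then show ?thesis unfolding lim_poly_def using p mult_bound_cpoly[OF p] by blast
qed

lemma lim_poly_limit:
  assumes "mult_bound \<phi> C" "\<And>e. 0 < e \<Longrightarrow> \<exists>\<psi>. lim_poly \<psi> \<and> mult_bound (\<lambda>z. \<phi> z - \<psi> z) e"
  shows "lim_poly \<phi>"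
  unfolding lim_poly_def
proof (intro conjI allI impI)
  show "\<exists>C. mult_bound \<phi> C" using assms(1) by blast
  fix e :: real assume e: "0 < e"
  obtain \<psi> where \<psi>: "lim_poly \<psi>" "mult_bound (\<lambda>z. \<phi> z - \<psi> z) (e/2)" using assms(2)[of "e/2"] e by auto
  obtain p where p: "cpoly p" "mult_bound (\<lambda>z. \<psi> z - p z) (e/2)" using \<psi>(1) e unfolding lim_poly_def by (metis half_gt_zero)
  show "\<exists>p. cpoly p \<and> mult_bound (\<lambda>z. \<phi> z - p z) e"
    using p(1) mult_bound_add[OF \<psi>(2) p(2)] by (intro exI[of _ p]) simp
qed

lemma lim_poly_add:
  assumes "lim_poly \<phi>" "lim_poly \<psi>" shows "lim_poly (\<lambda>z. \<phi> z + \<psi> z)"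
  unfolding lim_poly_def
proof (intro conjI allI impI)
  show "\<exists>C. mult_bound (\<lambda>z. \<phi> z + \<psi> z) C" using assms mult_bound_add unfolding lim_poly_def by blast
  fix e :: real assume "0 < e"
  then obtain p q where p: "cpoly p" "mult_bound (\<lambda>z. \<phi> z - p z) (e/2)" and q: "cpoly q" "mult_bound (\<lambda>z. \<psi> z - q z) (e/2)"
    using assms unfolding lim_poly_def by (metis half_gt_zero)
  show "\<exists>p. cpoly p \<and> mult_bound (\<lambda>z. \<phi> z + \<psi> z - p z) e"
    using cpoly_add[OF p(1) q(1)] mult_bound_add[OF p(2) q(2)]
    by (intro exI[of _ "\<lambda>z. p z + q z"]) (simp add: algebra_simps)
qed

lemma lim_poly_mult:
  assumes "lim_poly \<phi>" "lim_poly \<psi>" shows "lim_poly (\<lambda>z. \<phi> z * \<psi> z)"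
proof -
  obtain C D where C: "mult_bound \<phi> C" and D: "mult_bound \<psi> D" using assms unfolding lim_poly_def by blast
  have C0: "0 \<le> C" "0 \<le> D" using mult_boundD(1)[OF C] mult_boundD(1)[OF D] .
  show ?thesis
  proof (rule lim_poly_limit[OF mult_bound_mult[OF C D]])
    fix e :: real assume e: "0 < e"
    obtain p where p: "cpoly p" "mult_bound (\<lambda>z. \<phi> z - p z) (e / 2 / (D + 1))"
      using assms(1) e C0 unfolding lim_poly_def
      by (metis add_nonneg_pos divide_pos_pos half_gt_zero zero_less_one)
    obtain P where P: "mult_bound p P" using mult_bound_cpoly[OF p(1)] by blast
    have P0: "0 \<le> P" by (rule mult_boundD(1)[OF P])
    \<comment> \<open>The tolerance involves a multiplier bound of \<open>p\<close>, so
      \<open>q\<close> is chosen after \<open>p\<close>.\<close>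
    obtain q where q: "cpoly q" "mult_bound (\<lambda>z. \<psi> z - q z) (e / 2 / (P + 1))"
      using assms(2) e P0 unfolding lim_poly_def
      by (metis add_nonneg_pos divide_pos_pos half_gt_zero zero_less_one)
    have "mult_bound (\<lambda>z. (\<phi> z - p z) * \<psi> z + p z * (\<psi> z - q z)) (e / 2 / (D + 1) * D + P * (e / 2 / (P + 1)))"
      by (intro mult_bound_add mult_bound_mult p q P D)
    moreover have "e / 2 / (D + 1) * D + P * (e / 2 / (P + 1)) \<le> e / 2 + e / 2"
      using e C0 P0 by (intro add_mono) (auto simp: divide_simps mult_left_mono)
    ultimately have "mult_bound (\<lambda>z. (\<phi> z - p z) * \<psi> z + p z * (\<psi> z - q z)) e"
      using mult_bound_mono by fastforce
    then show "\<exists>f. lim_poly f \<and> mult_bound (\<lambda>z. \<phi> z * \<psi> z - f z) e"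
      using lim_poly_cpoly[OF cpoly_mult[OF p(1) q(1)]]
      by (intro exI[of _ "\<lambda>z. p z * q z"]) (simp add: algebra_simps)
  qed
qed

lemma lim_poly_sum: "(\<And>i. i \<in> I \<Longrightarrow> lim_poly (\<phi> i)) \<Longrightarrow> lim_poly (\<lambda>z. \<Sum>i\<in>I. \<phi> i z)"
  by (induction I rule: infinite_finite_induct) (auto intro: lim_poly_add lim_poly_cpoly cpoly_const)

lemma lim_poly_power: "lim_poly \<phi> \<Longrightarrow> lim_poly (\<lambda>z. \<phi> z ^ n)"
  by (induction n) (auto intro: lim_poly_mult lim_poly_cpoly cpoly_const)

lemma lim_poly_suminf:
  assumes "\<And>n. lim_poly (\<phi> n)" and m: "\<And>n. mult_bound (\<phi> n) (C n)" and C: "summable C"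
  shows "lim_poly (\<lambda>z. \<Sum>n. \<phi> n z)"
proof (rule lim_poly_limit[OF mult_bound_suminf[OF m C]])
  fix e :: real assume "0 < e"
  then obtain N where N: "\<bar>\<Sum>i. C (i + N)\<bar> < e"
    using suminf_exist_split[OF _ C, of e] by auto
  show "\<exists>\<psi>. lim_poly \<psi> \<and> mult_bound (\<lambda>z. (\<Sum>n. \<phi> n z) - \<psi> z) e"
    by (intro exI[of _ "\<lambda>z. \<Sum>n<N. \<phi> n z"] conjI lim_poly_sum assms(1) mult_bound_mono[OF mult_bound_suminf_tail[OF m C]])
       (use N in auto)
qed

text \<open>The n-th term of the kernel series has multiplier norm at most M a_n (r |w|)^n for any r
  > 1. With r |w| < 1 these bounds are summable.\<close>

lemma lim_poly_K: assumes w: "norm w < 1" shows "lim_poly (\<lambda>z. K z w)"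
proof -
  obtain r where r: "1 < r" "norm w * r < 1"
  proof (cases "norm w = 0")
    case True then show ?thesis by (intro that[of 2]) auto
  next
    case False
    then have "1 < 1 / norm w" using w by (simp add: less_divide_eq)
    then obtain r where "1 < r" "r < 1 / norm w" using dense by blast
    then show ?thesis using False by (intro that[of r]) (auto simp: field_simps)
  qed
  obtain M where M: "1 \<le> M" "\<And>m n. a m \<le> M * r ^ n * a (m + n)" using a_growth[OF r(1)] by blast
  show ?thesis unfolding UI_kernel_def
  proof (rule lim_poly_suminf)
    show "lim_poly (\<lambda>z. complex_of_real (a n) * cinner z w ^ n)" for n
      by (intro lim_poly_cpoly cpoly_mult cpoly_const cpoly_power cpoly_cinner)
    show "mult_bound (\<lambda>z. complex_of_real (a n) * cinner z w ^ n) (M * (a n * (norm w * r) ^ n))" for n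
    proof -
      have "1 * 1 \<le> M * r ^ n" using M(1) r(1) by (intro mult_mono one_le_power) auto
      then have "mult_bound (\<lambda>z. cinner z w ^ n) (M * r ^ n * norm w ^ n)"
        using M(2) by (intro mult_bound_cinner_power[OF w]) auto
      from mult_bound_scale[OF this, of "of_real (a n)"] show ?thesis
        using a_pos[of n] by (simp add: power_mult_distrib mult_ac abs_of_pos)
    qed
    show "summable (\<lambda>n. M * (a n * (norm w * r) ^ n))"
      using r by (intro summable_mult a_summable_real) auto
  qed
qed

lemma lim_poly_kernel_comb: "S \<subseteq> open_ball \<Longrightarrow> lim_poly (kernel_comb S c)"
  unfolding kernel_comb_def
  by (intro lim_poly_sum lim_poly_mult lim_poly_K lim_poly_cpoly cpoly_const) (auto simp: open_ball_def)

text \<open>A bounded accretive multiplier is inverted by a Neumann series in \<open>1 - F / N\<close>, \<open>N\<close> large.\<close>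
lemma lim_poly_inverse:
  assumes F: "lim_poly F" and d: "0 < d" and re: "\<And>z. norm z \<le> 1 \<Longrightarrow> d \<le> Re (F z)"
    and psd: "psd open_ball (\<lambda>z v. (F z + cnj (F v) - of_real (2 * d)) * K z v)"
  shows "lim_poly (\<lambda>z. 1 / F z)"
proof -
  obtain L where L: "mult_bound F L" using F unfolding lim_poly_def by blast
  have L0: "0 \<le> L" by (rule mult_boundD(1)[OF L])
  \<comment> \<open>N \<ge> L^2 / d brings the contraction constant down to q^2 \<le> 1 - d / N < 1;
    N \<ge> 2 d keeps the radicand of q nonnegative.\<close>
  define N where "N = max (2 * d) (L\<^sup>2 / d)"
  have "L\<^sup>2 / d \<le> N" by (simp add: N_def)
  then have "L\<^sup>2 \<le> d * N" using d by (simp add: pos_divide_le_eq mult.commute)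
  then have N: "0 < N" "2 * d \<le> N" "L\<^sup>2 \<le> d * N"
    using d by (auto simp: N_def less_max_iff_disj)
  define q where "q = sqrt (1 - 2 * d / N + L\<^sup>2 / N\<^sup>2)"
  have q2: "q\<^sup>2 = 1 - 2 * d / N + L\<^sup>2 / N\<^sup>2" "0 \<le> q"
  proof -
    have "2 * d / N \<le> 1" using N by simp
    then show "q\<^sup>2 = 1 - 2 * d / N + L\<^sup>2 / N\<^sup>2" "0 \<le> q"
      unfolding q_def by (auto intro!: real_sqrt_pow2 add_nonneg_nonneg)
  qed
  have "L\<^sup>2 / N\<^sup>2 \<le> d * N / N\<^sup>2" using N by (intro divide_right_mono) auto
  then have "q\<^sup>2 \<le> 1 - d / N" using N unfolding q2 by (simp add: power2_eq_square)
  also have "\<dots> < 1" using d N by simp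
  finally have q1: "q < 1" using power2_less_imp_less[of q 1] by simp
  define G where "G z = 1 + of_real (- (1 / N)) * F z" for z
  have G: "mult_bound G q"
  proof (rule mult_boundI[OF q2(2)])
    fix z :: "complex^'a" assume z: "norm z \<le> 1"
    have "(cmod (G z))\<^sup>2 = 1 - 2 * Re (F z) / N + (cmod (F z))\<^sup>2 / N\<^sup>2"
    proof -
      have "(cmod (1 + of_real (- u) * f))\<^sup>2 = 1 - 2 * u * Re f + u\<^sup>2 * (cmod f)\<^sup>2" for u f
        by (simp add: cmod_power2) (simp add: power2_eq_square algebra_simps)
      from this[of "1 / N" "F z"] show ?thesis by (simp add: G_def power_divide)
    qed
    also have "\<dots> \<le> q\<^sup>2"
      unfolding q2 using re[OF z] mult_boundD(2)[OF L z] N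
      by (intro add_mono diff_left_mono divide_right_mono power_mono) auto
    finally show "cmod (G z) \<le> q" using q2(2) by (rule power2_le_imp_le)
  next
    fix S c assume S: "finite (S :: (complex^'a) set)" "S \<subseteq> open_ball"
    define e where "e x = cnj (F x) * c x" for x
    have "bform S (\<lambda>z v. (F z + cnj (F v) - of_real (2 * d)) * K z v) c c
        = bform S K e c + bform S K c e - of_real (2 * d) * bform S K c c"
      by (simp add: bform_def e_def algebra_simps sum.distrib sum_subtractf sum_distrib_left)
    then have acc: "d * En S c \<le> Re (bform S K c e)"
      using psd_Re[OF psd S, of c] by (simp add: En_def bform_K_swap[OF S(2), of e c])
    have "sqrt (En S e) \<le> L * sqrt (En S c)" unfolding e_def by (rule mult_boundD(3)[OF L S])
    then have "(sqrt (En S e))\<^sup>2 \<le> (L * sqrt (En S c))\<^sup>2" using En_nonneg[OF S] by (intro power_mono) auto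
    then have Le: "En S e \<le> L\<^sup>2 * En S c" using En_nonneg[OF S] by (simp add: power_mult_distrib)
    have "(\<lambda>x. cnj (G x) * c x) = (\<lambda>x. c x + of_real (- (1 / N)) * e x)"
      by (simp add: G_def e_def algebra_simps)
    then have "En S (\<lambda>x. cnj (G x) * c x) = En S c + 2 * Re (of_real (- (1/N)) * bform S K c e) + (1 / N)\<^sup>2 * En S e"
      unfolding En_add[OF S(2)] En_scale bform_scale_right
      by (simp only: En_add[OF S(2)] En_scale bform_scale_right norm_of_real power2_abs power2_minus)
    also have "\<dots> = En S c - 2 * Re (bform S K c e) / N + En S e / N\<^sup>2"
      by (simp add: power_divide)
    also have "\<dots> \<le> En S c - 2 * (d * En S c) / N + L\<^sup>2 * En S c / N\<^sup>2"
      using acc Le N by (intro add_mono diff_left_mono divide_right_mono) auto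
    also have "\<dots> = q\<^sup>2 * En S c" unfolding q2 by (simp add: algebra_simps)
    finally have "sqrt (En S (\<lambda>x. cnj (G x) * c x)) \<le> sqrt (q\<^sup>2 * En S c)" by simp
    then show "sqrt (En S (\<lambda>x. cnj (G x) * c x)) \<le> q * sqrt (En S c)"
      using q2(2) by (simp add: real_sqrt_mult)
  qed
  have "lim_poly (\<lambda>z. \<Sum>n. G z ^ n)"
  proof (rule lim_poly_suminf)
    show "lim_poly (\<lambda>z. G z ^ n)" for n
      unfolding G_def by (intro lim_poly_power lim_poly_add lim_poly_mult F lim_poly_cpoly cpoly_const)
    show "mult_bound (\<lambda>z. G z ^ n) (q ^ n)" for n by (rule mult_bound_power[OF G])
    show "summable (\<lambda>n. q ^ n)" using q1 q2(2) by simp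
  qed
  then have l: "lim_poly (\<lambda>z. of_real (1 / N) * (\<Sum>n. G z ^ n))"
    by (rule lim_poly_mult[OF lim_poly_cpoly[OF cpoly_const]])
  have eq: "of_real (1 / N) * (\<Sum>n. G z ^ n) = 1 / F z" if "norm z \<le> 1" for z
  proof -
    have "cmod (G z) < 1" using mult_boundD(2)[OF G that] q1 by simp
    then show ?thesis using suminf_geometric[of "G z"] N by (simp add: G_def)
  qed
  \<comment> \<open>The Neumann series is known to equal 1 / F only on the closed ball, and
    \<open>mult_bound\<close> depends only on the values there.\<close>
  have cong: "mult_bound \<phi> C \<longleftrightarrow> mult_bound \<psi> C" if "\<And>z. norm z \<le> 1 \<Longrightarrow> \<phi> z = \<psi> z" for \<phi> \<psi> :: "complex^'a \<Rightarrow> complex" and C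
  proof -
    have "En S (\<lambda>x. cnj (\<phi> x) * c x) = En S (\<lambda>x. cnj (\<psi> x) * c x)" if S: "S \<subseteq> open_ball" for S c
    proof -
      have "\<phi> x = \<psi> x" if "x \<in> S" for x
        using that S \<open>\<And>z. norm z \<le> 1 \<Longrightarrow> \<phi> z = \<psi> z\<close>[of x] by (auto simp: open_ball_def)
      then show ?thesis by (simp add: En_def bform_def)
    qed
    then show ?thesis unfolding mult_bound_def using that by (auto simp: simp del: real_sqrt_le_iff)
  qed
  have "mult_bound (\<lambda>z. of_real (1 / N) * (\<Sum>n. G z ^ n) - p z) C \<longleftrightarrow> mult_bound (\<lambda>z. 1 / F z - p z) C" for p C
    by (rule cong) (simp only: eq)
  moreover have "mult_bound (\<lambda>z. of_real (1 / N) * (\<Sum>n. G z ^ n)) C \<longleftrightarrow> mult_bound (\<lambda>z. 1 / F z) C" for C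
    by (rule cong) (simp only: eq)
  ultimately show ?thesis using l unfolding lim_poly_def by blast
qed

end

section \<open>Potentials and capacity\<close>

definition weight :: "'x set \<Rightarrow> 'x set \<Rightarrow> ('x \<Rightarrow> real) \<Rightarrow> bool" where
  "weight E S c \<longleftrightarrow> finite S \<and> S \<subseteq> E \<and> (\<forall>x\<in>S. 0 \<le> c x) \<and> sum c S = 1"

context pick_space begin

definition potential :: "(complex^'d) set \<Rightarrow> (complex^'d \<Rightarrow> real) \<Rightarrow> real \<Rightarrow> complex^'d \<Rightarrow> complex" where
  "potential S c t z = (\<Sum>x\<in>S. of_real (c x) * K z (t *\<^sub>R x))"

text \<open>Dilating one variable only leaves the points on the sphere. The squared norm of a
  potential with poles t x dilates both and is the energy at t t, see
  \<open>En_dilation\<close>.\<close>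

definition energy :: "(complex^'d) set \<Rightarrow> (complex^'d \<Rightarrow> real) \<Rightarrow> real \<Rightarrow> real" where
  "energy S c t = Re (bform S (\<lambda>x y. K x (t *\<^sub>R y)) (\<lambda>x. of_real (c x)) (\<lambda>x. of_real (c x)))"

text \<open>Energies increase with \<open>t\<close> by \<open>energy_mono\<close>, so one
  \<open>t\<close> for each \<open>M\<close> means that the infimum over all weights tends to
  infinity as \<open>t\<close> tends to 1. The negation yields one bound that is beaten at every
  \<open>t\<close>, by weights depending on \<open>t\<close>.\<close>

definition capacity_zero :: "(complex^'d) set \<Rightarrow> bool" where
  "capacity_zero E \<longleftrightarrow> (\<forall>M. \<exists>t. 0 < t \<and> t < 1 \<and> (\<forall>S c. weight E S c \<longrightarrow> M \<le> energy S c t))"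

lemma energy_potential: "energy S c t = (\<Sum>x\<in>S. c x * Re (potential S c t x))"
  by (simp add: energy_def bform_def potential_def sum_distrib_left mult.assoc)

lemma norm_scaleR_less_1: "norm x = 1 \<Longrightarrow> 0 \<le> t \<Longrightarrow> t < 1 \<Longrightarrow> norm (t *\<^sub>R x) < 1"
  by simp

lemma potential_kernel_comb:
  assumes "0 < t"
  shows "potential S c t = kernel_comb ((*\<^sub>R) t ` S) (\<lambda>y. of_real (c (y /\<^sub>R t)))"
  unfolding potential_def kernel_comb_def using assms
  by (subst sum.reindex) (auto simp: inj_on_def)

text \<open>The difference has the coefficients a_n (t'^n - t^n) \<ge> 0. Taking t = 0, where the
  kernel is 1, it also gives positivity of each dilated kernel on the sphere.\<close>

lemma psd_K_dilation_diff:
  assumes t: "0 \<le> t" "t \<le> t'" "t' < 1"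
  shows "psd unit_sphere (\<lambda>x y. K x (t' *\<^sub>R y) - K x (t *\<^sub>R y))"
proof -
  have nc: "cmod (of_real s * cinner x y) < 1" if "norm x = 1" "norm y = 1" "0 \<le> s" "s < 1" for s and x y :: "complex^'d"
    using norm_cinner_less(1)[of x "s *\<^sub>R y"] that by (simp add: cinner_scaleR_right)
  have s: "(\<lambda>n. complex_of_real (a n * r ^ n) * cinner x y ^ n) sums K x (r *\<^sub>R y)"
    if "norm x = 1" "norm y = 1" "0 \<le> r" "r < 1" for r and x y :: "complex^'d"
    using summable_sums[OF summable_norm_cancel[OF a_summable[OF nc[OF that]]]]
    by (simp add: K_eq A_def cinner_scaleR_right power_mult_distrib mult.assoc)
  have eq: "(\<lambda>n. complex_of_real (a n * (t' ^ n - t ^ n)) * cinner x y ^ n) sums (K x (t' *\<^sub>R y) - K x (t *\<^sub>R y))"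
    if "norm x = 1" "norm y = 1" for x y :: "complex^'d"
    using sums_diff[OF s[OF that, of t'] s[OF that, of t]] t by (simp add: algebra_simps)
  have "psd unit_sphere (\<lambda>x y :: complex^'d. (\<Sum>n. complex_of_real (a n * (t' ^ n - t ^ n)) * cinner x y ^ n) * 1)"
  proof (rule psd_powser_mult[OF psd_one])
    show "0 \<le> a n * (t' ^ n - t ^ n)" for n
      using t by (intro mult_nonneg_nonneg less_imp_le[OF a_pos]) (simp add: power_mono)
    show "summable (\<lambda>n. complex_of_real (a n * (t' ^ n - t ^ n)) * cinner x y ^ n)"
      if "x \<in> unit_sphere" "y \<in> unit_sphere" for x y :: "complex^'d"
      by (rule sums_summable[OF eq]) (use that in \<open>auto simp: unit_sphere_def\<close>)
  qed
  moreover have "(\<Sum>n. complex_of_real (a n * (t' ^ n - t ^ n)) * cinner x y ^ n) * 1 = K x (t' *\<^sub>R y) - K x (t *\<^sub>R y)"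
    if "x \<in> unit_sphere" "y \<in> unit_sphere" for x y :: "complex^'d"
    using sums_unique[OF eq[of x y]] that by (simp add: unit_sphere_def)
  ultimately show ?thesis using psd_cong[of unit_sphere] by (metis (mono_tags, lifting))
qed

lemma K_zero_right: "K x 0 = 1"
  using powser_zero[of "\<lambda>n. complex_of_real (a n)"] by (simp add: K_eq A_def cinner_def)

lemma psd_K_dilation:
  assumes "0 \<le> t" "t < 1" shows "psd unit_sphere (\<lambda>x y. K x (t *\<^sub>R y))"
  using psd_add[OF psd_K_dilation_diff[OF order.refl assms] psd_one]
  by (simp add: K_zero_right)

lemma energy_mono:
  assumes "finite S" "S \<subseteq> unit_sphere" "0 \<le> t" "t \<le> t'" "t' < 1"
  shows "energy S c t \<le> energy S c t'"
proof -
  define d where "d = (\<lambda>x. complex_of_real (c x))"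
  have "bform S (\<lambda>x y. K x (t' *\<^sub>R y) - K x (t *\<^sub>R y)) d d
    = bform S (\<lambda>x y. K x (t' *\<^sub>R y)) d d - bform S (\<lambda>x y. K x (t *\<^sub>R y)) d d"
    by (simp add: bform_def right_diff_distrib sum_subtractf)
  then show ?thesis
    using psd_Re[OF psd_K_dilation_diff[OF assms(3-5)] assms(1,2), of d]
    by (simp add: energy_def d_def)
qed

lemma En_dilation:
  assumes t: "0 < t"
  shows "En ((*\<^sub>R) t ` S) (\<lambda>y. of_real (c (y /\<^sub>R t))) = energy S c (t * t)"
proof -
  have "inj_on ((*\<^sub>R) t) S" using t by (auto simp: inj_on_def)
  then show ?thesis using t
    by (simp add: En_def energy_def bform_def sum.reindex K_eq cinner_scaleR_left cinner_scaleR_right mult.assoc)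
qed

lemma dilation_ball: "S \<subseteq> unit_sphere \<Longrightarrow> 0 \<le> t \<Longrightarrow> t < 1 \<Longrightarrow> (*\<^sub>R) t ` S \<subseteq> open_ball"
  by (auto simp: open_ball_def unit_sphere_def)

lemma H_bound_potential:
  assumes "finite S" "S \<subseteq> unit_sphere" "0 < t" "t < 1"
  shows "H_bound a (potential S c t) (sqrt (energy S c (t * t)))"
  unfolding potential_kernel_comb[OF assms(3)] En_dilation[OF assms(3), symmetric]
  by (intro H_bound_kernel_comb finite_imageI dilation_ball) (use assms in auto)

lemma lim_poly_potential:
  assumes "S \<subseteq> unit_sphere" "0 < t" "t < 1" shows "lim_poly (potential S c t)"
  unfolding potential_kernel_comb[OF assms(2)] by (intro lim_poly_kernel_comb dilation_ball) (use assms in auto)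

lemma Re_potential_nonneg:
  assumes "weight unit_sphere S c" "0 \<le> t" "t < 1" "norm z \<le> 1"
  shows "0 \<le> Re (potential S c t z)"
  unfolding potential_def Re_sum using assms
  by (intro sum_nonneg) (auto intro!: mult_nonneg_nonneg Re_K_nonneg simp: weight_def unit_sphere_def subset_iff)

lemma continuous_on_K: "norm w < 1 \<Longrightarrow> continuous_on (cball 0 1) (\<lambda>z. K z w)"
  unfolding K_eq by (intro continuous_intros) (auto intro: norm_cinner_less)

lemma continuous_on_potential:
  assumes "S \<subseteq> unit_sphere" "0 \<le> t" "t < 1" shows "continuous_on (cball 0 1) (potential S c t)"
  unfolding potential_def using assms
  by (intro continuous_intros continuous_on_K) (auto simp: unit_sphere_def)

text \<open>Re <z,x> = (|z|^2 + 1 - |z - x|^2) / 2 \<le> 1 - d, and \<open>d \<le> 1\<close>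
  preserves this under the dilation, so the bound is uniform in \<open>t\<close>.\<close>

lemma norm_K_dilation_le:
  assumes z: "norm z \<le> 1" and x: "norm x = 1" and t: "0 \<le> t" "t < 1"
    and d: "0 < d" "d \<le> 1" "d \<le> (norm (z - x))\<^sup>2 / 2"
  shows "cmod (K z (t *\<^sub>R x)) \<le> 1 / (b 1 * d)"
  unfolding K_eq
proof (rule norm_A_le)
  show "cmod (cinner z (t *\<^sub>R x)) < 1" by (rule norm_cinner_less(1)[OF z norm_scaleR_less_1[OF x t]])
  have "(norm z)\<^sup>2 \<le> 1" using z by (simp add: power_le_one)
  then have "Re (cinner z x) \<le> 1 - d"
    using d(3) norm_diff_sq_cinner[of z x] x by simp
  then have "t * Re (cinner z x) \<le> t * (1 - d)" by (intro mult_left_mono t)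
  also have "\<dots> \<le> 1 - d" using t d by (simp add: mult_left_le_one_le)
  finally show "d \<le> 1 - Re (cinner z (t *\<^sub>R x))" by (simp add: cinner_scaleR_right)
qed (rule d(1))

lemma norm_potential_le:
  assumes w: "weight E S c" and E: "E \<subseteq> unit_sphere" and z: "norm z \<le> 1" and t: "0 \<le> t" "t < 1"
    and C: "\<And>x. x \<in> E \<Longrightarrow> cmod (K z (t *\<^sub>R x)) \<le> C"
  shows "cmod (potential S c t z) \<le> C"
proof -
  have "cmod (potential S c t z) \<le> (\<Sum>x\<in>S. c x * C)"
    unfolding potential_def
    by (rule sum_norm_le) (use w C in \<open>auto simp: norm_mult weight_def intro!: mult_mono\<close>)
  also have "\<dots> = C" using w by (simp add: sum_distrib_right[symmetric] weight_def)
  finally show ?thesis .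
qed

lemma norm_K_sphere_le:
  assumes "norm x = 1" "norm y = 1" "0 \<le> t" "t < 1"
  shows "cmod (K x (t *\<^sub>R y)) \<le> 1 / (b 1 * (1 - t))"
  unfolding K_eq
proof (rule norm_A_le)
  show "cmod (cinner x (t *\<^sub>R y)) < 1" using assms by (intro norm_cinner_less(1)) auto
  have "cmod (cinner x (t *\<^sub>R y)) \<le> t"
    using norm_cinner_le[of x "t *\<^sub>R y"] assms by simp
  then show "1 - t \<le> 1 - Re (cinner x (t *\<^sub>R y))"
    using complex_Re_le_cmod[of "cinner x (t *\<^sub>R y)"] by simp
qed (use assms in simp)

text \<open>First variation of the energy at an almost minimal weight.\<close>
lemma almost_equilibrium:
  fixes E :: "(complex^'d) set"
  assumes E: "E \<subseteq> unit_sphere" "E \<noteq> {}" and t: "0 < t" "t < 1"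
  shows "\<exists>S c. weight E S c \<and> (\<forall>x\<in>E. energy S c t - 1 \<le> Re (potential S c t x))"
proof -
  define D where "D = 1 / (b 1 * (1 - t))"
  have D: "0 < D" using b1_pos t by (simp add: D_def)
  define X where "X = {energy S c t |S c. weight E S c}"
  obtain x0 where x0: "x0 \<in> E" using E by auto
  have "weight E {x0} (\<lambda>_. 1)" using x0 by (auto simp: weight_def)
  then have Xne: "X \<noteq> {}" unfolding X_def by blast
  have Xbd: "bdd_below X"
  proof (rule bdd_belowI[of _ 0])
    fix m assume "m \<in> X"
    then obtain S c where m: "m = energy S c t" and "weight E S c" unfolding X_def by blast
    then have S: "finite S" "S \<subseteq> unit_sphere" using E by (auto simp: weight_def)
    show "0 \<le> m" unfolding m energy_def by (rule psd_Re[OF psd_K_dilation S]) (use t in auto)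
  qed
  \<comment> \<open>Mass \<tau> is moved to the point x from a weight within \<tau> of the minimum.
    After division by \<tau> the second-order term is at most 2 \<tau> D \<le> 1/2, and the real
    part of the potential at x exceeds the energy minus 3/4.\<close>
  define \<tau> where "\<tau> = 1 / (4 * D + 4)"
  have \<tau>: "0 < \<tau>" "\<tau> < 1" "2 * \<tau> * D \<le> 1 / 2" using D by (auto simp: \<tau>_def field_simps)
  have "Inf X < Inf X + \<tau>" using \<tau> by simp
  then obtain S c where w: "weight E S c" and near: "energy S c t < Inf X + \<tau>"
    using cInf_lessD[OF Xne] unfolding X_def by blast
  have S: "finite S" "S \<subseteq> unit_sphere" using w E by (auto simp: weight_def)
  have pb: "cmod (potential S c t x) \<le> D" if "x \<in> E" for x
  proof (rule norm_potential_le[OF w E(1)])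
    have nE: "norm y = 1" if "y \<in> E" for y using that E by (auto simp: unit_sphere_def)
    show "norm x \<le> 1" using nE[OF that] by simp
    show "cmod (K x (t *\<^sub>R y)) \<le> D" if "y \<in> E" for y
      unfolding D_def using t by (intro norm_K_sphere_le nE \<open>x \<in> E\<close> that) auto
  qed (use t in auto)
  have "energy S c t \<le> (\<Sum>x\<in>S. c x * D)"
    unfolding energy_potential
    using w pb by (intro sum_mono mult_left_mono) (auto simp: weight_def intro: order_trans[OF complex_Re_le_cmod])
  also have "\<dots> = D" using w by (simp add: sum_distrib_right[symmetric] weight_def)
  finally have eD: "energy S c t \<le> D" .
  have "energy S c t - 1 \<le> Re (potential S c t x)" if x: "x \<in> E" for x
  proof -
    define T where "T = insert x S"
    have T: "finite T" "T \<subseteq> unit_sphere" "T \<subseteq> E" using S x E w by (auto simp: T_def weight_def)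
    define k where "k = (\<lambda>x y :: complex^'d. K x (t *\<^sub>R y))"
    have ps: "psd unit_sphere k" unfolding k_def using t by (intro psd_K_dilation) auto
    define c' where "c' y = (if y \<in> S then c y else 0)" for y
    define d where "d y = (1 - \<tau>) * c' y + \<tau> * (if y = x then 1 else 0)" for y
    define e where "e y = (if y = x then 1 else 0 :: complex)" for y
    have sc': "sum c' T = 1"
    proof -
      have "sum c' T = sum c S" unfolding T_def c'_def using S by (intro sum.mono_neutral_cong_right) auto
      then show ?thesis using w by (simp add: weight_def)
    qed
    have "weight E T d"
      unfolding weight_def
    proof (intro conjI ballI T)
      show "0 \<le> d y" if "y \<in> T" for y using w \<tau> by (auto simp: d_def c'_def weight_def)
      show "sum d T = 1" using sc' T x
        by (simp add: d_def sum.distrib sum_distrib_left[symmetric] T_def)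
    qed
    then have "Inf X \<le> energy T d t" unfolding X_def by (intro cInf_lower Xbd[unfolded X_def]) blast
    also have "energy T d t = (1 - \<tau>)\<^sup>2 * energy S c t + 2 * \<tau> * (1 - \<tau>) * Re (potential S c t x) + \<tau>\<^sup>2 * Re (k x x)"
    proof -
      define u where "u y = complex_of_real (c' y)" for y
      have uu: "bform T k u u = bform S k (\<lambda>y. of_real (c y)) (\<lambda>y. of_real (c y))"
      proof -
        have "bform T k u u = bform S k u u"
          by (rule bform_extend) (use S in \<open>auto simp: T_def u_def c'_def\<close>)
        then show ?thesis by (simp add: bform_def u_def c'_def)
      qed
      have ee: "bform T k e e = k x x"
        by (subst bform_extend[of T "{x}"]) (auto simp: T_def S e_def bform_def)
      have eu: "bform T k e u = potential S c t x"
      proof -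
        have "bform T k e u = (\<Sum>z\<in>T. if z = x then (\<Sum>y\<in>T. u y * k x y) else 0)"
          unfolding bform_def e_def by (intro sum.cong refl) auto
        also have "\<dots> = (\<Sum>y\<in>T. u y * k x y)" using T(1) by (simp add: T_def)
        also have "\<dots> = (\<Sum>y\<in>S. of_real (c y) * k x y)"
          unfolding T_def u_def c'_def using S by (intro sum.mono_neutral_cong_right) auto
        finally show ?thesis by (simp add: potential_def k_def)
      qed
      have ue: "bform T k u e = cnj (bform T k e u)"
        by (rule bform_hermitian, rule psd_hermitian[OF ps]) (use T in auto)
      have "(\<lambda>y. complex_of_real (d y)) = (\<lambda>y. of_real (1 - \<tau>) * u y + of_real \<tau> * e y)"
        by (auto simp: d_def u_def e_def)
      then have "energy T d t = Re (bform T k (\<lambda>y. of_real (1 - \<tau>) * u y + of_real \<tau> * e y)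
          (\<lambda>y. of_real (1 - \<tau>) * u y + of_real \<tau> * e y))"
        by (simp add: energy_def k_def)
      also have "\<dots> = (1 - \<tau>)\<^sup>2 * Re (bform T k u u) + 2 * \<tau> * (1 - \<tau>) * Re (bform T k e u) + \<tau>\<^sup>2 * Re (bform T k e e)"
        unfolding bform_add_left bform_add_right bform_scale_left bform_scale_right ue complex_cnj_complex_of_real
        by (simp add: power2_eq_square algebra_simps del: of_real_diff)
      finally show ?thesis
        unfolding uu ee eu by (simp add: energy_def k_def)
    qed
    finally have "energy S c t - \<tau> < (1 - \<tau>)\<^sup>2 * energy S c t + 2 * \<tau> * (1 - \<tau>) * Re (potential S c t x) + \<tau>\<^sup>2 * Re (k x x)"
      using near by simp
    then have "0 < \<tau> * (1 + 2 * (Re (potential S c t x) - energy S c t) + \<tau> * (energy S c t - 2 * Re (potential S c t x) + Re (k x x)))"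
      by (simp add: power2_eq_square algebra_simps)
    then have "0 < 1 + 2 * (Re (potential S c t x) - energy S c t) + \<tau> * (energy S c t - 2 * Re (potential S c t x) + Re (k x x))"
      using \<tau> by (simp add: zero_less_mult_iff)
    moreover have "energy S c t - 2 * Re (potential S c t x) + Re (k x x) \<le> 2 * D"
    proof -
      have "0 \<le> Re (potential S c t x)"
        using w E t x by (intro Re_potential_nonneg) (auto simp: weight_def unit_sphere_def)
      moreover have "Re (k x x) \<le> D"
        unfolding k_def D_def using x E t
        by (intro order_trans[OF complex_Re_le_cmod norm_K_sphere_le]) (auto simp: unit_sphere_def)
      ultimately show ?thesis using eD by simp
    qed
    then have "\<tau> * (energy S c t - 2 * Re (potential S c t x) + Re (k x x)) \<le> \<tau> * (2 * D)"
      using \<tau> by (intro mult_left_mono) auto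
    ultimately show ?thesis using \<tau>(3) by simp
  qed
  then show ?thesis using w by blast
qed

section \<open>From capacity zero to an unbounded function\<close>

lemma capacity_zero_potential:
  assumes "capacity_zero E" and E: "E \<subseteq> unit_sphere" "E \<noteq> {}"
  obtains t S c where "0 < t" "t < 1" "weight E S c" "M \<le> energy S c t"
    "\<And>x. x \<in> E \<Longrightarrow> energy S c t - 1 \<le> Re (potential S c t x)"
proof -
  obtain t where t: "0 < t" "t < 1" and M: "\<And>S c. weight E S c \<Longrightarrow> M \<le> energy S c t"
    using assms(1) unfolding capacity_zero_def by blast
  obtain S c where "weight E S c" "\<forall>x\<in>E. energy S c t - 1 \<le> Re (potential S c t x)"
    using almost_equilibrium[OF E t] by blast
  then show ?thesis using that t M by blast
qed

lemma capacity_zero_subset: "capacity_zero E \<Longrightarrow> E' \<subseteq> E \<Longrightarrow> capacity_zero E'"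
  unfolding capacity_zero_def weight_def by (meson order_trans)

text \<open>Nonnegative real parts rule out cancellation: on the ball every partial sum bounds |f|
  from below, and N terms contribute at least N/2 in the radial limit because each term is
  continuous up to the sphere.\<close>

lemma capacity_zero_unbounded:
  assumes cz: "capacity_zero E" and E: "E \<subseteq> unit_sphere"
  shows "\<exists>f. in_H a f \<and> (\<forall>\<zeta>\<in>E. filterlim (\<lambda>r::real. cmod (f (r *\<^sub>R \<zeta>))) at_top (at_left 1))"
proof (cases "E = {}")
  case True then show ?thesis using in_H_zero by blast
next
  case False
  have "\<exists>u. H_bound a u ((1/2) ^ k) \<and> (\<forall>z. norm z \<le> 1 \<longrightarrow> 0 \<le> Re (u z)) \<and> (\<forall>x\<in>E. 1 / 2 \<le> Re (u x))
      \<and> continuous_on (cball 0 1) u" for k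
  proof -
    \<comment> \<open>The energy e' \<ge> 4^(k+1) serves twice: 1 / sqrt e' \<le> 2^(-k) makes the
      norms summable, and e' \<ge> 2 gives (e' - 1) / e' \<ge> 1/2 on \<open>E\<close>.\<close>
    obtain t S c where t: "0 < t" "t < 1" and w: "weight E S c" and e: "4 ^ (k + 1) \<le> energy S c t"
      and p: "\<And>x. x \<in> E \<Longrightarrow> energy S c t - 1 \<le> Re (potential S c t x)"
      using capacity_zero_potential[OF cz E False] by blast
    have S: "finite S" "S \<subseteq> unit_sphere" "weight unit_sphere S c" using w E by (auto simp: weight_def)
    define e' where "e' = energy S c t"
    have e'4: "4 * 4 ^ k \<le> e'" using e by (simp add: e'_def)
    moreover have "(1::real) \<le> 4 ^ k" by simp
    ultimately have e2: "2 \<le> e'" "4 ^ k \<le> e'" by linarith+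
    define u where "u z = of_real (1 / e') * potential S c t z" for z
    have tt: "t * t \<le> t" using t by (simp add: mult_left_le)
    have "energy S c (t * t) \<le> e'"
      unfolding e'_def by (rule energy_mono[OF S(1,2)]) (use t tt in auto)
    then have hb: "H_bound a (potential S c t) (sqrt e')"
      by (intro H_bound_mono[OF H_bound_potential[OF S(1,2) t]]) simp
    have "H_bound a u (1 / e' * sqrt e')"
      unfolding u_def using H_bound_scale[OF hb, of "of_real (1 / e')"] e2 by (simp add: norm_divide)
    moreover have "1 / e' * sqrt e' \<le> (1/2) ^ k"
    proof -
      have "1 / e' * sqrt e' = 1 / sqrt e'" using e2 by (simp add: field_simps)
      moreover have "sqrt (4 ^ k) \<le> sqrt e'" using e2 by simp
      then have "2 ^ k \<le> sqrt e'" by (simp add: real_sqrt_power)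
      then have "1 / sqrt e' \<le> 1 / 2 ^ k" by (intro divide_left_mono) (use e2 in auto)
      ultimately show ?thesis by (simp add: power_divide)
    qed
    ultimately have "H_bound a u ((1/2) ^ k)" by (rule H_bound_mono)
    moreover have "0 \<le> Re (u z)" if "norm z \<le> 1" for z
      unfolding u_def using Re_potential_nonneg[OF S(3) _ t(2) that] t e2 by simp
    moreover have "1 / 2 \<le> Re (u x)" if "x \<in> E" for x
    proof -
      have "1 / 2 * e' \<le> Re (potential S c t x)" using p[OF that] e2 by (simp add: e'_def)
      then show ?thesis unfolding u_def using e2 by (simp add: field_simps)
    qed
    moreover have "continuous_on (cball 0 1) u"
      unfolding u_def by (intro continuous_intros continuous_on_potential S) (use t in auto)
    ultimately show ?thesis by blast
  qed
  then obtain u where u: "\<And>k. H_bound a (u k) ((1/2) ^ k)" "\<And>k z. norm z \<le> 1 \<Longrightarrow> 0 \<le> Re (u k z)"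
    "\<And>k x. x \<in> E \<Longrightarrow> 1 / 2 \<le> Re (u k x)" "\<And>k. continuous_on (cball 0 1) (u k)"
    by metis
  have sm: "summable (\<lambda>k. u k z)" if z: "z \<in> open_ball" for z
  proof (rule summable_comparison_test')
    show "summable (\<lambda>k. (1/2) ^ k * sqrt (En {z} (\<lambda>_. 1)))" by (intro summable_mult2) simp
    show "norm (u k z) \<le> (1/2) ^ k * sqrt (En {z} (\<lambda>_. 1))" for k
      using H_boundD(1)[OF u(1), of "{z}" "\<lambda>_. 1" k] z by (simp add: pairing_def)
  qed
  define f where "f z = (\<Sum>k. u k z)" for z
  have "H_bound a f 2"
  proof (rule H_bound_lim)
    show "H_bound a (\<lambda>z. \<Sum>k<N. u k z) 2" for N
    proof (rule H_bound_mono[OF H_bound_sum[OF u(1)]])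
      have "(\<Sum>k<N. (1/2) ^ k) \<le> (\<Sum>k. (1/2::real) ^ k)" by (rule sum_le_suminf) auto
      also have "\<dots> = 2" by (subst suminf_geometric) auto
      finally show "(\<Sum>k<N. (1/2) ^ k) \<le> (2::real)" .
    qed
    show "(\<lambda>N. \<Sum>k<N. u k z) \<longlonglongrightarrow> f z" if "z \<in> open_ball" for z
      unfolding f_def by (rule summable_LIMSEQ[OF sm[OF that]])
  qed
  moreover have "filterlim (\<lambda>r::real. cmod (f (r *\<^sub>R \<zeta>))) at_top (at_left 1)" if \<zeta>: "\<zeta> \<in> E" for \<zeta>
    unfolding filterlim_at_top
  proof
    fix Z :: real
    have n1: "norm \<zeta> = 1" using \<zeta> E by (auto simp: unit_sphere_def)
    obtain N :: nat where N: "2 * (Z + 1) < real N" using reals_Archimedean2 by blast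
    have lim: "((\<lambda>r. u k (r *\<^sub>R \<zeta>)) \<longlongrightarrow> u k \<zeta>) (at_left 1)" for k
    proof -
      have "continuous_on {0..1} (\<lambda>r. u k (r *\<^sub>R \<zeta>))"
        by (rule continuous_on_compose2[OF u(4)]) (auto intro!: continuous_intros simp: n1)
      then have "((\<lambda>r. u k (r *\<^sub>R \<zeta>)) \<longlongrightarrow> u k (1 *\<^sub>R \<zeta>)) (at 1 within {0..1})"
        unfolding continuous_on by (rule bspec) simp
      then show ?thesis by (simp add: at_within_Icc_at_left)
    qed
    have "((\<lambda>r. \<Sum>k<N. Re (u k (r *\<^sub>R \<zeta>))) \<longlongrightarrow> (\<Sum>k<N. Re (u k \<zeta>))) (at_left 1)"
      by (intro tendsto_sum tendsto_Re lim)
    moreover have "(\<Sum>k<N. 1 / 2) \<le> (\<Sum>k<N. Re (u k \<zeta>))" by (intro sum_mono u(3) \<zeta>)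
    then have "Z < (\<Sum>k<N. Re (u k \<zeta>))" using N by simp
    ultimately have "\<forall>\<^sub>F r in at_left 1. Z < (\<Sum>k<N. Re (u k (r *\<^sub>R \<zeta>)))" by (rule order_tendstoD(1))
    moreover have "\<forall>\<^sub>F r in at_left (1::real). r \<in> {0<..<1}" by (rule eventually_at_left_real) simp
    ultimately show "\<forall>\<^sub>F r in at_left 1. Z \<le> cmod (f (r *\<^sub>R \<zeta>))"
    proof eventually_elim
      case (elim r)
      have zb: "r *\<^sub>R \<zeta> \<in> open_ball" "norm (r *\<^sub>R \<zeta>) \<le> 1" using elim n1 by (auto simp: open_ball_def)
      have "(\<Sum>k<N. Re (u k (r *\<^sub>R \<zeta>))) \<le> (\<Sum>k. Re (u k (r *\<^sub>R \<zeta>)))"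
        by (intro sum_le_suminf summable_Re sm zb) (use u(2)[OF zb(2)] in auto)
      also have "\<dots> = Re (f (r *\<^sub>R \<zeta>))" unfolding f_def by (rule Re_suminf'[OF sm[OF zb(1)], symmetric])
      also have "\<dots> \<le> cmod (f (r *\<^sub>R \<zeta>))" by (rule complex_Re_le_cmod)
      finally show ?case using elim by simp
    qed
  qed
  ultimately show ?thesis unfolding in_H_def by blast
qed

section \<open>Accretivity of potentials and their Cayley quotients\<close>

text \<open>The average of \<open>psd_accretive\<close> over the poles; the constant 1 survives
  because the weights sum to 1.\<close>

lemma psd_kernel_comb_accretive:
  assumes w: "weight open_ball T c"
  shows "psd open_ball (\<lambda>z v. (kernel_comb T (\<lambda>x. of_real (c x)) z + cnj (kernel_comb T (\<lambda>x. of_real (c x)) v) - 1) * K z v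
      - (\<Sum>x\<in>T. of_real (c x) * (K z x * cnj (K v x))))"
proof -
  have one: "(\<Sum>x\<in>T. complex_of_real (c x)) = 1" using w by (simp add: weight_def flip: of_real_sum)
  have "psd open_ball (\<lambda>z v. \<Sum>x\<in>T. of_real (c x) *
      ((K z x + cnj (K v x) - 1) * K z v - K z x * cnj (K v x)))"
    using w by (intro psd_sum psd_scale psd_accretive) (auto simp: weight_def)
  also have "(\<lambda>z v. \<Sum>x\<in>T. of_real (c x) * ((K z x + cnj (K v x) - 1) * K z v - K z x * cnj (K v x)))
    = (\<lambda>z v. (kernel_comb T (\<lambda>x. of_real (c x)) z + cnj (kernel_comb T (\<lambda>x. of_real (c x)) v) - (\<Sum>x\<in>T. complex_of_real (c x))) * K z v
      - (\<Sum>x\<in>T. of_real (c x) * (K z x * cnj (K v x))))"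
    by (intro ext) (simp add: kernel_comb_def algebra_simps sum.distrib sum_subtractf sum_distrib_left sum_distrib_right)
  finally show ?thesis unfolding one .
qed

lemma weight_dilation:
  assumes w: "weight unit_sphere S c" and t: "0 < t" "t < 1"
  shows "weight open_ball ((*\<^sub>R) t ` S) (\<lambda>y. c (y /\<^sub>R t))"
  unfolding weight_def
proof (intro conjI)
  have "inj_on ((*\<^sub>R) t) S" using t by (auto simp: inj_on_def)
  then show "(\<Sum>y\<in>(*\<^sub>R) t ` S. c (y /\<^sub>R t)) = 1"
    using w t by (simp add: sum.reindex weight_def)
  show "(*\<^sub>R) t ` S \<subseteq> open_ball" using w t by (intro dilation_ball) (auto simp: weight_def)
qed (use w t in \<open>auto simp: weight_def\<close>)

lemma psd_potential_Re:
  assumes w: "weight unit_sphere S c" and t: "0 < t" "t < 1"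
  shows "psd open_ball (\<lambda>z v. (potential S c t z + cnj (potential S c t v) - 1) * K z v)"
proof -
  define T where "T = (*\<^sub>R) t ` S"
  define d where "d y = c (y /\<^sub>R t)" for y
  have w': "weight open_ball T d" unfolding T_def d_def by (rule weight_dilation[OF assms])
  have "psd open_ball (\<lambda>z v. (\<Sum>x\<in>T. of_real (d x) * (K z x * cnj (K v x))))"
    using w' by (intro psd_sum psd_scale psd_rank1) (auto simp: weight_def)
  from psd_add[OF psd_kernel_comb_accretive[OF w'] this] show ?thesis
    by (simp add: potential_kernel_comb[OF t(1)] T_def d_def)
qed

text \<open>With F = f + s, accretivity makes 1 / F a limit of polynomials, and the quotient is
  contractive because F(z) cnj(F(v)) - f(z) cnj(f(v)) = s (f(z) + cnj(f(v))) + s^2.\<close>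

lemma mult_bound_cayley:
  assumes w: "weight unit_sphere S c" and t: "0 < t" "t < 1" and s: "0 < s"
  shows "mult_bound (\<lambda>z. potential S c t z / (potential S c t z + of_real s)) 1" (is ?mult_bound)
    and "lim_poly (\<lambda>z. potential S c t z / (potential S c t z + of_real s))" (is ?lp)
proof -
  define f where "f = potential S c t"
  define F where "F z = f z + of_real s" for z
  have re: "0 \<le> Re (f z)" if "norm z \<le> 1" for z
    unfolding f_def using w t that by (intro Re_potential_nonneg) auto
  have Fnz: "F z \<noteq> 0" if "norm z \<le> 1" for z
    using re[OF that] s by (auto simp: F_def complex_eq_iff)
  have p1: "psd open_ball (\<lambda>z v. (f z + cnj (f v) - 1) * K z v)"
    unfolding f_def using w t by (intro psd_potential_Re) auto
  \<comment> \<open>Adding K cancels the -1; what remains is accretivity of F with the constant d =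
    s.\<close>
  have "psd open_ball (\<lambda>z v. (f z + cnj (f v) - 1) * K z v + of_real 1 * K z v)"
    by (intro psd_add p1 psd_scale psd_K) simp
  then have "psd open_ball (\<lambda>z v. (F z + cnj (F v) - of_real (2 * s)) * K z v)"
    by (simp add: F_def algebra_simps)
  moreover have "lim_poly F"
    unfolding F_def f_def using w t by (intro lim_poly_add lim_poly_potential lim_poly_cpoly[OF cpoly_const]) (auto simp: weight_def)
  ultimately have inv: "lim_poly (\<lambda>z. 1 / F z)"
    using lim_poly_inverse[of F s] s re by (simp add: F_def)
  have "lim_poly (\<lambda>z. f z * (1 / F z))"
    by (intro lim_poly_mult inv) (unfold f_def, use w t in \<open>auto intro: lim_poly_potential simp: weight_def\<close>)
  then show ?lp by (simp add: F_def f_def)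
  have "mult_bound (\<lambda>z. f z / F z) 1"
  proof (rule mult_boundI_psd)
    show "cmod (f z / F z) \<le> 1" if "norm z \<le> 1" for z
    proof -
      have "(Re (f z))\<^sup>2 \<le> (Re (f z) + s)\<^sup>2" using re[OF that] s by (intro power_mono) auto
      then have "cmod (f z) \<le> cmod (F z)" unfolding F_def cmod_def by simp
      then show ?thesis using Fnz[OF that] by (simp add: norm_divide divide_le_eq)
    qed
    \<comment> \<open>This is s (f(z) + cnj(f(v)) + s) K(z,v), split into two positive
      kernels.\<close>
    have "psd open_ball (\<lambda>z v. of_real s * ((f z + cnj (f v) - 1) * K z v) + of_real (s * (1 + s)) * K z v)"
      using s by (intro psd_add psd_scale p1 psd_K) auto
    then have "psd open_ball (\<lambda>z v. (1 / F z) * (of_real s * ((f z + cnj (f v) - 1) * K z v)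
        + of_real (s * (1 + s)) * K z v) * cnj (1 / F v))" by (rule psd_congruence)
    also have "?this \<longleftrightarrow> psd open_ball (\<lambda>z v. (of_real (1\<^sup>2) - f z / F z * cnj (f v / F v)) * K z v)"
    proof (rule psd_cong)
      fix z v :: "complex^'a" assume "z \<in> open_ball" "v \<in> open_ball"
      then have "F z \<noteq> 0" "cnj (F v) \<noteq> 0" using Fnz by (auto simp: open_ball_def)
      then show "(1 / F z) * (of_real s * ((f z + cnj (f v) - 1) * K z v) + of_real (s * (1 + s)) * K z v) * cnj (1 / F v)
          = (of_real (1\<^sup>2) - f z / F z * cnj (f v / F v)) * K z v"
        by (simp add: field_simps) (simp add: F_def algebra_simps)
    qed
    finally show "psd open_ball (\<lambda>z v. (of_real (1\<^sup>2) - f z / F z * cnj (f v / F v)) * K z v)" .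
  qed simp
  then show ?mult_bound by (simp add: F_def f_def)
qed

end

section \<open>Weak limits of discrete measures\<close>

text \<open>Even, of period 2, equal to 0 on [0, 1/3] and to 1 on [2/3, 1]: a continuous function
  that reads the first ternary digit of a point of the Cantor set, the digit 2 being read as
  1.\<close>

definition schoenberg :: "real \<Rightarrow> real" where
  "schoenberg x = max 0 (min 1 (1 / 2 - cos (pi * x)))"

lemma schoenberg_bounds: "0 \<le> schoenberg x" "schoenberg x \<le> 1"
  by (auto simp: schoenberg_def)

lemma continuous_on_schoenberg [continuous_intros]:
  fixes f :: "'a::t2_space \<Rightarrow> real"
  shows "continuous_on S f \<Longrightarrow> continuous_on S (\<lambda>x. schoenberg (f x))"
  unfolding schoenberg_def by (intro continuous_intros)

lemma sums_ternary: "(\<lambda>i. 2 / 3 ^ Suc i :: real) sums 1"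
  using sums_mult[OF geometric_sums[of "1/3::real"], of "2/3"] by (simp add: power_divide)

text \<open>Multiplication by 3^m shifts the expansion by m digits. The integer part split off is
  even, since all digits are 0 or 2, and disappears by periodicity; the rest lies in the first or
  the last third of [0,1] according to digit m.\<close>

lemma schoenberg_digit:
  assumes d: "\<And>i. d i \<in> {0, 1 :: nat}"
  shows "schoenberg (3 ^ m * (\<Sum>i. 2 * real (d i) / 3 ^ Suc i)) = real (d m)"
proof -
  have bnd: "real (d i) \<le> 1" for i using d[of i] by auto
  have geo: "summable (\<lambda>i. 2 / 3 ^ Suc i :: real)" "(\<Sum>i. 2 / 3 ^ Suc i :: real) = 1"
    using sums_ternary by (auto simp: sums_iff)
  define t where "t e = (\<Sum>i. 2 * real (e i) / 3 ^ Suc i)" for e :: "nat \<Rightarrow> nat"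
  have sm: "summable (\<lambda>i. 2 * real (e i) / 3 ^ Suc i)" if "\<And>i. real (e i) \<le> 1" for e :: "nat \<Rightarrow> nat"
    by (rule summable_comparison_test'[OF geo(1)]) (use that in \<open>auto intro!: divide_right_mono\<close>)
  have t01: "0 \<le> t e \<and> t e \<le> 1" if "\<And>i. real (e i) \<le> 1" for e
  proof
    show "0 \<le> t e" unfolding t_def by (intro suminf_nonneg sm that) auto
    have "t e \<le> (\<Sum>i. 2 / 3 ^ Suc i)"
      unfolding t_def by (intro suminf_le sm that geo(1)) (use that in \<open>auto intro!: divide_right_mono\<close>)
    then show "t e \<le> 1" using geo(2) by simp
  qed
  have step: "3 * t e = 2 * real (e 0) + t (\<lambda>i. e (Suc i))" if "\<And>i. real (e i) \<le> 1" for e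
  proof -
    have "t e = (\<Sum>i. 2 * real (e (Suc i)) / 3 ^ Suc (Suc i)) + 2 * real (e 0) / 3"
      unfolding t_def using suminf_split_head[OF sm[of e, OF that]] by simp
    also have "(\<Sum>i. 2 * real (e (Suc i)) / 3 ^ Suc (Suc i)) = (1 / 3) * t (\<lambda>i. e (Suc i))"
      unfolding t_def by (subst suminf_mult[symmetric]) (use sm[of "\<lambda>i. e (Suc i)", OF that] in auto)
    finally show ?thesis by simp
  qed
  have ex: "\<exists>k::nat. 3 ^ m * t d = 2 * real k + t (\<lambda>i. d (m + i))" for m
  proof (induction m)
    case 0
    then show ?case by (intro exI[of _ 0]) simp
  next
    case (Suc m)
    then obtain k :: nat where k: "3 ^ m * t d = 2 * real k + t (\<lambda>i. d (m + i))" by blast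
    have "3 ^ Suc m * t d = 2 * real (3 * k + d m) + t (\<lambda>i. d (Suc m + i))"
      using step[of "\<lambda>i. d (m + i)"] bnd k by simp
    then show ?case by blast
  qed
  obtain k :: nat where k: "3 ^ m * t d = 2 * real k + t (\<lambda>i. d (m + i))" using ex by blast
  define u where "u = t (\<lambda>i. d (m + i))"
  have "pi * (3 ^ m * t d) = pi * u + 2 * real k * pi" unfolding k u_def by (simp add: algebra_simps)
  then have c: "cos (pi * (3 ^ m * t d)) = cos (pi * u)"
    by (simp only: cos_add cos_2npi sin_2npi)
  have u3: "3 * u = 2 * real (d m) + t (\<lambda>i. d (m + Suc i))"
    unfolding u_def using step[of "\<lambda>i. d (m + i)"] bnd by simp
  have rest: "0 \<le> t (\<lambda>i. d (m + Suc i))" "t (\<lambda>i. d (m + Suc i)) \<le> 1"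
    using t01[of "\<lambda>i. d (m + Suc i)"] bnd by auto
  show ?thesis
  proof (cases "d m = 0")
    case True
    then have "0 \<le> u" "u \<le> 1 / 3" using u3 rest by auto
    then have "cos (pi / 3) \<le> cos (pi * u)" by (intro cos_monotone_0_pi_le) auto
    then have "1 / 2 - cos (pi * u) \<le> 0" by (simp add: cos_60)
    then show ?thesis using True c by (simp add: schoenberg_def t_def)
  next
    case False
    then have dm: "d m = 1" using d[of m] by auto
    then have u: "2 / 3 \<le> u" "u \<le> 1" using u3 rest by auto
    then have "cos (pi * u) \<le> cos (pi * (2 / 3))" by (intro cos_monotone_0_pi_le) auto
    also have "\<dots> = - 1 / 2"
      using cos_minus_pi[of "pi / 3"] cos_60 by (simp add: cos_120 algebra_simps)
    finally have "1 \<le> 1 / 2 - cos (pi * u)" by simp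
    then show ?thesis using dm c by (simp add: schoenberg_def t_def)
  qed
qed

text \<open>Iterates the doubling map and emits 1 when the remainder is at least 1/2. The remainder
  stays in the closed interval, so y = 1 receives the expansion with all digits 1.\<close>

lemma binary_expansion:
  fixes y :: real
  assumes "0 \<le> y" "y \<le> 1"
  obtains d :: "nat \<Rightarrow> nat" where "\<And>i. d i \<in> {0, 1}" "(\<lambda>i. real (d i) / 2 ^ Suc i) sums y"
proof -
  define r where "r = rec_nat y (\<lambda>_ s. 2 * s - (if 1 / 2 \<le> s then 1 else 0))"
  define d where "d i = (if 1 / 2 \<le> r i then 1 else 0 :: nat)" for i
  have r0: "r 0 = y" and rS: "r (Suc i) = 2 * r i - real (d i)" for i
    by (auto simp: r_def d_def)
  have r01: "0 \<le> r i \<and> r i \<le> 1" for i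
    using assms by (induction i) (auto simp: r0 rS d_def)
  have part: "(\<Sum>i<n. real (d i) / 2 ^ Suc i) = y - r n / 2 ^ n" for n
    by (induction n) (auto simp: r0 rS field_simps)
  have "(\<lambda>n. r n / 2 ^ n) \<longlonglongrightarrow> 0"
  proof (rule tendsto_sandwich[OF _ _ tendsto_const])
    show "(\<lambda>n. (1 / 2 :: real) ^ n) \<longlonglongrightarrow> 0" by (rule LIMSEQ_power_zero) simp
    show "\<forall>\<^sub>F n in sequentially. 0 \<le> r n / 2 ^ n" using r01 by simp
    have "r n / 2 ^ n \<le> (1 / 2) ^ n" for n
      using r01[of n] by (simp add: power_divide divide_right_mono)
    then show "\<forall>\<^sub>F n in sequentially. r n / 2 ^ n \<le> (1 / 2) ^ n" by (intro always_eventually allI)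
  qed
  then have "(\<lambda>n. y - r n / 2 ^ n) \<longlonglongrightarrow> y - 0" by (intro tendsto_intros)
  then have "(\<lambda>i. real (d i) / 2 ^ Suc i) sums y" unfolding sums_def part by simp
  then show ?thesis by (intro that[of d]) (auto simp: d_def)
qed

text \<open>Schoenberg's space filling curve: its coordinates read off the ternary digits of the parameter
  along residue classes.\<close>
lemma space_filling_curve:
  fixes R :: real
  assumes "0 < R"
  obtains p :: "real \<Rightarrow> 'a::euclidean_space" where "continuous_on UNIV p" "cball 0 R \<subseteq> p ` {0..1}"
proof -
  define n where "n = DIM('a)"
  have n0: "0 < n" by (simp add: n_def)
  obtain idx :: "'a \<Rightarrow> nat" where idx: "bij_betw idx Basis {..<n}"
    using ex_bij_betw_finite_nat[OF finite_Basis] by (auto simp: n_def atLeast0LessThan)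
  have idxn: "idx v < n" if "v \<in> Basis" for v using bij_betwE[OF idx] that by auto
  define g where "g j t = (\<Sum>k. schoenberg (3 ^ (n * k + j) * t) / 2 ^ Suc k)" for j t
  have gc: "continuous_on UNIV (g j)" for j
  proof -
    have "uniform_limit UNIV (\<lambda>N t. \<Sum>k<N. schoenberg (3 ^ (n * k + j) * t) / 2 ^ Suc k) (g j) sequentially"
      unfolding g_def
    proof (rule Weierstrass_m_test)
      show "norm (schoenberg (3 ^ (n * k + j) * t) / 2 ^ Suc k) \<le> (1 / 2) ^ Suc k" for k t
        using schoenberg_bounds[of "3 ^ (n * k + j) * t"] by (simp add: power_divide divide_right_mono)
      show "summable (\<lambda>k. (1 / 2 :: real) ^ Suc k)" by (subst summable_Suc_iff) simp
    qed
    then show ?thesis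
      by (rule uniform_limit_theorem[rotated]) (auto intro!: always_eventually continuous_intros)
  qed
  define p where "p t = (\<Sum>v\<in>Basis. (R * (2 * g (idx v) t - 1)) *\<^sub>R v)" for t :: real
  have pc: "continuous_on UNIV p"
    unfolding p_def by (intro continuous_intros continuous_on_compose2[OF gc]) auto
  have "x \<in> p ` {0..1}" if x: "x \<in> cball 0 R" for x :: 'a
  proof -
    define y where "y v = (x \<bullet> v / R + 1) / 2" for v
    have y01: "0 \<le> y v \<and> y v \<le> 1" if "v \<in> Basis" for v
    proof -
      have "\<bar>x \<bullet> v\<bar> \<le> R" using Basis_le_norm[OF that, of x] x by simp
      then show ?thesis using assms by (auto simp: y_def field_simps abs_le_iff)
    qed
    have "\<forall>v\<in>Basis. \<exists>d. (\<forall>i. d i \<in> {0, 1::nat}) \<and> (\<lambda>i. real (d i) / 2 ^ Suc i) sums y v"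
      using binary_expansion y01 by metis
    then obtain d where d: "\<And>v i. v \<in> Basis \<Longrightarrow> d v i \<in> {0, 1::nat}"
      "\<And>v. v \<in> Basis \<Longrightarrow> (\<lambda>i. real (d v i) / 2 ^ Suc i) sums y v"
      by metis
    \<comment> \<open>Interleaves the binary digits of the rescaled coordinates of \<open>x\<close>
      into the digits of a single parameter.\<close>
    define e where "e m = d (the_inv_into Basis idx (m mod n)) (m div n)" for m
    have inB: "the_inv_into Basis idx j \<in> Basis" if "j < n" for j
      using idx that by (intro the_inv_into_into) (auto simp: bij_betw_def)
    have e01: "e m \<in> {0, 1}" for m
      unfolding e_def by (rule d(1)[OF inB]) (use n0 in simp)
    have eidx: "e (n * k + idx v) = d v k" if "v \<in> Basis" for v k
      using idxn[OF that] that idx by (simp add: e_def the_inv_into_f_f bij_betw_def)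
    define t where "t = (\<Sum>i. 2 * real (e i) / 3 ^ Suc i)"
    have geo: "summable (\<lambda>i. 2 / 3 ^ Suc i :: real)" "(\<Sum>i. 2 / 3 ^ Suc i :: real) = 1"
      using sums_ternary by (auto simp: sums_iff)
    have le: "2 * real (e i) / 3 ^ Suc i \<le> 2 / 3 ^ Suc i" for i
      using e01[of i] by (intro divide_right_mono) auto
    have smt: "summable (\<lambda>i. 2 * real (e i) / 3 ^ Suc i)"
      by (rule summable_comparison_test'[OF geo(1)]) (use le in auto)
    have "0 \<le> t" unfolding t_def by (intro suminf_nonneg smt) auto
    moreover have "t \<le> 1" unfolding t_def geo(2)[symmetric] by (intro suminf_le smt geo le)
    moreover have "g (idx v) t = y v" if "v \<in> Basis" for v
      unfolding g_def t_def schoenberg_digit[OF e01] eidx[OF that]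
      using d(2)[OF that] by (simp add: sums_iff)
    then have "R * (2 * g (idx v) t - 1) = x \<bullet> v" if "v \<in> Basis" for v
      using that assms by (simp add: y_def field_simps)
    then have "p t = (\<Sum>v\<in>Basis. (x \<bullet> v) *\<^sub>R v)"
      unfolding p_def by (intro sum.cong refl) simp
    then have "p t = x" by (simp add: euclidean_representation)
    ultimately show ?thesis by (intro image_eqI[of _ _ t]) auto
  qed
  then show ?thesis using that[OF pc] by blast
qed

text \<open>A right inverse of a space-filling curve p carries the weights to probability measures
  on [0,1]. These are tight, so a subsequence converges weakly on the line, and p carries the limit
  back. Continuity of p transfers the convergence, because q is integrated in the form
  q(p(s)).\<close>

lemma weight_weak_limit:
  fixes E :: "'a::euclidean_space set" and c :: "nat \<Rightarrow> 'a \<Rightarrow> real"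
  assumes E: "compact E" and w: "\<And>k. weight E (S k) (c k)"
  obtains r :: "nat \<Rightarrow> nat" and \<mu> where "strict_mono r" "prob_space \<mu>" "sets \<mu> = sets borel" "AE x in \<mu>. x \<in> E"
    "\<And>q :: 'a \<Rightarrow> complex. continuous_on E q \<Longrightarrow>
      (\<lambda>k. \<Sum>x\<in>S (r k). of_real (c (r k) x) * q x) \<longlonglongrightarrow> (LINT x|\<mu>. indicator E x *\<^sub>R q x)"
proof -
  obtain R where R: "0 < R" "E \<subseteq> cball 0 R"
    using compact_imp_bounded[OF E] bounded_subset_ballD[of E 0] ball_subset_cball by (metis order_trans)
  obtain p :: "real \<Rightarrow> 'a" where p: "continuous_on UNIV p" "cball 0 R \<subseteq> p ` {0..1}"
    using space_filling_curve[OF R(1)] .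
  have "\<forall>x\<in>E. \<exists>s\<in>{0..1}. p s = x" using p(2) R(2) by (metis imageE subsetD)
  then obtain \<tau> where \<tau>: "\<And>x. x \<in> E \<Longrightarrow> \<tau> x \<in> {0..1}" "\<And>x. x \<in> E \<Longrightarrow> p (\<tau> x) = x" by metis
  define N where "N k = distr (point_measure (S k) (\<lambda>x. ennreal (c k x))) borel \<tau>" for k
  have fin: "finite (S k)" and SE: "S k \<subseteq> E" and c0: "\<And>x. x \<in> S k \<Longrightarrow> 0 \<le> c k x" and c1: "sum (c k) (S k) = 1" for k
    using w[of k] by (auto simp: weight_def)
  \<comment> \<open>The selection \<tau> comes from choice and has no regularity on
    \<open>E\<close>; on a point measure every function is measurable.\<close>
  have meas: "\<tau> \<in> measurable (point_measure (S k) f) borel" for k f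
    by (simp add: measurable_point_measure_eq1 measurable_def)
  have pp: "prob_space (point_measure (S k) (\<lambda>x. ennreal (c k x)))" for k
    using c0[of _ k] c1[of k] fin[of k] by (intro prob_space_point_measure) (auto simp: sum_ennreal)
  have rd: "real_distribution (N k)" for k
    unfolding N_def real_distribution_def real_distribution_axioms_def
    by (auto intro!: prob_space.prob_space_distr pp meas)
  have intN: "integral\<^sup>L (N k) h = (\<Sum>x\<in>S k. of_real (c k x) * h (\<tau> x))"
    if "h \<in> borel_measurable borel" for k and h :: "real \<Rightarrow> complex"
    unfolding N_def using that c0[of _ k] fin[of k]
    by (subst integral_distr[OF meas]) (auto simp: lebesgue_integral_point_measure_finite scaleR_conv_of_real)
  have "tight N"
    unfolding tight_def
  proof (intro conjI allI impI rd)
    fix \<epsilon> :: real assume \<epsilon>: "0 < \<epsilon>"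
    \<comment> \<open>The left end lies below 0 because tightness uses half-open intervals and mass
      may sit at 0.\<close>
    have "measure (N k) {-1<..1} = 1" for k
    proof -
      interpret prob_space "point_measure (S k) (\<lambda>x. ennreal (c k x))" by (rule pp)
      have "\<tau> -` {-1<..1} \<inter> space (point_measure (S k) (\<lambda>x. ennreal (c k x))) = space (point_measure (S k) (\<lambda>x. ennreal (c k x)))"
        using \<tau>(1) SE[of k] by (force simp: space_point_measure)
      then show ?thesis
        unfolding N_def by (subst measure_distr[OF meas]) (auto simp: prob_space)
    qed
    then show "\<exists>a b. a < b \<and> (\<forall>n. 1 - \<epsilon> < measure (N n) {a<..b})"
      using \<epsilon> by (intro exI[of _ "-1"] exI[of _ 1]) auto
  qed
  from tight_imp_convergent_subsubsequence[OF this strict_mono_id]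
  obtain r M where r: "strict_mono (r :: nat \<Rightarrow> nat)" and M: "real_distribution M"
    and wc: "weak_conv_m (N \<circ> id \<circ> r) M" by blast
  interpret M: real_distribution M by (rule M)
  have pm: "p \<in> measurable M borel"
    using borel_measurable_continuous_onI[OF p(1)] by simp
  define \<mu> where "\<mu> = distr M borel p"
  have \<mu>: "prob_space \<mu>" "sets \<mu> = sets borel"
    unfolding \<mu>_def by (auto intro!: M.prob_space_distr pm)
  interpret \<mu>: prob_space \<mu> by (rule \<mu>(1))
  have conv: "(\<lambda>k. \<Sum>x\<in>S (r k). of_real (c (r k) x) * q x) \<longlonglongrightarrow> integral\<^sup>L \<mu> q"
    if q: "continuous_on UNIV q" "\<And>x. norm (q x) \<le> C" for q :: "'a \<Rightarrow> complex" and C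
  proof -
    have qp: "continuous_on UNIV (\<lambda>s. q (p s))" by (rule continuous_on_compose2[OF q(1) p(1)]) auto
    have "(\<lambda>k. integral\<^sup>L ((N \<circ> id \<circ> r) k) (\<lambda>s. q (p s))) \<longlonglongrightarrow> integral\<^sup>L M (\<lambda>s. q (p s))"
      by (rule weak_conv_imp_integral_bdd_continuous_conv[OF _ M wc])
         (use rd qp q(2) in \<open>auto simp: continuous_on_eq_continuous_at\<close>)
    moreover have "integral\<^sup>L ((N \<circ> id \<circ> r) k) (\<lambda>s. q (p s)) = (\<Sum>x\<in>S (r k). of_real (c (r k) x) * q x)" for k
      unfolding o_def id_def
      by (subst intN) (use subsetD[OF SE] \<tau>(2) borel_measurable_continuous_onI[OF qp] in \<open>auto intro!: sum.cong\<close>)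
    moreover have "integral\<^sup>L \<mu> q = integral\<^sup>L M (\<lambda>s. q (p s))"
      unfolding \<mu>_def using borel_measurable_continuous_onI[OF q(1)] by (intro integral_distr pm) auto
    ultimately show ?thesis by simp
  qed
  have Ene: "E \<noteq> {}" using SE[of 0] c1[of 0] by auto
  have Ecl: "closed E" by (rule compact_imp_closed[OF E])
  have AE: "AE x in \<mu>. x \<in> E"
  proof -
    \<comment> \<open>A bounded continuous function whose zero set is the closed set
      \<open>E\<close>. Its sums against the weights vanish, hence so does its integral in the
      limit.\<close>
    define q where "q x = min 1 (infdist x E)" for x
    have qc: "continuous_on UNIV q" unfolding q_def by (intro continuous_intros)
    have q01: "0 \<le> q x" "q x \<le> 1" for x by (auto simp: q_def infdist_nonneg)
    have qm: "q \<in> borel_measurable \<mu>"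
      using borel_measurable_continuous_onI[OF qc] measurable_cong_sets[OF \<mu>(2) refl] by blast
    have iq: "integrable \<mu> q"
      by (rule \<mu>.integrable_const_bound[of _ 1]) (use q01 qm in auto)
    have "(\<lambda>k. \<Sum>x\<in>S (r k). of_real (c (r k) x) * complex_of_real (q x)) \<longlonglongrightarrow> integral\<^sup>L \<mu> (\<lambda>x. complex_of_real (q x))"
      by (rule conv[of _ 1]) (use qc q01 in \<open>auto intro!: continuous_intros\<close>)
    moreover have "(\<Sum>x\<in>S (r k). of_real (c (r k) x) * complex_of_real (q x)) = 0" for k
      using SE by (intro sum.neutral) (auto simp: q_def subset_iff)
    ultimately have "integral\<^sup>L \<mu> (\<lambda>x. complex_of_real (q x)) = 0"
      by (simp add: LIMSEQ_const_iff)
    then have "integral\<^sup>L \<mu> q = 0" by simp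
    then have "AE x in \<mu>. q x = 0"
      using integral_nonneg_eq_0_iff_AE[OF iq] q01 by simp
    then show ?thesis
      by eventually_elim (use in_closed_iff_infdist_zero[OF Ecl Ene] in \<open>auto simp: q_def min_def split: if_splits\<close>)
  qed
  show ?thesis
  proof (rule that[OF r \<mu> AE])
    fix q :: "'a \<Rightarrow> complex" assume q: "continuous_on E q"
    obtain C where C: "\<And>x. x \<in> E \<Longrightarrow> norm (q x) \<le> C" "0 \<le> C"
      using compact_imp_bounded[OF compact_continuous_image[OF q E]] unfolding bounded_pos by (auto intro: less_imp_le)
    obtain q' where q': "continuous_on UNIV q'" "\<And>x. x \<in> E \<Longrightarrow> q' x = q x" "\<And>x. norm (q' x) \<le> C"
      using Tietze[OF q, of UNIV C] Ecl C by auto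
    have "(\<lambda>k. \<Sum>x\<in>S (r k). of_real (c (r k) x) * q' x) \<longlonglongrightarrow> integral\<^sup>L \<mu> q'"
      by (rule conv[OF q'(1,3)])
    moreover have "(\<Sum>x\<in>S (r k). of_real (c (r k) x) * q' x) = (\<Sum>x\<in>S (r k). of_real (c (r k) x) * q x)" for k
      using SE q'(2) by (intro sum.cong) auto
    moreover have "integral\<^sup>L \<mu> q' = (LINT x|\<mu>. indicator E x *\<^sub>R q x)"
    proof (rule integral_cong_AE)
      show "q' \<in> borel_measurable \<mu>"
        using borel_measurable_continuous_onI[OF q'(1)] measurable_cong_sets[OF \<mu>(2) refl] by blast
      have "(\<lambda>x. indicator E x *\<^sub>R q x) \<in> borel_measurable borel"
        by (rule borel_measurable_continuous_on_indicator) (use q Ecl in auto)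
      then show "(\<lambda>x. indicator E x *\<^sub>R q x) \<in> borel_measurable \<mu>"
        using measurable_cong_sets[OF \<mu>(2) refl] by blast
      show "AE x in \<mu>. q' x = indicator E x *\<^sub>R q x" using AE by eventually_elim (simp add: q'(2))
    qed
    ultimately show "(\<lambda>k. \<Sum>x\<in>S (r k). of_real (c (r k) x) * q x) \<longlonglongrightarrow> (LINT x|\<mu>. indicator E x *\<^sub>R q x)"
      by simp
  qed
qed

section \<open>Henkin measures\<close>

text \<open>Inner regularity of the measure with density |h| extends the vanishing from compact sets
  to all Borel subsets of \<open>E\<close>. The real and imaginary parts of \<open>h\<close> on
  \<open>E\<close> are then densities of the zero measure.\<close>

lemma AE_zero_if_compact_integrals_zero:
  fixes h :: "'a::{second_countable_topology, complete_space} \<Rightarrow> complex"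
  assumes sets: "sets \<nu> = sets borel" and fin: "finite_measure \<nu>" and h: "integrable \<nu> h"
    and E: "E \<in> sets borel"
    and zero: "\<And>K. compact K \<Longrightarrow> K \<subseteq> E \<Longrightarrow> (LINT x|\<nu>. indicator K x *\<^sub>R h x) = 0"
  shows "AE x in \<nu>. x \<in> E \<longrightarrow> h x = 0"
proof -
  interpret finite_measure \<nu> by (rule fin)
  define \<rho> where "\<rho> = density \<nu> (\<lambda>x. ennreal (cmod (h x)))"
  have hm: "h \<in> borel_measurable \<nu>" using h by simp
  have em: "emeasure \<rho> X = ennreal (LINT x|\<nu>. indicator X x * cmod (h x))"
    and ii: "integrable \<nu> (\<lambda>x. indicator X x *\<^sub>R h x)" "integrable \<nu> (\<lambda>x. indicator X x * cmod (h x))"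
    if X: "X \<in> sets \<nu>" for X
  proof -
    show 1: "integrable \<nu> (\<lambda>x. indicator X x *\<^sub>R h x)" by (rule integrable_mult_indicator[OF X h])
    show 2: "integrable \<nu> (\<lambda>x. indicator X x * cmod (h x))"
      using integrable_mult_indicator[OF X integrable_norm[OF h]] by simp
    have "emeasure \<rho> X = (\<integral>\<^sup>+x. ennreal (cmod (h x)) * indicator X x \<partial>\<nu>)"
      unfolding \<rho>_def using hm X by (intro emeasure_density) auto
    also have "\<dots> = (\<integral>\<^sup>+x. ennreal (indicator X x * cmod (h x)) \<partial>\<nu>)"
      by (intro nn_integral_cong) (simp split: split_indicator)
    also have "\<dots> = ennreal (LINT x|\<nu>. indicator X x * cmod (h x))"
      by (rule nn_integral_eq_integral[OF 2]) simp
    finally show "emeasure \<rho> X = ennreal (LINT x|\<nu>. indicator X x * cmod (h x))" .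
  qed
  have sp: "space \<nu> \<in> sets \<nu>" by simp
  have rs: "sets \<rho> = sets borel" "space \<rho> = space \<nu>" by (simp_all add: \<rho>_def sets)
  have zB: "(LINT x|\<nu>. indicator Q x *\<^sub>R h x) = 0" if Q: "Q \<in> sets borel" "Q \<subseteq> E" for Q
  proof (rule ccontr)
    assume ne: "(LINT x|\<nu>. indicator Q x *\<^sub>R h x) \<noteq> 0"
    define e where "e = cmod (LINT x|\<nu>. indicator Q x *\<^sub>R h x)"
    have e: "0 < e" using ne by (simp add: e_def)
    have Qs: "Q \<in> sets \<nu>" using Q sets by simp
    have SUP: "emeasure \<rho> Q = (SUP K\<in>{K. K \<subseteq> Q \<and> compact K}. emeasure \<rho> K)"
      by (rule inner_regular[OF rs(1) _ Q(1)]) (simp add: rs(2) em[OF sp])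
    have "\<exists>K\<in>{K. K \<subseteq> Q \<and> compact K}. emeasure \<rho> Q < emeasure \<rho> K + ennreal e"
    proof (rule SUP_approx_ennreal[OF _ _ SUP])
      show "{K. K \<subseteq> Q \<and> compact K} \<noteq> {}" by auto
      show "emeasure \<rho> Q \<noteq> \<infinity>" by (simp only: em[OF Qs]) simp
    qed (use e in simp)
    then obtain K where K: "K \<subseteq> Q" "compact K" "emeasure \<rho> Q < emeasure \<rho> K + ennreal e" by auto
    have Ks: "K \<in> sets \<nu>" using K(2) sets by (simp add: borel_compact)
    have nn: "0 \<le> (LINT x|\<nu>. indicator K x * cmod (h x))" by (intro integral_nonneg_AE) auto
    have lt: "(LINT x|\<nu>. indicator Q x * cmod (h x)) < (LINT x|\<nu>. indicator K x * cmod (h x)) + e"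
    proof -
      have "ennreal (LINT x|\<nu>. indicator Q x * cmod (h x)) < ennreal ((LINT x|\<nu>. indicator K x * cmod (h x)) + e)"
        using K(3) e nn by (simp add: em[OF Qs] em[OF Ks] ennreal_plus)
      then show ?thesis by (subst (asm) ennreal_less_iff) (auto intro!: integral_nonneg_AE)
    qed
    have "(LINT x|\<nu>. indicator Q x *\<^sub>R h x) = (LINT x|\<nu>. indicator Q x *\<^sub>R h x) - (LINT x|\<nu>. indicator K x *\<^sub>R h x)"
      using zero[OF K(2)] K(1) Q(2) by simp
    also have "\<dots> = (LINT x|\<nu>. indicator Q x *\<^sub>R h x - indicator K x *\<^sub>R h x)"
      by (rule Bochner_Integration.integral_diff[symmetric, OF ii(1)[OF Qs] ii(1)[OF Ks]])
    finally have "e = cmod (LINT x|\<nu>. indicator Q x *\<^sub>R h x - indicator K x *\<^sub>R h x)" by (simp add: e_def)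
    also have "\<dots> \<le> (LINT x|\<nu>. cmod (indicator Q x *\<^sub>R h x - indicator K x *\<^sub>R h x))"
      by (rule integral_norm_bound)
    also have "\<dots> = (LINT x|\<nu>. indicator Q x * cmod (h x) - indicator K x * cmod (h x))"
      using K(1) by (intro Bochner_Integration.integral_cong refl) (auto split: split_indicator)
    also have "\<dots> < e"
      using lt by (subst Bochner_Integration.integral_diff[OF ii(2)[OF Qs] ii(2)[OF Ks]]) simp
    finally show False by simp
  qed
  have part: "AE x in \<nu>. indicator E x * T (h x) = 0"
    if T: "bounded_linear T" for T :: "complex \<Rightarrow> real"
  proof -
    have Es: "E \<in> sets \<nu>" using E sets by simp
    have Ti: "integrable \<nu> (\<lambda>x. indicator E x * T (h x))"
      using integrable_bounded_linear[OF T ii(1)[OF Es]] by (simp add: linear_simps(5)[OF T])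
    have "AE x in \<nu>. indicator E x * T (h x) = (\<lambda>_. 0) x"
    proof (rule density_unique_real[OF Ti])
      fix X assume X: "X \<in> sets \<nu>"
      have XE: "X \<inter> E \<in> sets borel" using X Es sets by auto
      have "(LINT x:X|\<nu>. indicator E x * T (h x)) = (LINT x|\<nu>. T (indicator (X \<inter> E) x *\<^sub>R h x))"
        unfolding set_lebesgue_integral_def
        by (intro Bochner_Integration.integral_cong refl) (auto simp: linear_simps(5)[OF T] linear_simps(3)[OF T] split: split_indicator)
      also have "\<dots> = T (LINT x|\<nu>. indicator (X \<inter> E) x *\<^sub>R h x)"
        using XE sets by (intro integral_bounded_linear[OF T] ii) simp
      also have "\<dots> = 0" using zB[OF XE] by (simp add: linear_simps(3)[OF T])
      finally show "(LINT x:X|\<nu>. indicator E x * T (h x)) = (LINT x:X|\<nu>. 0)" by (simp add: set_lebesgue_integral_def)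
    qed simp
    then show ?thesis by simp
  qed
  show ?thesis
    using part[OF bounded_linear_Re] part[OF bounded_linear_Im]
    by eventually_elim (auto simp: complex_eq_iff)
qed

context pick_space begin

text \<open>By the uniform multiplier bound and density it suffices to pair with kernel
  combinations, where the claim is pointwise convergence at finitely many points.\<close>

lemma H_inner_weak_null:
  assumes m: "\<And>n. mult_bound (\<phi> n) 1" and lim: "\<And>z. z \<in> open_ball \<Longrightarrow> (\<lambda>n. \<phi> n z) \<longlonglongrightarrow> 0"
    and f: "in_H a f" and g: "in_H a g"
  shows "(\<lambda>n. H_inner a (\<lambda>z. \<phi> n z * f z) g) \<longlonglongrightarrow> 0"
proof (rule LIMSEQ_I)
  fix \<epsilon> :: real assume \<epsilon>: "0 < \<epsilon>"
  define M where "M = 2 * H_norm a f + 2 * H_norm a g + 1"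
  have M: "0 < M" using H_norm_nonneg[OF f] H_norm_nonneg[OF g] by (simp add: M_def)
  \<comment> \<open>M bounds the four norms in \<open>H_inner_diff_le\<close>; the condition e \<le>
    1 enters through the norm of the approximating combination.\<close>
  define e where "e = min 1 (\<epsilon> / (2 * M))"
  have e: "0 < e" "e \<le> 1" "e * M \<le> \<epsilon> / 2" using \<epsilon> M by (auto simp: e_def min_def field_simps)
  obtain S c where S: "finite S" "S \<subseteq> open_ball" and d: "H_norm a (\<lambda>z. g z - kernel_comb S c z) \<le> e"
    using kernel_comb_dense[OF g e(1)] by blast
  have "(\<lambda>n. pairing S c (\<lambda>z. \<phi> n z * f z)) \<longlonglongrightarrow> (\<Sum>x\<in>S. cnj (c x) * (0 * f x))"
    unfolding pairing_def using S by (intro tendsto_intros lim) auto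
  then have "(\<lambda>n. pairing S c (\<lambda>z. \<phi> n z * f z)) \<longlonglongrightarrow> 0" by simp
  then obtain N where N: "\<And>n. n \<ge> N \<Longrightarrow> cmod (pairing S c (\<lambda>z. \<phi> n z * f z)) < \<epsilon> / 2"
    using LIMSEQ_D[of _ 0 "\<epsilon> / 2"] \<epsilon> by auto
  have "cmod (H_inner a (\<lambda>z. \<phi> n z * f z) g) < \<epsilon>" if n: "n \<ge> N" for n
  proof -
    define F where "F = (\<lambda>z. \<phi> n z * f z)"
    have F: "in_H a F" "H_norm a F \<le> H_norm a f"
      unfolding F_def using mult_bound_in_H[OF m f, of n] mult_bound_H_norm[OF m f, of n] by auto
    have p: "in_H a (kernel_comb S c)" by (rule in_H_kernel_comb[OF S])
    have "H_norm a (kernel_comb S c) \<le> H_norm a g + e"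
      using H_norm_triangle_diff[OF g p] d by simp
    then have b: "H_norm a F + H_norm a g + H_norm a F + H_norm a (kernel_comb S c) \<le> M"
      using F e unfolding M_def by linarith
    have "cmod (H_inner a F g - H_inner a F (kernel_comb S c))
        \<le> H_norm a (\<lambda>z. g z - kernel_comb S c z) * (H_norm a F + H_norm a g + H_norm a F + H_norm a (kernel_comb S c))"
      using H_inner_diff_le[OF F(1) g F(1) p] by (simp add: H_norm_zero)
    also have "\<dots> \<le> e * M"
      by (intro mult_mono d b add_nonneg_nonneg H_norm_nonneg F p g) (use e in auto)
    also have "\<dots> \<le> \<epsilon> / 2" by (rule e)
    finally have "cmod (H_inner a F g - H_inner a F (kernel_comb S c)) \<le> \<epsilon> / 2" .
    moreover have "cmod (H_inner a F (kernel_comb S c)) < \<epsilon> / 2"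
      unfolding H_inner_kernel_comb_right[OF F(1) S] unfolding F_def by (rule N[OF n])
    ultimately show ?thesis
      unfolding F_def[symmetric] using norm_triangle_ineq2[of "H_inner a F g" "H_inner a F (kernel_comb S c)"] by linarith
  qed
  then show "\<exists>N. \<forall>n\<ge>N. norm (H_inner a (\<lambda>z. \<phi> n z * f z) g - 0) < \<epsilon>" by auto
qed

lemma H_inner_mult_bound_le:
  assumes "mult_bound \<phi> C" "in_H a f" "in_H a g"
  shows "norm (H_inner a (\<lambda>z. \<phi> z * f z) g) \<le> 2 * C\<^sup>2 * (H_norm a f)\<^sup>2 + 2 * (H_norm a g)\<^sup>2"
proof -
  have "(H_norm a (\<lambda>z. \<phi> z * f z))\<^sup>2 \<le> (C * H_norm a f)\<^sup>2"
    by (intro power_mono mult_bound_H_norm H_norm_nonneg mult_bound_in_H[OF assms(1)] assms)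
  then show ?thesis using H_inner_le[OF mult_bound_in_H[OF assms(1,2)] assms(3)] by (simp add: power_mult_distrib)
qed

text \<open>Tannery's theorem: the common multiplier bound gives a summable majorant independent of
  \<open>n\<close>.\<close>

lemma suminf_H_inner_lim:
  assumes FG: "\<And>m. in_H a (F m)" "\<And>m. in_H a (G m)"
    and sF: "summable (\<lambda>m. (H_norm a (F m))\<^sup>2)" and sG: "summable (\<lambda>m. (H_norm a (G m))\<^sup>2)"
    and m: "\<And>n. mult_bound (\<phi> n) C"
    and lim: "\<And>m. (\<lambda>n. H_inner a (\<lambda>z. \<phi> n z * F m z) (G m)) \<longlonglongrightarrow> L m"
  shows "(\<lambda>n. \<Sum>m. H_inner a (\<lambda>z. \<phi> n z * F m z) (G m)) \<longlonglongrightarrow> suminf L"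
proof -
  have "summable (\<lambda>m. 2 * C\<^sup>2 * (H_norm a (F m))\<^sup>2 + 2 * (H_norm a (G m))\<^sup>2)"
    by (intro summable_add summable_mult sF sG)
  moreover have "\<forall>\<^sub>F (m, n) in sequentially \<times>\<^sub>F sequentially. norm (H_inner a (\<lambda>z. \<phi> n z * F m z) (G m))
      \<le> 2 * C\<^sup>2 * (H_norm a (F m))\<^sup>2 + 2 * (H_norm a (G m))\<^sup>2"
    using H_inner_mult_bound_le[OF m FG] by (intro always_eventually) auto
  ultimately show ?thesis
    using tannerys_theorem[where a = "\<lambda>m n. H_inner a (\<lambda>z. \<phi> n z * F m z) (G m)" and F = sequentially, OF lim]
    by simp
qed

text \<open>Both sides are continuous under polynomial approximation in multiplier norm. The
  indicator of the closed ball appears because \<phi> is unrestricted outside it and may fail to be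
  measurable, while \<nu> does not charge that region.\<close>

lemma Henkin_lim_poly:
  assumes \<nu>: "sphere_cmeasure \<nu> h"
    and FG: "\<And>m. in_H a (F m)" "\<And>m. in_H a (G m)"
    and sF: "summable (\<lambda>m. (H_norm a (F m))\<^sup>2)" and sG: "summable (\<lambda>m. (H_norm a (G m))\<^sup>2)"
    and eq: "\<And>p. cpoly p \<Longrightarrow> (LINT x|\<nu>. p x * h x) = (\<Sum>m. H_inner a (\<lambda>z. p z * F m z) (G m))"
    and \<phi>: "lim_poly \<phi>"
  shows "(\<lambda>x. indicator (cball 0 1) x *\<^sub>R \<phi> x) \<in> borel_measurable borel" (is ?meas)
    and "(LINT x|\<nu>. (indicator (cball 0 1) x *\<^sub>R \<phi> x) * h x) = (\<Sum>m. H_inner a (\<lambda>z. \<phi> z * F m z) (G m))" (is ?eq)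
proof -
  obtain C where C: "mult_bound \<phi> C" using \<phi> unfolding lim_poly_def by blast
  have "\<exists>p. cpoly p \<and> mult_bound (\<lambda>z. \<phi> z - p z) (1 / real (Suc l))" for l
    using \<phi> unfolding lim_poly_def by auto
  then obtain p where p: "\<And>l. cpoly (p l)" "\<And>l. mult_bound (\<lambda>z. \<phi> z - p l z) (1 / real (Suc l))" by metis
  have z: "(\<lambda>l. 1 / real (Suc l)) \<longlonglongrightarrow> 0" using LIMSEQ_inverse_real_of_nat by (simp add: inverse_eq_divide)
  have pm: "mult_bound (p l) (C + 1)" for l
  proof -
    have "mult_bound (\<lambda>z. \<phi> z - (\<phi> z - p l z)) (C + 1 / real (Suc l))" by (rule mult_bound_diff[OF C p(2)])
    then have "mult_bound (p l) (C + 1 / real (Suc l))" by simp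
    then show ?thesis by (rule mult_bound_mono) simp
  qed
  have pt: "(\<lambda>l. p l x) \<longlonglongrightarrow> \<phi> x" if "norm x \<le> 1" for x
  proof -
    have "(\<lambda>l. \<phi> x - p l x) \<longlonglongrightarrow> 0"
      by (rule Lim_null_comparison[OF _ z]) (use mult_boundD(2)[OF p(2) that] in auto)
    from tendsto_diff[OF tendsto_const[of "\<phi> x"] this] show ?thesis by simp
  qed
  have sets: "sets \<nu> = sets borel" and fin: "finite_measure \<nu>" and h: "integrable \<nu> h"
    and null: "emeasure \<nu> (UNIV - unit_sphere) = 0"
    using \<nu> by (auto simp: sphere_cmeasure_def)
  have pmeas: "(\<lambda>x. indicator (cball 0 1) x *\<^sub>R p l x) \<in> borel_measurable borel" for l
    by (intro borel_measurable_continuous_on_indicator continuous_on_cpoly p) auto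
  show meas: ?meas
    by (rule borel_measurable_LIMSEQ_metric[OF pmeas]) (auto intro: pt split: split_indicator)
  have us: "UNIV - unit_sphere \<in> sets (borel :: (complex^'a) measure)"
  proof -
    have "closed (unit_sphere :: (complex^'a) set)" unfolding unit_sphere_def
      by (intro closed_Collect_eq continuous_intros)
    then show ?thesis by auto
  qed
  have AE: "AE x in \<nu>. norm x = 1"
    by (rule AE_I[OF _ null]) (use us sets in \<open>auto simp: unit_sphere_def\<close>)
  have bm: "f \<in> borel_measurable \<nu>" if "f \<in> borel_measurable borel" for f :: "complex^'a \<Rightarrow> complex"
    using that measurable_cong_sets[OF sets refl] by blast
  have "(\<lambda>l. LINT x|\<nu>. p l x * h x) \<longlonglongrightarrow> (LINT x|\<nu>. (indicator (cball 0 1) x *\<^sub>R \<phi> x) * h x)"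
  proof (rule integral_dominated_convergence[where w = "\<lambda>x. (C + 1) * cmod (h x)"])
    show "(\<lambda>x. (indicator (cball 0 1) x *\<^sub>R \<phi> x) * h x) \<in> borel_measurable \<nu>"
      using bm[OF meas] borel_measurable_integrable[OF h] by (rule borel_measurable_times)
    show "(\<lambda>x. p l x * h x) \<in> borel_measurable \<nu>" for l
      using bm[OF borel_measurable_continuous_onI[OF continuous_on_cpoly[OF p(1)]]] borel_measurable_integrable[OF h]
      by (rule borel_measurable_times)
    show "integrable \<nu> (\<lambda>x. (C + 1) * cmod (h x))" using h by simp
    show "AE x in \<nu>. (\<lambda>l. p l x * h x) \<longlonglongrightarrow> (indicator (cball 0 1) x *\<^sub>R \<phi> x) * h x"
      using AE by eventually_elim (auto intro!: tendsto_mult pt)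
    show "AE x in \<nu>. norm (p l x * h x) \<le> (C + 1) * cmod (h x)" for l
      using AE by eventually_elim (use mult_boundD(2)[OF pm] in \<open>auto simp: norm_mult intro!: mult_right_mono\<close>)
  qed
  moreover have "(\<lambda>l. \<Sum>m. H_inner a (\<lambda>z. p l z * F m z) (G m)) \<longlonglongrightarrow> (\<Sum>m. H_inner a (\<lambda>z. \<phi> z * F m z) (G m))"
  proof (rule suminf_H_inner_lim[OF FG sF sG pm])
    fix m
    define D where "D = (C + 1) * H_norm a (F m) + C * H_norm a (F m) + 2 * H_norm a (G m)"
    have "(\<lambda>l. H_inner a (\<lambda>z. p l z * F m z) (G m) - H_inner a (\<lambda>z. \<phi> z * F m z) (G m)) \<longlonglongrightarrow> 0"
    proof (rule Lim_null_comparison)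
      show "(\<lambda>l. 1 / real (Suc l) * (H_norm a (F m) * D)) \<longlonglongrightarrow> 0"
        using tendsto_mult_right[OF z, of "H_norm a (F m) * D"] by simp
      have "norm (H_inner a (\<lambda>z. p l z * F m z) (G m) - H_inner a (\<lambda>z. \<phi> z * F m z) (G m))
        \<le> 1 / real (Suc l) * (H_norm a (F m) * D)" for l
      proof -
        have i1: "in_H a (\<lambda>z. p l z * F m z)" and i2: "in_H a (\<lambda>z. \<phi> z * F m z)"
          by (rule mult_bound_in_H[OF pm FG(1)], rule mult_bound_in_H[OF C FG(1)])
        have "H_norm a (\<lambda>z. p l z * F m z - \<phi> z * F m z) = H_norm a (\<lambda>z. (-1) * ((\<phi> z - p l z) * F m z))"
          by (simp add: algebra_simps)
        also have "\<dots> = H_norm a (\<lambda>z. (\<phi> z - p l z) * F m z)"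
          using H_norm_scale[OF mult_bound_in_H[OF p(2) FG(1)], of "-1"] by simp
        also have "\<dots> \<le> 1 / real (Suc l) * H_norm a (F m)" by (rule mult_bound_H_norm[OF p(2) FG(1)])
        finally have 1: "H_norm a (\<lambda>z. p l z * F m z - \<phi> z * F m z) \<le> 1 / real (Suc l) * H_norm a (F m)" .
        have 2: "H_norm a (\<lambda>z. p l z * F m z) + H_norm a (G m) + H_norm a (\<lambda>z. \<phi> z * F m z) + H_norm a (G m) \<le> D"
          unfolding D_def using mult_bound_H_norm[OF pm FG(1), of l m] mult_bound_H_norm[OF C FG(1), of m] by simp
        have "norm (H_inner a (\<lambda>z. p l z * F m z) (G m) - H_inner a (\<lambda>z. \<phi> z * F m z) (G m))
          \<le> H_norm a (\<lambda>z. p l z * F m z - \<phi> z * F m z)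
            * (H_norm a (\<lambda>z. p l z * F m z) + H_norm a (G m) + H_norm a (\<lambda>z. \<phi> z * F m z) + H_norm a (G m))"
          using H_inner_diff_le[OF i1 FG(2) i2 FG(2), of m m] by (simp add: H_norm_zero)
        also have "\<dots> \<le> (1 / real (Suc l) * H_norm a (F m)) * D"
          by (intro mult_mono 1 2 add_nonneg_nonneg H_norm_nonneg i1 i2 FG mult_nonneg_nonneg) auto
        finally show ?thesis by (simp add: mult.assoc)
      qed
      then show "\<forall>\<^sub>F l in sequentially. norm (H_inner a (\<lambda>z. p l z * F m z) (G m) - H_inner a (\<lambda>z. \<phi> z * F m z) (G m))
        \<le> 1 / real (Suc l) * (H_norm a (F m) * D)" by (intro always_eventually allI)
    qed
    then show "(\<lambda>l. H_inner a (\<lambda>z. p l z * F m z) (G m)) \<longlonglongrightarrow> H_inner a (\<lambda>z. \<phi> z * F m z) (G m)"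
      by (rule LIM_zero_cancel)
  qed
  ultimately show ?eq using eq[OF p(1)] LIMSEQ_unique by simp
qed

text \<open>The shift s = sqrt e, with e the energy, separates two scales: on \<open>E\<close> the
  real part of the potential is at least e - 1, large compared with s, and at a point off
  \<open>E\<close> all potentials are bounded by one constant, small compared with s.\<close>

lemma capacity_zero_peak:
  assumes cz: "capacity_zero E" and E: "compact E" "E \<subseteq> unit_sphere" "E \<noteq> {}"
  obtains \<phi> :: "nat \<Rightarrow> complex^'d \<Rightarrow> complex" where
    "\<And>n. mult_bound (\<phi> n) 1" "\<And>n. lim_poly (\<phi> n)"
    "\<And>z. norm z \<le> 1 \<Longrightarrow> (\<lambda>n. \<phi> n z) \<longlonglongrightarrow> indicator E z"
proof -
  have "\<exists>t S c. 0 < t \<and> t < 1 \<and> weight E S c \<and> real n + 2 \<le> energy S c t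
      \<and> (\<forall>x\<in>E. energy S c t - 1 \<le> Re (potential S c t x))" for n
    using capacity_zero_potential[OF cz E(2,3), of "real n + 2"] by metis
  then obtain t S c where t: "\<And>n. 0 < t n" "\<And>n. t n < 1" and w: "\<And>n. weight E (S n) (c n)"
    and e: "\<And>n. real n + 2 \<le> energy (S n) (c n) (t n)"
    and p: "\<And>n x. x \<in> E \<Longrightarrow> energy (S n) (c n) (t n) - 1 \<le> Re (potential (S n) (c n) (t n) x)"
    by metis
  define s where "s n = sqrt (energy (S n) (c n) (t n))" for n
  have s2: "s n * s n = energy (S n) (c n) (t n)" for n using e[of n] by (simp add: s_def)
  have s1: "1 \<le> s n" for n using e[of n] by (simp add: s_def)
  have s0: "0 < s n" for n using s1[of n] by simp
  have sinv: "(\<lambda>n. 1 / s n) \<longlonglongrightarrow> 0"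
  proof -
    have "filterlim s at_top sequentially"
      unfolding s_def
    proof (rule filterlim_compose[OF sqrt_at_top], rule filterlim_at_top_mono[OF filterlim_real_sequentially])
      have "real n \<le> energy (S n) (c n) (t n)" for n using e[of n] by simp
      then show "\<forall>\<^sub>F n in sequentially. real n \<le> energy (S n) (c n) (t n)" by (intro always_eventually allI)
    qed
    then show ?thesis using tendsto_inverse_0_at_top[of s] by (simp add: inverse_eq_divide)
  qed
  have ws: "weight unit_sphere (S n) (c n)" for n using w[of n] E(2) by (auto simp: weight_def)
  define f where "f n = potential (S n) (c n) (t n)" for n
  define \<phi> where "\<phi> n z = f n z / (f n z + of_real (s n))" for n z
  have re: "0 \<le> Re (f n z)" if "norm z \<le> 1" for n z
    unfolding f_def by (rule Re_potential_nonneg[OF ws _ t(2) that]) (use t[of n] in simp)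
  show ?thesis
  proof (rule that[of \<phi>])
    show "mult_bound (\<phi> n) 1" "lim_poly (\<phi> n)" for n
      unfolding \<phi>_def f_def using mult_bound_cayley[OF ws t s0] by auto
    fix z :: "complex^'d" assume z: "norm z \<le> 1"
    show "(\<lambda>n. \<phi> n z) \<longlonglongrightarrow> indicator E z"
    proof (cases "z \<in> E")
      case True
      have "norm (\<phi> n z - 1) \<le> 1 / s n" for n
      proof -
        \<comment> \<open>Here e - 1 + s \<ge> e = s^2, because s \<ge> 1.\<close>
        have "s n * s n \<le> Re (f n z + of_real (s n))"
          using p[OF True, of n] s1[of n] unfolding s2 f_def by simp
        also have "\<dots> \<le> cmod (f n z + of_real (s n))" by (rule complex_Re_le_cmod)
        finally have le: "s n * s n \<le> cmod (f n z + of_real (s n))" .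
        then have "0 < cmod (f n z + of_real (s n))" using s0[of n] by (smt (verit) mult_pos_pos)
        then have nz: "f n z + of_real (s n) \<noteq> 0" by simp
        then have "\<phi> n z - 1 = - of_real (s n) / (f n z + of_real (s n))"
          unfolding \<phi>_def by (simp add: field_simps)
        then have "norm (\<phi> n z - 1) = s n / cmod (f n z + of_real (s n))"
          using s0[of n] by (simp add: norm_divide)
        also have "\<dots> \<le> s n / (s n * s n)"
          using le s0[of n] by (intro divide_left_mono) (auto intro!: mult_pos_pos simp: \<open>0 < cmod (f n z + of_real (s n))\<close> nz)
        finally show ?thesis using s0[of n] by simp
      qed
      then have "(\<lambda>n. \<phi> n z - 1) \<longlonglongrightarrow> 0" by (intro Lim_null_comparison[OF _ sinv]) auto
      then show ?thesis using True by (simp add: LIM_zero_cancel)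
    next
      case False
      define d where "d = min 1 ((infdist z E)\<^sup>2 / 2)"
      have "0 < infdist z E"
        using False E in_closed_iff_infdist_zero[OF compact_imp_closed[OF E(1)] E(3)] infdist_nonneg[of z E]
        by (metis order_le_less)
      then have d: "0 < d" "d \<le> 1" by (auto simp: d_def)
      have dx: "d \<le> (norm (z - x))\<^sup>2 / 2" if "x \<in> E" for x
      proof -
        have "(infdist z E)\<^sup>2 \<le> (norm (z - x))\<^sup>2"
          using infdist_le[OF that, of z] infdist_nonneg[of z E] by (intro power_mono) (auto simp: dist_norm)
        then show ?thesis by (simp add: d_def min_def)
      qed
      define D where "D = 1 / (b 1 * d)"
      have fD: "cmod (f n z) \<le> D" for n
        unfolding f_def
      proof (rule norm_potential_le[OF w E(2) z])
        show "cmod (K z (t n *\<^sub>R x)) \<le> D" if "x \<in> E" for x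
          unfolding D_def
          by (rule norm_K_dilation_le[OF z _ _ _ d(1,2) dx[OF that]])
             (use that E(2) t[of n] in \<open>auto simp: unit_sphere_def\<close>)
      qed (use t[of n] in auto)
      have "norm (\<phi> n z) \<le> D * (1 / s n)" for n
      proof -
        have "s n \<le> Re (f n z + of_real (s n))" using re[OF z, of n] by simp
        also have "\<dots> \<le> cmod (f n z + of_real (s n))" by (rule complex_Re_le_cmod)
        finally have "s n \<le> cmod (f n z + of_real (s n))" .
        then have "cmod (f n z) / cmod (f n z + of_real (s n)) \<le> D / s n"
          using fD[of n] s0[of n] order_trans[OF norm_ge_zero fD[of n]] by (intro frac_le) auto
        then show ?thesis by (simp add: \<phi>_def norm_divide)
      qed
      then have "(\<lambda>n. \<phi> n z) \<longlonglongrightarrow> 0"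
        by (intro Lim_null_comparison[OF _ tendsto_mult_right_zero[OF sinv, of D]]) auto
      then show ?thesis using False by simp
    qed
  qed
qed

text \<open>The multipliers of \<open>capacity_zero_peak\<close> tend to 0 on the open ball, so the
  Henkin functional tends to 0 along them, while their integrals tend to that of the density over Q.
  All compact Q in \<open>E\<close> are treated since one vanishing integral of a complex density
  does not control its modulus.\<close>

lemma capacity_zero_totally_null:
  fixes E :: "(complex^'d) set"
  assumes cz: "capacity_zero E" and E: "compact E" "E \<subseteq> unit_sphere"
  shows "totally_null a E"
  unfolding totally_null_def
proof (intro conjI allI impI E)
  show Eb: "E \<in> sets borel" by (rule borel_compact[OF E(1)])
  fix \<nu> :: "(complex^'d) measure" and h assume "Henkin a \<nu> h"
  then obtain F G where \<nu>: "sphere_cmeasure \<nu> h" and FG: "\<And>m. in_H a (F m)" "\<And>m. in_H a (G m)"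
    and sF: "summable (\<lambda>m. (H_norm a (F m))\<^sup>2)" and sG: "summable (\<lambda>m. (H_norm a (G m))\<^sup>2)"
    and eq: "\<And>p. cpoly p \<Longrightarrow> (LINT x|\<nu>. p x * h x) = (\<Sum>m. H_inner a (\<lambda>z. p z * F m z) (G m))"
    unfolding Henkin_def by blast
  have sets: "sets \<nu> = sets borel" and fin: "finite_measure \<nu>" and h: "integrable \<nu> h"
    using \<nu> by (auto simp: sphere_cmeasure_def)
  have "(LINT x|\<nu>. indicator Q x *\<^sub>R h x) = 0" if Q: "compact Q" "Q \<subseteq> E" for Q
  proof (cases "Q = {}")
    case False
    obtain \<phi> where m: "\<And>n. mult_bound (\<phi> n) 1" and l: "\<And>n. lim_poly (\<phi> n)"
      and pt: "\<And>z. norm z \<le> 1 \<Longrightarrow> (\<lambda>n. \<phi> n z) \<longlonglongrightarrow> indicator Q z"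
      using capacity_zero_peak[OF capacity_zero_subset[OF cz Q(2)] Q(1) order_trans[OF Q(2) E(2)] False] by blast
    note HL = Henkin_lim_poly[OF \<nu> FG sF sG eq l]
    have bm: "f \<in> borel_measurable \<nu>" if "f \<in> borel_measurable borel" for f :: "complex^'d \<Rightarrow> complex"
      using that measurable_cong_sets[OF sets refl] by blast
    have Qsub: "Q \<subseteq> cball 0 1" using Q E(2) by (auto simp: unit_sphere_def)
    have l1: "(\<lambda>n. LINT x|\<nu>. (indicator (cball 0 1) x *\<^sub>R \<phi> n x) * h x) \<longlonglongrightarrow> (LINT x|\<nu>. indicator Q x *\<^sub>R h x)"
    proof (rule integral_dominated_convergence[where w = "\<lambda>x. cmod (h x)"])
      have "Q \<in> sets \<nu>" using borel_compact[OF Q(1)] sets by simp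
      from integrable_mult_indicator[OF this h]
      show "(\<lambda>x. indicator Q x *\<^sub>R h x) \<in> borel_measurable \<nu>" by (rule borel_measurable_integrable)
      show "(\<lambda>x. (indicator (cball 0 1) x *\<^sub>R \<phi> n x) * h x) \<in> borel_measurable \<nu>" for n
        using bm[OF HL(1)] borel_measurable_integrable[OF h] by (rule borel_measurable_times)
      show "integrable \<nu> (\<lambda>x. cmod (h x))" using h by simp
      have "(\<lambda>n. (indicator (cball 0 1) x *\<^sub>R \<phi> n x) * h x) \<longlonglongrightarrow> indicator Q x *\<^sub>R h x" for x
      proof (cases "norm x \<le> 1")
        case True
        then show ?thesis using tendsto_mult[OF pt[OF True] tendsto_const[of "h x"]]
          by (simp add: scaleR_conv_of_real of_real_indicator)
      qed (use Qsub in \<open>auto split: split_indicator\<close>)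
      then show "AE x in \<nu>. (\<lambda>n. (indicator (cball 0 1) x *\<^sub>R \<phi> n x) * h x) \<longlonglongrightarrow> indicator Q x *\<^sub>R h x" by simp
      show "AE x in \<nu>. norm ((indicator (cball 0 1) x *\<^sub>R \<phi> n x) * h x) \<le> cmod (h x)" for n
        using mult_boundD(2)[OF m] by (auto simp: norm_mult mult_left_le_one_le split: split_indicator)
    qed
    have l2: "(\<lambda>n. \<Sum>i. H_inner a (\<lambda>z. \<phi> n z * F i z) (G i)) \<longlonglongrightarrow> (\<Sum>i. 0)"
    proof (rule suminf_H_inner_lim[OF FG sF sG m], rule H_inner_weak_null[OF m _ FG])
      fix z :: "complex^'d" assume "z \<in> open_ball"
      then have "norm z \<le> 1" "z \<notin> Q" using Q E(2) by (auto simp: open_ball_def unit_sphere_def)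
      then show "(\<lambda>n. \<phi> n z) \<longlonglongrightarrow> 0" using pt[of z] by simp
    qed
    have "(\<lambda>n. LINT x|\<nu>. (indicator (cball 0 1) x *\<^sub>R \<phi> n x) * h x) = (\<lambda>n. \<Sum>i. H_inner a (\<lambda>z. \<phi> n z * F i z) (G i))"
      by (rule ext) (rule HL(2))
    then show ?thesis using LIMSEQ_unique[OF l1] l2 by simp
  qed simp
  then have "AE x in \<nu>. x \<in> E \<longrightarrow> h x = 0"
    by (rule AE_zero_if_compact_integrals_zero[OF sets fin h Eb])
  then have "(\<integral>\<^sup>+x\<in>E. ennreal (cmod (h x)) \<partial>\<nu>) = (\<integral>\<^sup>+x. 0 \<partial>\<nu>)"
    by (intro nn_integral_cong_AE) (auto split: split_indicator elim!: eventually_mono)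
  then show "(\<integral>\<^sup>+x\<in>E. ennreal (cmod (h x)) \<partial>\<nu>) = 0" by simp
qed

end

section \<open>Sets of positive capacity\<close>

lemma bform_sum_kernel: "bform S (\<lambda>z v. \<Sum>i\<in>I. k i z v) c d = (\<Sum>i\<in>I. bform S (k i) c d)"
  by (induction I rule: infinite_finite_induct) (simp_all add: bform_add_kernel, simp_all add: bform_def)

lemma radii_tendsto: "(\<lambda>n. 1 - 1 / real (n + 2)) \<longlonglongrightarrow> 1"
proof -
  have "(\<lambda>n. 1 / real (n + 2)) \<longlonglongrightarrow> 0"
    using LIMSEQ_ignore_initial_segment[OF lim_1_over_n, of 2] by simp
  from tendsto_diff[OF tendsto_const[of 1] this] show ?thesis by simp
qed

context pick_space begin

text \<open>|f(w) - f(z)| is at most \<open>C\<close> times the norm of K(.,w) - K(.,z), and the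
  square of that norm is continuous in w and vanishes at w = z.\<close>

lemma H_bound_continuous:
  assumes f: "H_bound a f C" shows "continuous_on open_ball (f :: complex^'d \<Rightarrow> complex)"
  unfolding continuous_on
proof
  fix z :: "complex^'d" assume z: "z \<in> open_ball"
  define \<phi> where "\<phi> w = Re (K z z) - 2 * Re (K w z) + Re (K w w)" for w
  have "continuous_on open_ball \<phi>"
    unfolding \<phi>_def K_eq
    by (intro continuous_intros) (use z in \<open>auto intro: norm_cinner_less simp: open_ball_def\<close>)
  then have "(\<phi> \<longlongrightarrow> \<phi> z) (at z within open_ball)" using z unfolding continuous_on by (rule bspec)
  then have "((\<lambda>w. C * sqrt (\<phi> w)) \<longlongrightarrow> C * sqrt (\<phi> z)) (at z within open_ball)" by (intro tendsto_intros)
  then have lim: "((\<lambda>w. C * sqrt (\<phi> w)) \<longlongrightarrow> 0) (at z within open_ball)" by (simp add: \<phi>_def)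
  have "cmod (f w - f z) \<le> C * sqrt (\<phi> w)" if w: "w \<in> open_ball" "w \<noteq> z" for w
  proof -
    define c where "c x = (if x = w then 1 else -1 :: complex)" for x
    have zw: "K z w = cnj (K w z)" using z w by (intro K_commute) (auto simp: open_ball_def)
    have "pairing {w, z} c f = f w - f z" using w by (simp add: pairing_def c_def)
    moreover have "En {w, z} c = \<phi> w" using w zw by (simp add: En_def bform_def c_def \<phi>_def)
    ultimately show ?thesis using H_boundD(1)[OF f, of "{w, z}" c] z w by simp
  qed
  then have "\<forall>\<^sub>F w in at z within open_ball. norm (f w - f z) \<le> C * sqrt (\<phi> w)"
    by (simp add: eventually_at_filter)
  then have "((\<lambda>w. f w - f z) \<longlongrightarrow> 0) (at z within open_ball)" by (rule Lim_null_comparison[OF _ lim])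
  then show "(f \<longlongrightarrow> f z) (at z within open_ball)" by (rule LIM_zero_cancel)
qed

text \<open>One energy bound works for all the dilations 1 - 1/(k+2), and weak compactness extracts
  the measure. Raising the bound to at least 1 makes it usable as a divisor.\<close>

lemma not_capacity_zero_limit:
  assumes ncz: "\<not> capacity_zero E" and E: "compact E" "E \<subseteq> unit_sphere"
  obtains M S c t \<mu> where "1 \<le> M" "\<And>k::nat. weight E (S k) (c k)" "\<And>k. 0 < t k" "\<And>k. t k < 1" "t \<longlonglongrightarrow> 1"
    "\<And>k. energy (S k) (c k) (t k) \<le> M"
    "prob_space \<mu>" "sets \<mu> = sets borel" "AE x in \<mu>. x \<in> E"
    "\<And>q :: complex^'d \<Rightarrow> complex. continuous_on E q \<Longrightarrow>
      (\<lambda>k. \<Sum>x\<in>S k. of_real (c k x) * q x) \<longlonglongrightarrow> (LINT x|\<mu>. indicator E x *\<^sub>R q x)"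
proof -
  obtain M0 where M0: "\<And>t. 0 < t \<Longrightarrow> t < 1 \<Longrightarrow> \<exists>S c. weight E S c \<and> energy S c t < M0"
    using ncz unfolding capacity_zero_def by (auto simp: not_le)
  define t where "t k = 1 - 1 / real (k + 2)" for k
  have t01: "0 < t k" "t k < 1" for k by (auto simp: t_def)
  have tl: "t \<longlonglongrightarrow> 1" unfolding t_def[abs_def] by (rule radii_tendsto)
  obtain S c where w: "\<And>k. weight E (S k) (c k)" and e: "\<And>k. energy (S k) (c k) (t k) < M0"
  proof -
    have "\<forall>k. \<exists>S c. weight E S c \<and> energy S c (t k) < M0" using M0[OF t01] by blast
    then show ?thesis using that by metis
  qed
  obtain r :: "nat \<Rightarrow> nat" and \<mu> where r: "strict_mono r" and \<mu>: "prob_space \<mu>" "sets \<mu> = sets borel" "AE x in \<mu>. x \<in> E"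
    and conv: "\<And>q :: complex^'d \<Rightarrow> complex. continuous_on E q \<Longrightarrow>
      (\<lambda>k. \<Sum>x\<in>S (r k). of_real (c (r k) x) * q x) \<longlonglongrightarrow> (LINT x|\<mu>. indicator E x *\<^sub>R q x)"
    using weight_weak_limit[where S = S and c = c, OF E(1) w] by blast
  show ?thesis
  proof (rule that[of "max 1 M0" "S \<circ> r" "c \<circ> r" "t \<circ> r" \<mu>])
    show "(t \<circ> r) \<longlonglongrightarrow> 1" by (rule LIMSEQ_subseq_LIMSEQ[OF tl r])
    show "energy ((S \<circ> r) k) ((c \<circ> r) k) ((t \<circ> r) k) \<le> max 1 M0" for k
      using e[of "r k"] by simp
  qed (use w t01 \<mu> conv in auto)
qed

lemma dominated_convergence_compact:
  fixes q :: "nat \<Rightarrow> complex^'d \<Rightarrow> complex"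
  assumes E: "compact E" and \<mu>: "prob_space \<mu>" "sets \<mu> = sets borel"
    and q: "\<And>n. continuous_on E (q n)" "continuous_on E q0"
    and bd: "\<And>n x. x \<in> E \<Longrightarrow> cmod (q n x) \<le> C" and lim: "\<And>x. x \<in> E \<Longrightarrow> (\<lambda>n. q n x) \<longlonglongrightarrow> q0 x"
  shows "(\<lambda>n. LINT x|\<mu>. indicator E x *\<^sub>R q n x) \<longlonglongrightarrow> (LINT x|\<mu>. indicator E x *\<^sub>R q0 x)"
proof -
  interpret prob_space \<mu> by (rule \<mu>)
  have meas: "(\<lambda>x. indicator E x *\<^sub>R g x) \<in> borel_measurable \<mu>" if "continuous_on E g" for g :: "complex^'d \<Rightarrow> complex"
    using borel_measurable_continuous_on_indicator[OF borel_compact[OF E] that] measurable_cong_sets[OF \<mu>(2) refl] by blast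
  show ?thesis
  proof (rule integral_dominated_convergence[where w = "\<lambda>x. \<bar>C\<bar>"])
    show "AE x in \<mu>. (\<lambda>n. indicator E x *\<^sub>R q n x) \<longlonglongrightarrow> indicator E x *\<^sub>R q0 x"
      using lim by (auto split: split_indicator)
    show "AE x in \<mu>. norm (indicator E x *\<^sub>R q n x) \<le> \<bar>C\<bar>" for n
      using order_trans[OF bd abs_ge_self] by (auto split: split_indicator)
  qed (use meas q in auto)
qed

lemma dilated_weight_sum:
  fixes S :: "(complex^'d) set"
  assumes "0 < u"
  shows "pairing ((*\<^sub>R) u ` S) (\<lambda>y. of_real (c (y /\<^sub>R u))) q = (\<Sum>x\<in>S. of_real (c x) * q (u *\<^sub>R x))"
  unfolding pairing_def using assms by (subst sum.reindex) (auto simp: inj_on_def)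

text \<open>The representing function is the potential g(z) of \<mu>, the integral of K(z,x) over x.
  The identity I p = <p,g> exhibits the Henkin functional as the single term with F = 1 and G = g,
  although \<mu> is carried by \<open>E\<close>.\<close>

lemma totally_null_capacity_zero:
  fixes E :: "(complex^'d) set"
  assumes E: "compact E" "E \<subseteq> unit_sphere" and tn: "totally_null a E"
  shows "capacity_zero E"
proof (rule ccontr)
  assume "\<not> capacity_zero E"
  then obtain M S c t \<mu> where M: "1 \<le> M" and w: "\<And>k::nat. weight E (S k) (c k)"
    and t: "\<And>k. 0 < t k" "\<And>k. t k < 1" "t \<longlonglongrightarrow> 1" and e: "\<And>k. energy (S k) (c k) (t k) \<le> M"
    and \<mu>: "prob_space \<mu>" "sets \<mu> = sets borel" "AE x in \<mu>. x \<in> E"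
    and conv: "\<And>q :: complex^'d \<Rightarrow> complex. continuous_on E q \<Longrightarrow>
      (\<lambda>k. \<Sum>x\<in>S k. of_real (c k x) * q x) \<longlonglongrightarrow> (LINT x|\<mu>. indicator E x *\<^sub>R q x)"
    using not_capacity_zero_limit[OF _ E] by blast
  interpret prob_space \<mu> by (rule \<mu>)
  define I where "I q = (LINT x|\<mu>. indicator E x *\<^sub>R q x)" for q :: "complex^'d \<Rightarrow> complex"
  have nE: "norm x = 1" if "x \<in> E" for x using that E by (auto simp: unit_sphere_def)
  have Sk: "finite (S k)" "S k \<subseteq> unit_sphere" for k using w[of k] E by (auto simp: weight_def)
  define u where "u n = 1 - 1 / real (n + 2)" for n
  have u: "0 < u n" "u n < 1" for n by (auto simp: u_def)
  have ul: "u \<longlonglongrightarrow> 1" unfolding u_def[abs_def] by (rule radii_tendsto)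
  \<comment> \<open>Once t k exceeds u n, monotonicity passes the bound \<open>M\<close> down to the
    energy at u n u n, the squared norm of the potential with poles u n x.\<close>
  have ev: "\<exists>k0. \<forall>k\<ge>k0. energy (S k) (c k) (u n * u n) \<le> M" for n
  proof -
    obtain k0 where k0: "\<And>k. k \<ge> k0 \<Longrightarrow> u n < t k"
      using order_tendstoD(1)[OF t(3) u(2)[of n]] by (auto simp: eventually_sequentially)
    have "energy (S k) (c k) (u n * u n) \<le> M" if "k \<ge> k0" for k
    proof -
      have "u n * u n \<le> u n" using u[of n] by (simp add: mult_left_le)
      then have "u n * u n \<le> t k" using k0[OF that] by simp
      then have "energy (S k) (c k) (u n * u n) \<le> energy (S k) (c k) (t k)"
        by (intro energy_mono Sk t) (use u[of n] in auto)
      then show ?thesis using e[of k] by simp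
    qed
    then show ?thesis by blast
  qed
  define g where "g z = I (K z)" for z
  have Kc: "continuous_on E (\<lambda>x. K z (s *\<^sub>R x))" if "norm z < 1" "0 \<le> s" "s \<le> 1" for z s
    unfolding K_eq by (intro continuous_intros) (use that nE in \<open>auto intro!: norm_cinner_less(2)\<close>)
  have g: "H_bound a g (sqrt M)"
  proof (rule H_bound_lim)
    show "H_bound a (\<lambda>z. I (\<lambda>x. K z (u n *\<^sub>R x))) (sqrt M)" for n
    proof -
      obtain k0 where k0: "\<And>k. k \<ge> k0 \<Longrightarrow> energy (S k) (c k) (u n * u n) \<le> M" using ev by blast
      show ?thesis
      proof (rule H_bound_lim)
        show "H_bound a (potential (S (k + k0)) (c (k + k0)) (u n)) (sqrt M)" for k
          by (rule H_bound_mono[OF H_bound_potential[OF Sk u]]) (use k0[of "k + k0"] in simp)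
        show "(\<lambda>k. potential (S (k + k0)) (c (k + k0)) (u n) z) \<longlonglongrightarrow> I (\<lambda>x. K z (u n *\<^sub>R x))" if z: "z \<in> open_ball" for z
          unfolding potential_def I_def
          by (rule LIMSEQ_ignore_initial_segment[OF conv[OF Kc]]) (use z u[of n] in \<open>auto simp: open_ball_def\<close>)
      qed
    qed
    fix z :: "complex^'d" assume "z \<in> open_ball"
    then have z: "norm z < 1" by (simp add: open_ball_def)
    show "(\<lambda>n. I (\<lambda>x. K z (u n *\<^sub>R x))) \<longlonglongrightarrow> g z"
      unfolding g_def I_def
    proof (rule dominated_convergence_compact[OF E(1) \<mu>(1,2)])
      show "continuous_on E (\<lambda>x. K z (u n *\<^sub>R x))" for n using Kc[OF z] u[of n] by simp
      show "continuous_on E (K z)" using Kc[OF z, of 1] by simp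
      show "cmod (K z (u n *\<^sub>R x)) \<le> 1 / (b 1 * (1 - norm z))" if "x \<in> E" for n x
        unfolding K_eq
      proof (rule norm_A_le)
        have "cmod (cinner z (u n *\<^sub>R x)) \<le> norm z"
          using norm_cinner_le[of z "u n *\<^sub>R x"] nE[OF that] u[of n] mult_left_le[of "u n" "norm z"] by simp
        then show "cmod (cinner z (u n *\<^sub>R x)) < 1" "1 - norm z \<le> 1 - Re (cinner z (u n *\<^sub>R x))"
          using z complex_Re_le_cmod[of "cinner z (u n *\<^sub>R x)"] by auto
      qed (use z in simp)
      show "(\<lambda>n. K z (u n *\<^sub>R x)) \<longlonglongrightarrow> K z x" if "x \<in> E" for x
      proof -
        have "cmod (cinner z x) < 1" by (rule norm_cinner_less(2)[OF z]) (use nE[OF that] in simp)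
        moreover have "(\<lambda>n. of_real (u n) * cinner z x) \<longlonglongrightarrow> of_real 1 * cinner z x"
          by (intro tendsto_intros ul)
        ultimately have "(\<lambda>n. A (of_real (u n) * cinner z x)) \<longlonglongrightarrow> A (cinner z x)"
          by (intro isCont_tendsto_compose[OF isCont_A]) auto
        then show ?thesis by (simp add: K_eq cinner_scaleR_right)
      qed
    qed
  qed
  have gH: "in_H a g" using g unfolding in_H_def by blast
  \<comment> \<open>Integration against \<mu> is bounded by sqrt M in the norm of the space. This is
    how the energy bound controls I on functions that are not kernel combinations.\<close>
  have Ib: "cmod (I q) \<le> r * sqrt M" if q: "continuous_on (cball 0 1) q" "H_bound a q r" for q r
  proof (rule LIMSEQ_le_const2)
    have in1: "u n *\<^sub>R x \<in> cball 0 1" if "x \<in> E" for n x using nE[OF that] u[of n] by simp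
    have qc: "continuous_on E (\<lambda>x. q (u n *\<^sub>R x))" for n
      by (rule continuous_on_compose2[OF q(1)]) (use in1 in \<open>auto intro!: continuous_intros\<close>)
    obtain D where D: "\<And>x. x \<in> cball 0 1 \<Longrightarrow> cmod (q x) \<le> D"
      using compact_imp_bounded[OF compact_continuous_image[OF q(1) compact_cball]]
      unfolding bounded_iff ball_simps by blast
    show "(\<lambda>n. cmod (I (\<lambda>x. q (u n *\<^sub>R x)))) \<longlonglongrightarrow> cmod (I q)"
      unfolding I_def
    proof (rule tendsto_norm[OF dominated_convergence_compact[OF E(1) \<mu>(1,2) qc]])
      show "continuous_on E q" by (rule continuous_on_subset[OF q(1)]) (use nE in auto)
      show "cmod (q (u n *\<^sub>R x)) \<le> D" if "x \<in> E" for n x by (rule D[OF in1[OF that]])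
      show "(\<lambda>n. q (u n *\<^sub>R x)) \<longlonglongrightarrow> q x" if "x \<in> E" for x
      proof (rule continuous_on_tendsto_compose[OF q(1)])
        show "(\<lambda>n. u n *\<^sub>R x) \<longlonglongrightarrow> x" using tendsto_scaleR[OF ul tendsto_const[of x]] by simp
      qed (use nE[OF that] in1[OF that] in auto)
    qed
    have "cmod (I (\<lambda>x. q (u n *\<^sub>R x))) \<le> r * sqrt M" for n
    proof (rule LIMSEQ_le_const2[OF tendsto_norm[OF conv[OF qc[of n], folded I_def]]])
      obtain k0 where k0: "\<And>k. k \<ge> k0 \<Longrightarrow> energy (S k) (c k) (u n * u n) \<le> M" using ev by blast
      have "cmod (\<Sum>x\<in>S k. of_real (c k x) * q (u n *\<^sub>R x)) \<le> r * sqrt M" if "k \<ge> k0" for k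
      proof -
        have "cmod (\<Sum>x\<in>S k. of_real (c k x) * q (u n *\<^sub>R x)) \<le> r * sqrt (energy (S k) (c k) (u n * u n))"
          unfolding dilated_weight_sum[OF u(1), symmetric] En_dilation[OF u(1), symmetric]
          by (intro H_boundD(1)[OF q(2)] finite_imageI dilation_ball Sk) (use u[of n] in auto)
        also have "\<dots> \<le> r * sqrt M"
          using k0[OF that] H_boundD(2)[OF q(2)] by (intro mult_left_mono) auto
        finally show ?thesis .
      qed
      then show "\<exists>k0. \<forall>k\<ge>k0. norm (\<Sum>x\<in>S k. of_real (c k x) * q (u n *\<^sub>R x)) \<le> r * sqrt M" by blast
    qed
    then show "\<exists>N. \<forall>n\<ge>N. cmod (I (\<lambda>x. q (u n *\<^sub>R x))) \<le> r * sqrt M" by blast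
  qed
  have ii: "integrable \<mu> (\<lambda>x. indicator E x *\<^sub>R q x)" if q: "continuous_on E q" for q :: "complex^'d \<Rightarrow> complex"
  proof -
    obtain D where "\<And>x. x \<in> E \<Longrightarrow> cmod (q x) \<le> D"
      using compact_imp_bounded[OF compact_continuous_image[OF q E(1)]] unfolding bounded_iff by auto
    then have D: "cmod (indicator E x *\<^sub>R q x) \<le> \<bar>D\<bar>" for x by (auto split: split_indicator intro: order_trans[OF _ abs_ge_self])
    have "(\<lambda>x. indicator E x *\<^sub>R q x) \<in> borel_measurable \<mu>"
      using borel_measurable_continuous_on_indicator[OF borel_compact[OF E(1)] q] measurable_cong_sets[OF \<mu>(2) refl] by blast
    then show ?thesis using D by (intro integrable_const_bound[of _ "\<bar>D\<bar>"]) auto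
  qed
  have Isub: "I (\<lambda>x. p x - q x) = I p - I q" if "continuous_on E p" "continuous_on E q" for p q
    unfolding I_def by (subst Bochner_Integration.integral_diff[symmetric, OF ii[OF that(1)] ii[OF that(2)]])
      (simp add: scaleR_diff_right)
  have Iv: "H_inner a (kernel_comb T d) g = I (kernel_comb T d)" if T: "finite T" "T \<subseteq> open_ball" for T d
  proof -
    have Kx: "cnj (K x y) = K y x" "continuous_on E (K x)" if "x \<in> T" "y \<in> E" for x y
      using that T nE[OF that(2)] Kc[of x 1] K_commute[of y x] by (auto simp: open_ball_def subset_iff)
    have "H_inner a (kernel_comb T d) g = (\<Sum>x\<in>T. d x * cnj (I (K x)))"
      unfolding H_inner_kernel_comb_left[OF gH T] pairing_def g_def by simp
    also have "\<dots> = (\<Sum>x\<in>T. LINT y|\<mu>. d x * cnj (indicator E y *\<^sub>R K x y))"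
      unfolding I_def integral_mult_right_zero Bochner_Integration.integral_cnj ..
    also have "\<dots> = (LINT y|\<mu>. (\<Sum>x\<in>T. d x * cnj (indicator E y *\<^sub>R K x y)))"
      by (rule Bochner_Integration.integral_sum[symmetric])
         (use Kc[of _ 1] T in \<open>auto intro!: integrable_mult_right integrable_cnj ii simp: open_ball_def subset_iff simp del: complex_cnj_scaleR\<close>)
    also have "\<dots> = I (kernel_comb T d)"
      unfolding I_def kernel_comb_def using Kx
      by (intro Bochner_Integration.integral_cong refl) (auto split: split_indicator)
    finally show ?thesis .
  qed
  have Ip: "H_inner a p g = I p" if p: "cpoly p" for p
  proof -
    obtain C where "mult_bound p C" using mult_bound_cpoly[OF p] by blast
    then have pH: "in_H a p" using mult_bound_in_H[OF _ in_H_one, of p C] by simp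
    have pc: "continuous_on X p" for X by (rule continuous_on_cpoly[OF p])
    define Z where "Z = 2 * H_norm a p + 2 * H_norm a g + 1 + sqrt M"
    \<comment> \<open>One approximant serves both sides: its error is controlled in
      \<open>H_inner\<close> by the norm and in \<open>I\<close> by \<open>Ib\<close>.\<close>
    have "cmod (H_inner a p g - I p) \<le> \<epsilon> * Z" if \<epsilon>: "0 < \<epsilon>" "\<epsilon> < 1" for \<epsilon>
    proof -
      obtain T d where T: "finite T" "T \<subseteq> open_ball" and d: "H_norm a (\<lambda>z. p z - kernel_comb T d z) \<le> \<epsilon>"
        using kernel_comb_dense[OF pH \<epsilon>(1)] by blast
      define v where "v = kernel_comb T d"
      have vH: "in_H a v" unfolding v_def by (rule in_H_kernel_comb[OF T])
      have vc: "continuous_on (cball 0 1) v"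
        unfolding v_def kernel_comb_def using T by (intro continuous_intros continuous_on_K) (auto simp: open_ball_def)
      have cE: "continuous_on E v" by (rule continuous_on_subset[OF vc]) (use nE in auto)
      have hb: "H_bound a (\<lambda>z. p z - v z) \<epsilon>"
        using H_bound_mono[OF H_bound_H_norm[OF in_H_diff[OF pH vH]]] d by (simp add: v_def)
      have "cmod (I (\<lambda>z. p z - v z)) \<le> \<epsilon> * sqrt M"
        by (rule Ib[OF _ hb]) (intro continuous_intros pc vc)
      then have 1: "cmod (I p - I v) \<le> \<epsilon> * sqrt M" using Isub[OF pc cE] by simp
      have vn: "H_norm a v \<le> H_norm a p + \<epsilon>" using H_norm_triangle_diff[OF pH vH] d by (simp add: v_def)
      have "cmod (H_inner a p g - H_inner a v g) \<le> H_norm a (\<lambda>z. p z - v z) * (H_norm a p + H_norm a g + H_norm a v + H_norm a g)"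
        using H_inner_diff_le[OF pH gH vH gH] by (simp add: H_norm_zero)
      also have "\<dots> \<le> \<epsilon> * (2 * H_norm a p + 2 * H_norm a g + 1)"
        using d vn \<epsilon> unfolding v_def[symmetric]
        by (intro mult_mono add_nonneg_nonneg H_norm_nonneg pH gH vH) auto
      finally have 2: "cmod (H_inner a p g - H_inner a v g) \<le> \<epsilon> * (2 * H_norm a p + 2 * H_norm a g + 1)" .
      have "cmod (H_inner a p g - I p) \<le> cmod (H_inner a p g - H_inner a v g) + cmod (I p - I v)"
        using norm_triangle_ineq4[of "H_inner a p g - H_inner a v g" "I p - I v"] Iv[OF T, of d] by (simp add: v_def)
      also have "\<dots> \<le> \<epsilon> * Z" using 1 2 by (simp add: Z_def algebra_simps)
      finally show ?thesis .
    qed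
    then have le: "\<forall>\<^sub>F \<epsilon> in at_right (0::real). cmod (H_inner a p g - I p) \<le> \<epsilon> * Z"
      using eventually_at_right_real[of 0 1] by (auto elim!: eventually_mono)
    have "((\<lambda>\<epsilon>. \<epsilon> * Z) \<longlongrightarrow> 0 * Z) (at_right 0)" by (intro tendsto_intros)
    from tendsto_lowerbound[OF this le] show ?thesis by simp
  qed
  define F where "F n = (if n = 0 then (\<lambda>z. 1) else (\<lambda>z. 0) :: complex^'d \<Rightarrow> complex)" for n :: nat
  define G where "G n = (if n = 0 then g else (\<lambda>z. 0))" for n :: nat
  have "Henkin a \<mu> (\<lambda>_. 1)"
    unfolding Henkin_def
  proof (rule conjI[rotated], rule exI[of _ F], rule exI[of _ G], intro conjI allI impI)
    show "sphere_cmeasure \<mu> (\<lambda>_. 1)"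
      unfolding sphere_cmeasure_def
    proof (intro conjI \<mu>(2) finite_measure_axioms)
      have "closed (unit_sphere :: (complex^'d) set)" unfolding unit_sphere_def
        by (intro closed_Collect_eq continuous_intros)
      then have "UNIV - unit_sphere \<in> sets \<mu>" unfolding \<mu>(2) by auto
      moreover have "AE x in \<mu>. x \<notin> UNIV - unit_sphere" using \<mu>(3) by eventually_elim (use E in auto)
      moreover have "{x \<in> space \<mu>. \<not> x \<notin> UNIV - unit_sphere} = UNIV - unit_sphere"
        using sets_eq_imp_space_eq[OF \<mu>(2)] by auto
      ultimately show "emeasure \<mu> (UNIV - unit_sphere) = 0"
        using AE_iff_measurable[of "UNIV - unit_sphere" \<mu> "\<lambda>x. x \<notin> UNIV - unit_sphere"] by blast
    qed simp
    show "in_H a (F n)" "in_H a (G n)" for n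
      using in_H_one in_H_zero gH by (auto simp: F_def G_def)
    show "summable (\<lambda>n. (H_norm a (F n))\<^sup>2)" "summable (\<lambda>n. (H_norm a (G n))\<^sup>2)"
      by (rule summable_finite[of "{0}"]; simp add: F_def G_def H_norm_zero)+
    fix p :: "complex^'d \<Rightarrow> complex" assume p: "cpoly p"
    have "(\<Sum>n. H_inner a (\<lambda>z. p z * F n z) (G n)) = (\<Sum>n\<in>{0}. H_inner a (\<lambda>z. p z * F n z) (G n))"
      by (rule suminf_finite) (auto simp: F_def G_def H_inner_zero)
    also have "\<dots> = I p" by (simp add: F_def G_def Ip[OF p])
    also have "\<dots> = (LINT x|\<mu>. p x * 1)"
      unfolding I_def
    proof (rule integral_cong_AE)
      show "(\<lambda>x. indicator E x *\<^sub>R p x) \<in> borel_measurable \<mu>"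
        using ii[OF continuous_on_cpoly[OF p]] by (rule borel_measurable_integrable)
      have "p \<in> borel_measurable borel" by (rule borel_measurable_continuous_onI[OF continuous_on_cpoly[OF p]])
      then have "p \<in> borel_measurable \<mu>" using measurable_cong_sets[OF \<mu>(2) refl] by blast
      then show "(\<lambda>x. p x * 1) \<in> borel_measurable \<mu>" by simp
      show "AE x in \<mu>. indicator E x *\<^sub>R p x = p x * 1" using \<mu>(3) by eventually_elim simp
    qed
    finally show "(LINT x|\<mu>. p x * 1) = (\<Sum>n. H_inner a (\<lambda>z. p z * F n z) (G n))" by simp
  qed
  then have "(\<integral>\<^sup>+x\<in>E. ennreal (cmod 1) \<partial>\<mu>) = 0" using tn unfolding totally_null_def by blast
  moreover have Es: "E \<in> sets \<mu>" using borel_compact[OF E(1)] \<mu>(2) by simp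
  ultimately have "emeasure \<mu> E = 0" by simp
  moreover have "emeasure \<mu> E = 1" using emeasure_eq_1_AE[OF Es \<mu>(3)] .
  ultimately show False by simp
qed

text \<open>With \<open>N = (\<surd>c\<^sub>i K(y\<^sub>i,y\<^sub>j) \<surd>c\<^sub>j)\<close> and \<open>D = diag (k(y\<^sub>i) + s)\<close>, accretivity says
  \<open>N\<^sup>2 \<le> (D - s) N + N (D - s)\<^sup>*\<close>, whence \<open>2 s N \<le> D D\<^sup>*\<close>.\<close>
lemma potential_weighted_bound:
  assumes w: "weight open_ball T c" and s: "0 < s" and h: "H_bound a h C"
  defines "k \<equiv> kernel_comb T (\<lambda>x. of_real (c x))"
  shows "(\<Sum>y\<in>T. c y * (cmod (h y) / cmod (k y + of_real s))\<^sup>2) \<le> C\<^sup>2 / (2 * s)"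
proof -
  have T: "finite T" "T \<subseteq> open_ball" and c0: "\<And>y. y \<in> T \<Longrightarrow> 0 \<le> c y" using w by (auto simp: weight_def)
  define D where "D y = k y + of_real s" for y
  \<comment> \<open>Chosen so that pairing it with \<open>h\<close> gives exactly the sum X to be
    bounded.\<close>
  define e where "e y = of_real (c y) * h y / of_real ((cmod (D y))\<^sup>2)" for y
  define X where "X = (\<Sum>y\<in>T. c y * (cmod (h y) / cmod (D y))\<^sup>2)"
  have X0: "0 \<le> X" unfolding X_def by (intro sum_nonneg mult_nonneg_nonneg c0) auto
  define v where "v = kernel_comb T e"
  have Dnz: "0 < cmod (D y)" if "y \<in> T" for y
  proof -
    have "0 \<le> Re (k y)"
      unfolding k_def kernel_comb_def Re_sum using T c0 that
      by (intro sum_nonneg) (auto intro!: mult_nonneg_nonneg Re_K_nonneg simp: open_ball_def subset_iff less_imp_le)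
    then have "D y \<noteq> 0" using s by (auto simp: D_def complex_eq_iff)
    then show ?thesis by simp
  qed
  have pe: "pairing T e h = of_real X"
    unfolding pairing_def X_def of_real_sum
  proof (rule sum.cong[OF refl])
    fix y
    have "cnj (e y) * h y = of_real (c y) * (h y * cnj (h y)) / of_real ((cmod (D y))\<^sup>2)"
      by (simp add: e_def mult_ac)
    also have "\<dots> = of_real (c y * (cmod (h y) / cmod (D y))\<^sup>2)"
      unfolding complex_norm_square[symmetric] by (simp add: power_divide)
    finally show "cnj (e y) * h y = of_real (c y * (cmod (h y) / cmod (D y))\<^sup>2)" .
  qed
  \<comment> \<open>The adjoint of multiplication by \<open>k\<close>, applied to the coefficients
    \<open>e\<close>.\<close>
  define w where "w y = cnj (k y) * e y" for y
  have "bform T (\<lambda>z v. (k z + cnj (k v) - 1) * K z v - (\<Sum>x\<in>T. of_real (c x) * (K z x * cnj (K v x)))) e e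
      = bform T K w e + bform T K e w - bform T K e e
        - bform T (\<lambda>z v. \<Sum>x\<in>T. of_real (c x) * (K z x * cnj (K v x))) e e"
    unfolding bform_def w_def by (simp add: algebra_simps sum.distrib sum_subtractf)
  also have "bform T K e w = cnj (bform T K w e)" by (rule bform_K_swap[OF T(2)])
  also have "bform T (\<lambda>z v. \<Sum>x\<in>T. of_real (c x) * (K z x * cnj (K v x))) e e
      = (\<Sum>x\<in>T. of_real (c x * (cmod (v x))\<^sup>2))"
    unfolding bform_sum_kernel bform_scale_kernel bform_rank1
  proof (rule sum.cong[OF refl])
    fix x assume x: "x \<in> T"
    have "(\<Sum>y\<in>T. cnj (e y) * K y x) = (\<Sum>y\<in>T. cnj (e y * K x y))"
    proof (rule sum.cong[OF refl])
      fix y assume "y \<in> T"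
      then have "K y x = cnj (K x y)" using x T by (intro K_commute) (auto simp: open_ball_def subset_iff less_imp_le)
      then show "cnj (e y) * K y x = cnj (e y * K x y)" by simp
    qed
    also have "\<dots> = cnj (v x)" by (simp add: v_def kernel_comb_def)
    finally show "of_real (c x) * ((\<Sum>y\<in>T. cnj (e y) * K y x) * cnj (\<Sum>y\<in>T. cnj (e y) * K y x)) = of_real (c x * (cmod (v x))\<^sup>2)"
      by (simp add: complex_norm_square mult.commute del: of_real_power)
  qed
  finally have bf: "bform T (\<lambda>z v. (k z + cnj (k v) - 1) * K z v - (\<Sum>x\<in>T. of_real (c x) * (K z x * cnj (K v x)))) e e
      = bform T K w e + cnj (bform T K w e) - bform T K e e - (\<Sum>x\<in>T. of_real (c x * (cmod (v x))\<^sup>2))" .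
  have "0 \<le> Re (bform T (\<lambda>z v. (k z + cnj (k v) - 1) * K z v - (\<Sum>x\<in>T. of_real (c x) * (K z x * cnj (K v x)))) e e)"
    unfolding k_def by (rule psd_Re[OF psd_kernel_comb_accretive[OF assms(1)] T])
  then have acc: "0 \<le> 2 * Re (bform T K w e) - En T e - (\<Sum>x\<in>T. c x * (cmod (v x))\<^sup>2)"
    unfolding bf En_def by (simp add: Re_sum)
  have "bform T K w e = (\<Sum>y\<in>T. cnj (e y) * k y * v y)"
    by (simp add: bform_def w_def v_def kernel_comb_def sum_distrib_left mult_ac)
  also have "\<dots> = (\<Sum>y\<in>T. cnj (e y) * D y * v y) - of_real s * (\<Sum>y\<in>T. cnj (e y) * v y)"
    by (simp add: D_def sum_distrib_left sum_subtractf[symmetric] algebra_simps)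
  also have "(\<Sum>y\<in>T. cnj (e y) * v y) = of_real (En T e)"
    using pairing_kernel_comb[of T e e] bform_K_self[OF T, of e] by (simp add: v_def pairing_def)
  finally have "2 * Re (bform T K w e) = (\<Sum>y\<in>T. 2 * Re (cnj (e y) * D y * v y)) - 2 * s * En T e"
    by (simp add: Re_sum sum_distrib_left)
  \<comment> \<open>Arithmetic-geometric mean: the terms c |v|^2 created here cancel against the
    subtracted rank-one terms of accretivity, which leaves 2 s En(e) \<le> X.\<close>
  also have "(\<Sum>y\<in>T. 2 * Re (cnj (e y) * D y * v y)) \<le> (\<Sum>y\<in>T. c y * (cmod (h y) / cmod (D y))\<^sup>2 + c y * (cmod (v y))\<^sup>2)"
  proof (rule sum_mono)
    fix y assume y: "y \<in> T"
    have "2 * Re (cnj (e y) * D y * v y) \<le> 2 * cmod (cnj (e y) * D y * v y)"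
      by (intro mult_left_mono complex_Re_le_cmod) simp
    also have "cmod (cnj (e y) * D y * v y) = c y * (cmod (h y) / cmod (D y) * cmod (v y))"
      using Dnz[OF y] c0[OF y] by (simp add: e_def norm_mult norm_divide norm_power power2_eq_square)
    also have "2 * \<dots> \<le> c y * (cmod (h y) / cmod (D y))\<^sup>2 + c y * (cmod (v y))\<^sup>2"
      using mult_left_mono[OF sum_squares_bound[of "cmod (h y) / cmod (D y)" "cmod (v y)"] c0[OF y]]
      by (simp add: algebra_simps)
    finally show "2 * Re (cnj (e y) * D y * v y) \<le> c y * (cmod (h y) / cmod (D y))\<^sup>2 + c y * (cmod (v y))\<^sup>2" by simp
  qed
  finally have "2 * Re (bform T K w e) \<le> X + (\<Sum>y\<in>T. c y * (cmod (v y))\<^sup>2) - 2 * s * En T e"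
    by (simp add: X_def sum.distrib)
  with acc have "2 * s * En T e \<le> X" using En_nonneg[OF T, of e] by linarith
  then have EX: "En T e \<le> X / (2 * s)" using s by (simp add: pos_le_divide_eq mult.commute)
  \<comment> \<open>X now occurs on both sides: X \<le> C sqrt(X / (2 s)) bounds X itself.\<close>
  have "X \<le> C * sqrt (En T e)" using H_boundD(1)[OF h T, of e] X0 by (simp add: pe)
  then have "X\<^sup>2 \<le> (C * sqrt (En T e))\<^sup>2" using X0 by (intro power_mono)
  also have "\<dots> = C\<^sup>2 * En T e" using En_nonneg[OF T, of e] by (simp add: power_mult_distrib)
  also have "\<dots> \<le> C\<^sup>2 * (X / (2 * s))" by (intro mult_left_mono EX) simp
  finally have "X * X \<le> (C\<^sup>2 / (2 * s)) * X" by (simp add: power2_eq_square)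
  then have "X \<le> C\<^sup>2 / (2 * s)"
    using X0 s by (cases "X = 0") (simp_all del: times_divide_eq_left add: mult_le_cancel_right)
  then show ?thesis by (simp add: X_def D_def)
qed

text \<open>The quantity tested is the truncation m = min(1, |f|^2 / L). Its averages over the
  dilated weights are at most 1/2 for large k, whereas divergence of |f| along radii makes its
  integrals against the probability measure \<mu> tend to 1.\<close>

lemma unbounded_capacity_zero:
  fixes E :: "(complex^'d) set"
  assumes E: "compact E" "E \<subseteq> unit_sphere" and f: "in_H a f"
    and unb: "\<And>\<zeta>. \<zeta> \<in> E \<Longrightarrow> filterlim (\<lambda>r::real. cmod (f (r *\<^sub>R \<zeta>))) at_top (at_left 1)"
  shows "capacity_zero E"
proof (rule ccontr)
  assume "\<not> capacity_zero E"
  then obtain M S c t \<mu> where M: "1 \<le> M" and w: "\<And>k::nat. weight E (S k) (c k)"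
    and t: "\<And>k. 0 < t k" "\<And>k. t k < 1" "t \<longlonglongrightarrow> 1" and e: "\<And>k. energy (S k) (c k) (t k) \<le> M"
    and \<mu>: "prob_space \<mu>" "sets \<mu> = sets borel" "AE x in \<mu>. x \<in> E"
    and conv: "\<And>q :: complex^'d \<Rightarrow> complex. continuous_on E q \<Longrightarrow>
      (\<lambda>k. \<Sum>x\<in>S k. of_real (c k x) * q x) \<longlonglongrightarrow> (LINT x|\<mu>. indicator E x *\<^sub>R q x)"
    using not_capacity_zero_limit[OF _ E] by blast
  interpret prob_space \<mu> by (rule \<mu>)
  obtain C where C: "H_bound a f C" using f unfolding in_H_def by blast
  have nE: "norm x = 1" if "x \<in> E" for x using that E by (auto simp: unit_sphere_def)
  have ws: "weight unit_sphere (S k) (c k)" for k using w[of k] E by (auto simp: weight_def)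
  have Sk: "finite (S k)" "S k \<subseteq> unit_sphere" for k using ws[of k] by (auto simp: weight_def)
  \<comment> \<open>The potential contributes 4 M / (2 s) = 1/4 to the average.\<close>
  define s where "s = 8 * M"
  have s: "0 < s" using M by (simp add: s_def)
  \<comment> \<open>The function \<open>f\<close> contributes 2 s C^2 / L \<le> 1/4; the summand 1
    keeps L positive when C = 0.\<close>
  define L where "L = 8 * s * C\<^sup>2 + 1"
  have L: "0 < L" using s by (simp add: L_def add_nonneg_pos)
  define u where "u n = 1 - 1 / real (n + 2)" for n
  have u: "0 < u n" "u n < 1" for n by (auto simp: u_def)
  have ul: "u \<longlonglongrightarrow> 1" unfolding u_def[abs_def] by (rule radii_tendsto)
  have ull: "filterlim u (at_left 1) sequentially"
    unfolding filterlim_at using ul u by (auto intro!: always_eventually simp: less_imp_neq)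
  define m where "m y = min 1 ((cmod (f y))\<^sup>2 / L)" for y
  define q where "q n x = complex_of_real (m (u n *\<^sub>R x))" for n x
  have m01: "0 \<le> m y" "m y \<le> 1" for y using L by (auto simp: m_def)
  have inb: "u n *\<^sub>R x \<in> open_ball" if "x \<in> E" for n x using u[of n] nE[OF that] by (simp add: open_ball_def)
  have qc: "continuous_on E (q n)" for n
  proof -
    have "continuous_on E (\<lambda>x. f (u n *\<^sub>R x))"
      by (rule continuous_on_compose2[OF H_bound_continuous[OF C]]) (use inb in \<open>auto intro!: continuous_intros\<close>)
    then show ?thesis unfolding q_def m_def using L by (intro continuous_intros) auto
  qed
  have bound: "(\<Sum>x\<in>S k. c k x * m (u n *\<^sub>R x)) \<le> 1 / 2" if k: "u n \<le> t k" for n k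
  proof -
    define T where "T = (*\<^sub>R) (u n) ` S k"
    define d where "d y = c k (y /\<^sub>R u n)" for y
    have wT: "weight open_ball T d" unfolding T_def d_def by (rule weight_dilation[OF ws u])
    have T: "finite T" "T \<subseteq> open_ball" using wT by (auto simp: weight_def)
    define p where "p = kernel_comb T (\<lambda>x. of_real (d x))"
    have "u n * u n \<le> u n" using u[of n] by (simp add: mult_left_le)
    then have "u n * u n \<le> t k" using k by simp
    then have "energy (S k) (c k) (u n * u n) \<le> energy (S k) (c k) (t k)"
      by (intro energy_mono Sk t) (use u[of n] k in auto)
    then have "En T (\<lambda>x. of_real (d x)) \<le> M"
      using e[of k] unfolding T_def d_def En_dilation[OF u(1)] by simp
    then have pb: "H_bound a p (sqrt M)"
      unfolding p_def by (intro H_bound_mono[OF H_bound_kernel_comb[OF T]]) simp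
    define \<alpha> where "\<alpha> y = (cmod (p y) / cmod (p y + of_real s))\<^sup>2" for y
    define \<beta> where "\<beta> y = (cmod (f y) / cmod (p y + of_real s))\<^sup>2" for y
    have A1: "(\<Sum>y\<in>T. d y * \<alpha> y) \<le> M / (2 * s)"
      using potential_weighted_bound[OF wT s pb] M by (simp add: \<alpha>_def p_def)
    have A2: "(\<Sum>y\<in>T. d y * \<beta> y) \<le> C\<^sup>2 / (2 * s)"
      using potential_weighted_bound[OF wT s C] by (simp add: \<beta>_def p_def)
    \<comment> \<open>If |p| \<le> s, then |p + s| \<le> 2 s and |f| is controlled by \<beta>.
      Otherwise |p + s| \<le> 2 |p|, so 4 \<alpha> \<ge> 1 and the truncation at 1 suffices.\<close>
    have pw: "m y \<le> 4 * \<alpha> y + 4 * s\<^sup>2 / L * \<beta> y" if y: "y \<in> T" for y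
    proof -
      define Q where "Q = cmod (p y + of_real s)"
      have "0 \<le> Re (p y)"
        unfolding p_def kernel_comb_def Re_sum using wT y
        by (intro sum_nonneg)
           (auto intro!: mult_nonneg_nonneg Re_K_nonneg simp: weight_def open_ball_def subset_iff less_imp_le)
      then have "s \<le> Re (p y + of_real s)" by simp
      also have "\<dots> \<le> Q" unfolding Q_def by (rule complex_Re_le_cmod)
      finally have Q: "0 < Q" using s by simp
      have Qle: "Q \<le> cmod (p y) + s" unfolding Q_def using norm_triangle_ineq[of "p y" "of_real s"] s by simp
      have nn: "0 \<le> \<alpha> y" "0 \<le> \<beta> y" by (simp_all add: \<alpha>_def \<beta>_def)
      show ?thesis
      proof (cases "cmod (p y) \<le> s")
        case True
        have "(cmod (f y))\<^sup>2 = Q\<^sup>2 * \<beta> y" using Q by (simp add: \<beta>_def Q_def[symmetric] power_divide)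
        also have "\<dots> \<le> (2 * s)\<^sup>2 * \<beta> y"
          using Qle True Q nn by (intro mult_right_mono power_mono) auto
        finally have "(cmod (f y))\<^sup>2 / L \<le> (2 * s)\<^sup>2 * \<beta> y / L" using L by (intro divide_right_mono) auto
        then have "m y \<le> 4 * s\<^sup>2 / L * \<beta> y" by (simp add: m_def power_mult_distrib min_le_iff_disj)
        then show ?thesis using nn by simp
      next
        case False
        then have "1 / 2 \<le> cmod (p y) / Q" using Qle Q by (simp add: pos_le_divide_eq)
        then have "(1 / 2)\<^sup>2 \<le> \<alpha> y" unfolding \<alpha>_def Q_def[symmetric] by (intro power_mono) auto
        then have "1 \<le> 4 * \<alpha> y" by (simp add: power_divide)
        moreover have "0 \<le> 4 * s\<^sup>2 / L * \<beta> y" using nn L by simp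
        ultimately show ?thesis using m01(2)[of y] by linarith
      qed
    qed
    have "(\<Sum>x\<in>S k. c k x * m (u n *\<^sub>R x)) = (\<Sum>y\<in>T. d y * m y)"
      unfolding T_def d_def using u(1)[of n] by (subst sum.reindex) (auto simp: inj_on_def)
    also have "\<dots> \<le> (\<Sum>y\<in>T. d y * (4 * \<alpha> y + 4 * s\<^sup>2 / L * \<beta> y))"
      using wT pw by (intro sum_mono mult_left_mono) (auto simp: weight_def)
    also have "\<dots> = 4 * (\<Sum>y\<in>T. d y * \<alpha> y) + 4 * s\<^sup>2 / L * (\<Sum>y\<in>T. d y * \<beta> y)"
      unfolding sum_distrib_left distrib_left sum.distrib by (simp add: mult_ac)
    also have "\<dots> \<le> 4 * (M / (2 * s)) + 4 * s\<^sup>2 / L * (C\<^sup>2 / (2 * s))"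
      using L by (intro add_mono mult_left_mono A1 A2) auto
    also have "\<dots> = 1 / 4 + 2 * s * C\<^sup>2 / L"
      using M s by (simp add: s_def power2_eq_square)
    also have "2 * s * C\<^sup>2 / L \<le> 1 / 4"
      using L s by (simp add: pos_divide_le_eq) (simp add: L_def)
    finally show ?thesis by simp
  qed
  have half: "Re (LINT x|\<mu>. indicator E x *\<^sub>R q n x) \<le> 1 / 2" for n
  proof (rule LIMSEQ_le_const2[OF tendsto_Re[OF conv[OF qc]]])
    obtain k0 where k0: "\<And>k. k \<ge> k0 \<Longrightarrow> u n < t k"
      using order_tendstoD(1)[OF t(3) u(2)[of n]] by (auto simp: eventually_sequentially)
    have "Re (\<Sum>x\<in>S k. of_real (c k x) * q n x) \<le> 1 / 2" if "k \<ge> k0" for k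
      using bound[of n k] k0[OF that] by (simp add: q_def Re_sum)
    then show "\<exists>k0. \<forall>k\<ge>k0. Re (\<Sum>x\<in>S k. of_real (c k x) * q n x) \<le> 1 / 2" by blast
  qed
  have "(\<lambda>n. LINT x|\<mu>. indicator E x *\<^sub>R q n x) \<longlonglongrightarrow> (LINT x|\<mu>. indicator E x *\<^sub>R (1::complex))"
  proof (rule dominated_convergence_compact[OF E(1) \<mu>(1,2) qc])
    show "cmod (q n x) \<le> 1" for n x using m01 by (simp add: q_def)
    show "(\<lambda>n. q n x) \<longlonglongrightarrow> 1" if "x \<in> E" for x
    proof (rule tendsto_eventually)
      have "filterlim (\<lambda>n. cmod (f (u n *\<^sub>R x))) at_top sequentially"
        by (rule filterlim_compose[OF unb[OF that] ull])
      then have "\<forall>\<^sub>F n in sequentially. sqrt L \<le> cmod (f (u n *\<^sub>R x))" by (simp add: filterlim_at_top)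
      then show "\<forall>\<^sub>F n in sequentially. q n x = 1"
      proof eventually_elim
        case (elim n)
        then have "(sqrt L)\<^sup>2 \<le> (cmod (f (u n *\<^sub>R x)))\<^sup>2" using L by (intro power_mono) auto
        then have "1 \<le> (cmod (f (u n *\<^sub>R x)))\<^sup>2 / L" using L by (simp add: pos_le_divide_eq)
        then show ?case by (simp add: q_def m_def)
      qed
    qed
  qed simp
  then have "Re (LINT x|\<mu>. indicator E x *\<^sub>R (1::complex)) \<le> 1 / 2"
    by (intro LIMSEQ_le_const2[OF tendsto_Re]) (use half in auto)
  moreover have "(LINT x|\<mu>. indicator E x *\<^sub>R (1::complex)) = (LINT x|\<mu>. 1)"
    using borel_compact[OF E(1)] \<mu>(2) \<mu>(3) by (intro integral_cong_AE) auto
  ultimately show False by (simp add: prob_space)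
qed

end

theorem theorem1p2:
  fixes a :: "nat \<Rightarrow> real" and E :: "(complex^'d) set"
  assumes "regular_UI a" and "complete_pick a"
    and "compact E" and "E \<subseteq> unit_sphere"
  shows "unboundedness_set a E \<longleftrightarrow> totally_null a E"
proof -
  interpret pick_space a by unfold_locales (use assms in auto)
  have "unboundedness_set a E \<longleftrightarrow> capacity_zero E"
    using unbounded_capacity_zero[OF assms(3,4)] capacity_zero_unbounded[OF _ assms(4)] assms(3,4)
    unfolding unboundedness_set_def by blast
  also have "\<dots> \<longleftrightarrow> totally_null a E"
    using capacity_zero_totally_null[OF _ assms(3,4)] totally_null_capacity_zero[OF assms(3,4)] by blast
  finally show ?thesis .
qed

end
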